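(* For each $d$, let $p=p(d)\in(0,1]$, let $\boldsymbol\theta^{(d)}\in\mathbb R^d$ with $|\boldsymbol\theta^{(d)}|_2=1$, let $\boldsymbol x^{(d)}\in\{-1,1\}^d$, let $\boldsymbol X^{(d)}=\{\boldsymbol X^{(d)}_t\}_{t\ge0}$ be the lazy nearest neighbour random walk (LNNRW) on $\{-1,1\}^d$ with parameter $p$ started at $\boldsymbol X^{(d)}_0=\boldsymbol x^{(d)}$, and set $Y^{(d)}_t:=\langle\boldsymbol\theta^{(d)},\boldsymbol X^{(d)}_t\rangle$ and $y^{(d)}:=Y^{(d)}_0=\langle\boldsymbol\theta^{(d)},\boldsymbol x^{(d)}\rangle$. Let $u\in\mathbb R$ and let $U=\{U_t\}_{t\ge0}$ be the Ornstein-Uhlenbeck process with generator $\frac{\partial^2}{\partial u^2}-u\frac{\partial}{\partial u}$ started at $U_0=u$. If $y^{(d)}\to u$ and $|\boldsymbol\theta^{(d)}|_\infty\to0$ as $d\to\infty$, then the processes $Y^{(d)}=\{Y^{(d)}_t\}_{t\ge0}$ converge weakly (in distribution, as processes) to $U$ as $d\to\infty$.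
   Context: $\langle\cdot,\cdot\rangle$ is the standard inner product on $\mathbb R^d$, $|\cdot|_2$ the Euclidean norm and $|\boldsymbol\theta|_\infty=\max_j|\theta_j|$. LNNRW on $\{-1,1\}^d$ with parameter $p\in(0,1]$ ($p$ may depend on $d$): two vertices of $\{-1,1\}^d$ are nearest neighbours if they differ in exactly one coordinate. At regular clock pulses separated by time intervals of length $\delta:=\frac{2p}{d}$, independently of the past, the walk stays where it is with probability $1-p$, or moves to any given one of its $d$ nearest neighbours with probability $\frac pd$ each. Thus, if $\boldsymbol X^{(d)}(n)$, $n\in\{0,1,2,\dots\}$, denotes the resulting discrete-time Markov chain (position after $n$ clock pulses), then $\boldsymbol X^{(d)}_t=\boldsymbol X^{(d)}(n)$ for $n\delta\le t<(n+1)\delta$. The Ornstein-Uhlenbeck process $U$ is the one-dimensional diffusion with drift coefficient $b(u)=-u$ and diffusion coefficient $a(u)=2$, started at a deterministic point. Weak convergence of processes means weak convergence of their laws on path space, here the Skorokhod space $D([0,\infty),\mathbb R)$ of right-continuous functions with left limits. *)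

theory Defs
  imports "HOL-Probability.Probability"
begin

text \<open>
  A path on \<open>[0,\<infinity>)\<close> is a function on the reals that is extensional on \<open>{0..}\<close>, so that
  equality of paths is equality on \<open>[0,\<infinity>)\<close>.
\<close>

definition cadlag_paths :: "(real \<Rightarrow> real) set" where
  "cadlag_paths = {x \<in> extensional {0..}.
     (\<forall>t\<ge>0. (x \<longlongrightarrow> x t) (at_right t)) \<and> (\<forall>t>0. \<exists>l. (x \<longlongrightarrow> l) (at_left t))}"

text \<open>Strictly increasing functions from \<open>[0,\<infinity>)\<close> onto itself; they are automatically continuous.\<close>

definition time_changes :: "(real \<Rightarrow> real) set" where
  "time_changes = {l. strict_mono_on {0..} l \<and> l ` {0..} = {0..}}"

definition skorokhod_nbhd :: "(real \<Rightarrow> real) \<Rightarrow> real \<Rightarrow> real \<Rightarrow> (real \<Rightarrow> real) set" where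
  "skorokhod_nbhd x T e = {y \<in> cadlag_paths. \<exists>l\<in>time_changes.
     \<forall>t\<in>{0..T}. \<bar>l t - t\<bar> < e \<and> \<bar>y t - x (l t)\<bar> < e}"

text \<open>
  The Skorokhod (J1) topology. The sets \<open>skorokhod_nbhd x T e\<close> are neighbourhoods of \<open>x\<close>
  (they need not be open), and convergence of sequences is the usual one, see
  \<open>limitin_skorokhod_iff\<close> below and Proposition 3.5.3(c) in Ethier and Kurtz, Markov Processes.
\<close>

definition skorokhod :: "(real \<Rightarrow> real) topology" where
  "skorokhod = topology (\<lambda>G. G \<subseteq> cadlag_paths \<and>
     (\<forall>x\<in>G. \<exists>T>0. \<exists>e>0. skorokhod_nbhd x T e \<subseteq> G))"

lemma skorokhod_nbhd_mono:
  "T \<le> T' \<Longrightarrow> e' \<le> e \<Longrightarrow> skorokhod_nbhd x T' e' \<subseteq> skorokhod_nbhd x T e"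
proof
  fix y assume le: "T \<le> T'" "e' \<le> e" and y: "y \<in> skorokhod_nbhd x T' e'"
  then obtain l where "y \<in> cadlag_paths" "l \<in> time_changes"
    and l: "\<forall>t\<in>{0..T'}. \<bar>l t - t\<bar> < e' \<and> \<bar>y t - x (l t)\<bar> < e'"
    by (auto simp: skorokhod_nbhd_def)
  moreover have "\<forall>t\<in>{0..T}. \<bar>l t - t\<bar> < e \<and> \<bar>y t - x (l t)\<bar> < e"
    using l le by (meson atLeastAtMost_iff order_less_le_trans order_trans)
  ultimately show "y \<in> skorokhod_nbhd x T e"
    by (auto simp: skorokhod_nbhd_def)
qed

lemma openin_skorokhod:
  "openin skorokhod G \<longleftrightarrow> G \<subseteq> cadlag_paths \<and>
     (\<forall>x\<in>G. \<exists>T>0. \<exists>e>0. skorokhod_nbhd x T e \<subseteq> G)"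
proof -
  let ?P = "\<lambda>G. G \<subseteq> cadlag_paths \<and> (\<forall>x\<in>G. \<exists>T>0. \<exists>e>0. skorokhod_nbhd x T e \<subseteq> G)"
  have "istopology ?P"
    unfolding istopology_def
  proof (intro conjI allI impI)
    fix S S' assume S: "?P S" and S': "?P S'"
    have "\<exists>T>0. \<exists>e>0. skorokhod_nbhd x T e \<subseteq> S \<inter> S'" if x: "x \<in> S \<inter> S'" for x
    proof -
      obtain T e T' e' where *: "T > 0" "e > 0" "skorokhod_nbhd x T e \<subseteq> S"
        "T' > 0" "e' > 0" "skorokhod_nbhd x T' e' \<subseteq> S'"
        using S S' x by (metis IntD1 IntD2)
      have "skorokhod_nbhd x (max T T') (min e e') \<subseteq> S \<inter> S'"
        using *(3,6) skorokhod_nbhd_mono[of T "max T T'" "min e e'" e x]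
          skorokhod_nbhd_mono[of T' "max T T'" "min e e'" e' x] by auto
      with * show ?thesis by (intro exI[of _ "max T T'"] exI[of _ "min e e'"] conjI) auto
    qed
    then show "\<forall>x\<in>S \<inter> S'. \<exists>T>0. \<exists>e>0. skorokhod_nbhd x T e \<subseteq> S \<inter> S'" by blast
    show "S \<inter> S' \<subseteq> cadlag_paths" using S by blast
  next
    fix K assume K: "\<forall>G\<in>K. ?P G"
    show "\<Union>K \<subseteq> cadlag_paths" using K by blast
    show "\<forall>x\<in>\<Union>K. \<exists>T>0. \<exists>e>0. skorokhod_nbhd x T e \<subseteq> \<Union>K"
      using K by (metis UnionE Union_upper subset_trans)
  qed
  then show ?thesis
    by (simp add: skorokhod_def)
qed

lemma topspace_skorokhod [simp]: "topspace skorokhod = cadlag_paths"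
proof -
  have "openin skorokhod cadlag_paths"
    unfolding openin_skorokhod by (auto simp: skorokhod_nbhd_def intro!: exI[of _ 1])
  moreover have "topspace skorokhod \<subseteq> cadlag_paths"
    using openin_skorokhod openin_topspace by blast
  ultimately show ?thesis
    by (simp add: openin_subset subset_antisym)
qed

lemma time_changes_comp:
  assumes "l \<in> time_changes" "m \<in> time_changes"
  shows "(\<lambda>t. l (m t)) \<in> time_changes"
proof -
  have img: "l ` {0..} = {0..}" "m ` {0..} = {0..}"
    and mono: "strict_mono_on {0..} l" "strict_mono_on {0..} m"
    using assms by (simp_all add: time_changes_def)
  have "l (m s) < l (m t)" if "0 \<le> s" "s < t" for s t
  proof -
    have "m s \<in> {0..}" "m t \<in> {0..}"
      using imageI[of s "{0..}" m] imageI[of t "{0..}" m] img(2) that by simp_all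
    moreover have "m s < m t" using strict_mono_onD[OF mono(2), of s t] that by simp
    ultimately show ?thesis using strict_mono_onD[OF mono(1)] by blast
  qed
  then have "strict_mono_on {0..} (\<lambda>t. l (m t))"
    by (simp add: strict_mono_on_def)
  moreover have "(\<lambda>t. l (m t)) ` {0..} = {0..}"
    by (metis img image_image)
  ultimately show ?thesis by (simp add: time_changes_def)
qed

lemma time_changes_nonneg: "l \<in> time_changes \<Longrightarrow> 0 \<le> t \<Longrightarrow> 0 \<le> l t"
  using imageI[of t "{0..}" l] by (auto simp: time_changes_def)

lemma limitin_skorokhod_iff:
  assumes x: "x \<in> cadlag_paths"
  shows "limitin skorokhod y x sequentially \<longleftrightarrow>
    (\<forall>T>0. \<forall>e>0. \<forall>\<^sub>F n in sequentially. y n \<in> skorokhod_nbhd x T e)"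
proof
  assume lim: "limitin skorokhod y x sequentially"
  show "\<forall>T>0. \<forall>e>0. \<forall>\<^sub>F n in sequentially. y n \<in> skorokhod_nbhd x T e"
  proof (intro allI impI)
    fix T e :: real assume T: "T > 0" and e: "e > 0"
    define G where "G = (\<Union>T'\<in>{T<..}. \<Union>e'\<in>{0<..<e}. skorokhod_nbhd x T' e')"
    have "openin skorokhod G"
      unfolding openin_skorokhod
    proof (intro conjI ballI)
      show "G \<subseteq> cadlag_paths" by (auto simp: G_def skorokhod_nbhd_def)
      fix z assume "z \<in> G"
      then obtain T' e' l where T': "T < T'" and e': "0 < e'" "e' < e" and l: "l \<in> time_changes"
        and zx: "\<And>t. t \<in> {0..T'} \<Longrightarrow> \<bar>l t - t\<bar> < e' \<and> \<bar>z t - x (l t)\<bar> < e'"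
        unfolding G_def skorokhod_nbhd_def by auto
      define r where "r = min ((T' - T) / 2) ((e - e') / 2)"
      have r: "0 < r" "T < T' - r" "e' + r < e"
        using T' e' by (auto simp: r_def min_def field_simps)
      have "skorokhod_nbhd z T' r \<subseteq> G"
      proof
        fix w assume "w \<in> skorokhod_nbhd z T' r"
        then obtain m where w: "w \<in> cadlag_paths" and m: "m \<in> time_changes"
          and wz: "\<And>t. t \<in> {0..T'} \<Longrightarrow> \<bar>m t - t\<bar> < r \<and> \<bar>w t - z (m t)\<bar> < r"
          unfolding skorokhod_nbhd_def by auto
        have "\<bar>l (m t) - t\<bar> < e' + r \<and> \<bar>w t - x (l (m t))\<bar> < e' + r" if t: "t \<in> {0..T' - r}" for t
        proof -
          have a: "\<bar>m t - t\<bar> < r" "\<bar>w t - z (m t)\<bar> < r" using wz[of t] t r by auto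
          have "m t \<in> {0..T'}" using a t time_changes_nonneg[OF m, of t] by auto
          from zx[OF this] a show ?thesis by linarith
        qed
        then have "w \<in> skorokhod_nbhd x (T' - r) (e' + r)"
          using w time_changes_comp[OF l m] unfolding skorokhod_nbhd_def by (auto intro!: bexI[of _ "\<lambda>t. l (m t)"])
        then show "w \<in> G" unfolding G_def using r e' by force
      qed
      then show "\<exists>T>0. \<exists>e>0. skorokhod_nbhd z T e \<subseteq> G"
        using r(1) T T' by (intro exI[of _ T'] exI[of _ r] conjI) simp_all
    qed
    moreover have "x \<in> G"
    proof -
      have "(\<lambda>t. t) \<in> time_changes" by (auto simp: time_changes_def strict_mono_on_def)
      then have "x \<in> skorokhod_nbhd x (T + 1) (e / 2)"
        unfolding skorokhod_nbhd_def using x e by (auto intro!: bexI[of _ "\<lambda>t. t"])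
      then show ?thesis unfolding G_def using e
        by (intro UN_I[of "T + 1"] UN_I[of "e / 2"]) auto
    qed
    ultimately have "\<forall>\<^sub>F n in sequentially. y n \<in> G"
      using lim unfolding limitin_def by blast
    moreover have "G \<subseteq> skorokhod_nbhd x T e"
      unfolding G_def by (intro UN_least skorokhod_nbhd_mono) simp_all
    ultimately show "\<forall>\<^sub>F n in sequentially. y n \<in> skorokhod_nbhd x T e"
      by (meson eventually_mono subsetD)
  qed
next
  assume "\<forall>T>0. \<forall>e>0. \<forall>\<^sub>F n in sequentially. y n \<in> skorokhod_nbhd x T e"
  then show "limitin skorokhod y x sequentially"
    unfolding limitin_def openin_skorokhod topspace_skorokhod
    using x by (blast intro: eventually_mono)
qed

definition borel_of_topology :: "'a topology \<Rightarrow> 'a measure" where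
  "borel_of_topology S = sigma (topspace S) {G. openin S G}"

definition weakly_converges :: "'a topology \<Rightarrow> (nat \<Rightarrow> 'a measure) \<Rightarrow> 'a measure \<Rightarrow> bool" where
  "weakly_converges S \<mu> \<nu> \<longleftrightarrow>
     (\<forall>\<^sub>F n in sequentially. prob_space (\<mu> n) \<and> sets (\<mu> n) = sets (borel_of_topology S)) \<and>
     prob_space \<nu> \<and> sets \<nu> = sets (borel_of_topology S) \<and>
     (\<forall>f. continuous_map S euclideanreal f \<and> bounded (f ` topspace S) \<longrightarrow>
        (\<lambda>n. \<integral>x. f x \<partial>\<mu> n) \<longlonglongrightarrow> (\<integral>x. f x \<partial>\<nu>))"

text \<open>
  If the path map of \<open>Z\<close> is not measurable into the Skorokhod space, the \<open>distr\<close> below is the null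
  measure or not the intended law; in \<open>weakly_converges\<close> the \<open>prob_space\<close> conjuncts are there
  so that genuine laws are asserted.
\<close>

definition path_law :: "'a measure \<Rightarrow> (real \<Rightarrow> 'a \<Rightarrow> real) \<Rightarrow> (real \<Rightarrow> real) measure" where
  "path_law M Z = distr M (borel_of_topology skorokhod) (\<lambda>\<omega>. \<lambda>t\<in>{0..}. Z t \<omega>)"

definition hypercube :: "nat \<Rightarrow> (nat \<Rightarrow> real) set" where
  "hypercube d = {..<d} \<rightarrow>\<^sub>E {-1, 1}"

definition nearest_neighbours :: "nat \<Rightarrow> (nat \<Rightarrow> real) \<Rightarrow> (nat \<Rightarrow> real) \<Rightarrow> bool" where
  "nearest_neighbours d v w \<longleftrightarrow> card {i \<in> {..<d}. v i \<noteq> w i} = 1"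

definition lnnrw_transition :: "nat \<Rightarrow> real \<Rightarrow> (nat \<Rightarrow> real) \<Rightarrow> (nat \<Rightarrow> real) \<Rightarrow> real" where
  "lnnrw_transition d p v w =
     (if w = v then 1 - p else if nearest_neighbours d v w then p / real d else 0)"

definition lnnrw :: "nat \<Rightarrow> real \<Rightarrow> (nat \<Rightarrow> real) \<Rightarrow> 'a measure \<Rightarrow> (nat \<Rightarrow> 'a \<Rightarrow> nat \<Rightarrow> real) \<Rightarrow> bool" where
  "lnnrw d p x M X \<longleftrightarrow>
     prob_space M \<and>
     (\<forall>n. X n \<in> M \<rightarrow>\<^sub>M count_space (hypercube d)) \<and>
     (AE \<omega> in M. X 0 \<omega> = x) \<and>
     (\<forall>n h. \<forall>w\<in>hypercube d.
        \<P>(\<omega> in M. \<forall>k\<le>n. X k \<omega> = h k) \<noteq> 0 \<longrightarrow>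
        \<P>(\<omega> in M. X (Suc n) \<omega> = w \<bar> \<forall>k\<le>n. X k \<omega> = h k) = lnnrw_transition d p (h n) w)"

text \<open>The walk in continuous time: position \<open>X n\<close> during \<open>n * (2p/d) \<le> t < (n + 1) * (2p/d)\<close>.\<close>

definition lnnrw_at :: "nat \<Rightarrow> real \<Rightarrow> (nat \<Rightarrow> 'a \<Rightarrow> nat \<Rightarrow> real) \<Rightarrow> real \<Rightarrow> 'a \<Rightarrow> nat \<Rightarrow> real" where
  "lnnrw_at d p X t = X (nat \<lfloor>t / (2 * p / real d)\<rfloor>)"

definition natural_filtration :: "'a measure \<Rightarrow> (real \<Rightarrow> 'a \<Rightarrow> real) \<Rightarrow> real \<Rightarrow> 'a measure" where
  "natural_filtration M U t =
     sigma (space M) {U r -` A \<inter> space M | r A. 0 \<le> r \<and> r \<le> t \<and> A \<in> sets borel}"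

definition martingale :: "'a measure \<Rightarrow> (real \<Rightarrow> 'a measure) \<Rightarrow> (real \<Rightarrow> 'a \<Rightarrow> real) \<Rightarrow> bool" where
  "martingale M F Z \<longleftrightarrow>
     (\<forall>t\<ge>0. integrable M (Z t) \<and> Z t \<in> borel_measurable (F t)) \<and>
     (\<forall>s\<ge>0. \<forall>t\<ge>s. AE \<omega> in M. real_cond_exp M (F s) (Z t) \<omega> = Z s \<omega>)"

definition diffusion_generator ::
    "(real \<Rightarrow> real) \<Rightarrow> (real \<Rightarrow> real) \<Rightarrow> (real \<Rightarrow> real) \<Rightarrow> real \<Rightarrow> real" where
  "diffusion_generator b a f v = a v / 2 * deriv (deriv f) v + b v * deriv f v"

definition C2_compact_support :: "(real \<Rightarrow> real) set" where
  "C2_compact_support = {f. (\<forall>v. f differentiable (at v)) \<and> (\<forall>v. deriv f differentiable (at v)) \<and>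
     continuous_on UNIV (deriv (deriv f)) \<and> compact (closure {v. f v \<noteq> 0})}"

text \<open>
  The diffusion with drift coefficient \<open>b\<close> and diffusion coefficient \<open>a\<close> started at \<open>u\<close>, in the
  sense of Stroock and Varadhan: a continuous process solving the martingale problem for its
  generator.
\<close>

definition diffusion_from ::
    "(real \<Rightarrow> real) \<Rightarrow> (real \<Rightarrow> real) \<Rightarrow> real \<Rightarrow> 'a measure \<Rightarrow> (real \<Rightarrow> 'a \<Rightarrow> real) \<Rightarrow> bool" where
  "diffusion_from b a u M U \<longleftrightarrow>
     prob_space M \<and>
     (\<forall>t\<ge>0. U t \<in> borel_measurable M) \<and>
     (\<forall>\<omega>\<in>space M. continuous_on {0..} (\<lambda>t. U t \<omega>)) \<and>
     (AE \<omega> in M. U 0 \<omega> = u) \<and>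
     (\<forall>f\<in>C2_compact_support. martingale M (natural_filtration M U)
        (\<lambda>t \<omega>. f (U t \<omega>) - f (U 0 \<omega>)
              - integral {0..t} (\<lambda>s. diffusion_generator b a f (U s \<omega>))))"

definition ornstein_uhlenbeck_from :: "real \<Rightarrow> 'a measure \<Rightarrow> (real \<Rightarrow> 'a \<Rightarrow> real) \<Rightarrow> bool" where
  "ornstein_uhlenbeck_from = diffusion_from (\<lambda>v. - v) (\<lambda>v. 2)"

end

(*
  (1) The limit U. Applying the martingale problem to the functions
  exp(c_r) cos(l_r x + a), where l_r = l exp(r - T) and c_r is such that they solve the backward
  equation, shows that U_t - exp(-(t - s)) U_s is independent of the past up to time s and centred
  Gaussian with variance 1 - exp(-2(t - s)). These functions have no compact support; they are
  multiplied by a cutoff in log(1 + x^2), which the generator maps to O(1/R) uniformly in x, so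
  that no moment bound on U is needed.

  (2) The walk. With dt = 2p/d the increments Y_(n+1) - (1 - dt) Y_n are martingale differences
  with conditional variance 2 dt - dt^2 Y_n^2, bounded by a multiple of max |theta_i|. A
  characteristic function computation gives the same Gaussian noises in the limit, jointly over
  finitely many times, and a fourth moment bound for stopped sums controls the oscillations.

  (3) Instead of tightness in the Skorokhod space and Prokhorov's theorem, a bounded continuous
  functional f is approximated from below by its Lipschitz envelopes
  inf_y f(y) + m sup_(t <= m) min(1, |x(t) - y(t)|). On paths sampled on a grid these are Lipschitz
  functions of finitely many coordinates, and the oscillation bound controls the error made by
  sampling.
*)
theory Submission
  imports Defs
begin

section \<open>Lipschitz envelopes and weak convergence of paths\<close>

text \<open>Joint convergence at grid times is reduced to one-dimensional statements. With spacing h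
  = 1/k both processes obey Z_(i+1) = exp(-h) Z_i + noise, so the grid values are a Lipschitz
  function of the start and the normalised noises, and it suffices that the noises become
  independent standard normals. This is tested on boxes, one coordinate at a time: that the earlier
  noises lie in a box is an event of the past, and on it the next noise is handled by the
  one-dimensional continuity theorem. The same box computation, applied to U as a constant sequence,
  identifies the law of U on the grid.

  Fourth moments enter because about kT grid intervals of length 1/k are united. A second moment
  bound gives O(1/k) per interval, so the sum does not decay; the fourth moment gives O(1/k^2), up
  to a term of order kappa^2/k that vanishes as d grows with k fixed. Hence d tends to infinity
  before k.

  One-sided approximation suffices, since lower bounds for f + B and for B - f together give
  convergence of the expectations.\<close>

definition capped_dist :: "nat \<Rightarrow> (real \<Rightarrow> real) \<Rightarrow> (real \<Rightarrow> real) \<Rightarrow> real" where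
  "capped_dist m x y = (SUP t\<in>{0..real m}. min 1 \<bar>x t - y t\<bar>)"

text \<open>The inf-convolution of \<open>f\<close> with a multiple of the truncated uniform
  distance. The index \<open>m\<close> is both the slope and the time horizon, so a single limit in
  \<open>m\<close> recovers \<open>f\<close>.\<close>

definition envelope :: "((real \<Rightarrow> real) \<Rightarrow> real) \<Rightarrow> nat \<Rightarrow> (real \<Rightarrow> real) \<Rightarrow> real" where
  "envelope f m x = (INF y\<in>cadlag_paths. f y + real m * capped_dist m x y)"

text \<open>Left-endpoint sampling on the grid of mesh \<open>1 / k\<close>. On
  \<open>{0..real m}\<close> only the finitely many grid values with index at most
  \<open>k * m\<close> occur.\<close>

definition sampled :: "nat \<Rightarrow> (real \<Rightarrow> real) \<Rightarrow> real \<Rightarrow> real" where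
  "sampled k x t = x (real (nat \<lfloor>real k * t\<rfloor>) / real k)"

text \<open>The cap at 1 bounds the set under the supremum, so this holds for arbitrary functions,
  bounded on the interval or not.\<close>

lemma capped_dist_upper:
  "t \<in> {0..real m} \<Longrightarrow> min 1 \<bar>x t - y t\<bar> \<le> capped_dist m x y"
  unfolding capped_dist_def by (rule cSUP_upper) (auto intro!: bdd_aboveI2[where M=1])

lemma capped_dist_least:
  "(\<And>t. t \<in> {0..real m} \<Longrightarrow> min 1 \<bar>x t - y t\<bar> \<le> c) \<Longrightarrow> capped_dist m x y \<le> c"
  unfolding capped_dist_def by (rule cSUP_least) auto

lemma capped_dist_nonneg: "0 \<le> capped_dist m x y"
proof -
  have "0 \<le> min 1 \<bar>x 0 - y 0\<bar>" by simp
  also have "\<dots> \<le> capped_dist m x y" by (rule capped_dist_upper) simp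
  finally show ?thesis .
qed

lemma capped_dist_le_1: "capped_dist m x y \<le> 1"
  by (rule capped_dist_least) simp

lemma capped_dist_self: "capped_dist m x x = 0"
  using capped_dist_least[of m x x 0] capped_dist_nonneg[of m x x] by simp

text \<open>Makes the infimum in \<open>envelope\<close> run over a nonempty set, as
  \<open>cINF_greatest\<close> requires.\<close>

lemma cadlag_paths_nonempty: "cadlag_paths \<noteq> {}"
proof -
  have "restrict (\<lambda>_. 0) {0..} \<in> cadlag_paths"
    unfolding cadlag_paths_def
  proof (intro CollectI conjI allI impI)
    fix t :: real assume t: "0 \<le> t"
    have "eventually (\<lambda>s. restrict (\<lambda>_. 0) {0..} s = (0::real)) (at_right t)"
      using t by (auto simp: eventually_at_filter)
    then show "(restrict (\<lambda>_. 0) {0..} \<longlongrightarrow> restrict (\<lambda>_. 0::real) {0..} t) (at_right t)"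
      using t by (simp add: tendsto_eventually)
  next
    fix t :: real assume t: "0 < t"
    have "eventually (\<lambda>s. s \<in> {0<..<t}) (at_left t)"
      using t eventually_at_left_real by blast
    then have "eventually (\<lambda>s. restrict (\<lambda>_. 0) {0..} s = (0::real)) (at_left t)"
      by eventually_elim auto
    then show "\<exists>l. (restrict (\<lambda>_. 0::real) {0..} \<longlongrightarrow> l) (at_left t)"
      using tendsto_eventually by blast
  qed auto
  then show ?thesis by blast
qed

text \<open>Nonnegativity of \<open>f\<close> provides the lower bound without which the infimum is
  meaningless. Bounded functionals are shifted to this case in
  \<open>weakly_converges_skorokhodI\<close>.\<close>

lemma envelope_lower:
  assumes "\<forall>y\<in>cadlag_paths. 0 \<le> f y" "y \<in> cadlag_paths"
  shows "envelope f m x \<le> f y + real m * capped_dist m x y"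
  unfolding envelope_def using assms capped_dist_nonneg
  by (intro cINF_lower) (auto intro!: bdd_belowI2[where m=0] add_nonneg_nonneg)

lemma envelope_greatest:
  "(\<And>y. y \<in> cadlag_paths \<Longrightarrow> c \<le> f y + real m * capped_dist m x y) \<Longrightarrow> c \<le> envelope f m x"
  unfolding envelope_def using cadlag_paths_nonempty by (intro cINF_greatest)

lemma envelope_le:
  assumes "\<forall>y\<in>cadlag_paths. 0 \<le> f y" "x \<in> cadlag_paths"
  shows "envelope f m x \<le> f x"
  using envelope_lower[of f x m x] assms capped_dist_self by simp

lemma envelope_nonneg:
  assumes "\<forall>y\<in>cadlag_paths. 0 \<le> f y"
  shows "0 \<le> envelope f m x"
  by (rule envelope_greatest) (use assms capped_dist_nonneg in auto)

text \<open>Any single path \<open>y\<close> serves as competitor. The argument \<open>x\<close>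
  ranges over all functions because the bound is applied to sampled paths.\<close>

lemma envelope_bound:
  assumes "\<forall>y\<in>cadlag_paths. 0 \<le> f y \<and> f y \<le> B"
  shows "envelope f m x \<le> B + real m"
proof -
  obtain y where y: "y \<in> cadlag_paths" using cadlag_paths_nonempty by blast
  have "envelope f m x \<le> f y + real m * capped_dist m x y" using assms y by (intro envelope_lower) auto
  also have "\<dots> \<le> B + real m * 1"
    using bspec[OF assms y] capped_dist_le_1 by (intro add_mono mult_left_mono) auto
  finally show ?thesis by simp
qed

lemma envelope_lipschitz:
  assumes f: "\<forall>y\<in>cadlag_paths. 0 \<le> f y"
    and e: "\<And>t. t \<in> {0..real m} \<Longrightarrow> \<bar>x t - x' t\<bar> \<le> e"
  shows "envelope f m x \<le> envelope f m x' + real m * e"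
proof -
  have e0: "0 \<le> e" using e[of 0] by (simp add: order_trans[OF abs_ge_zero])
  have "envelope f m x - real m * e \<le> f y + real m * capped_dist m x' y" if y: "y \<in> cadlag_paths" for y
  proof -
    have "capped_dist m x y \<le> capped_dist m x' y + e"
    proof (rule capped_dist_least)
      fix t assume t: "t \<in> {0..real m}"
      have "min 1 \<bar>x t - y t\<bar> \<le> min 1 \<bar>x' t - y t\<bar> + e" using e[OF t] e0 by linarith
      then show "min 1 \<bar>x t - y t\<bar> \<le> capped_dist m x' y + e"
        using capped_dist_upper[OF t, of x' y] by linarith
    qed
    then have "real m * capped_dist m x y \<le> real m * (capped_dist m x' y + e)"
      by (intro mult_left_mono) auto
    then show ?thesis using envelope_lower[OF f y, of m x] by (simp add: algebra_simps)
  qed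
  then have "envelope f m x - real m * e \<le> envelope f m x'" by (rule envelope_greatest)
  then show ?thesis by simp
qed

text \<open>In particular a path and its restriction to \<open>{0..}\<close> have the same envelope,
  which bridges processes and the extensional elements of \<open>cadlag_paths\<close>.\<close>

lemma envelope_cong:
  assumes "\<forall>y\<in>cadlag_paths. 0 \<le> f y"
    and "\<And>t. t \<in> {0..real m} \<Longrightarrow> x t = x' t"
  shows "envelope f m x = envelope f m x'"
  using envelope_lipschitz[of f m x x' 0] envelope_lipschitz[of f m x' x 0] assms
  by (intro antisym) auto

text \<open>Only the identity time change is needed: the locally uniform neighbourhoods of a path are
  contained in its Skorokhod neighbourhoods.\<close>

lemma envelope_tendsto:
  assumes f: "\<forall>y\<in>cadlag_paths. 0 \<le> f y \<and> f y \<le> B"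
    and lsc: "\<And>c. openin skorokhod {y \<in> cadlag_paths. c < f y}"
    and x: "x \<in> cadlag_paths"
  shows "(\<lambda>m. envelope f m x) \<longlonglongrightarrow> f x"
proof (rule order_tendstoI)
  fix c assume "f x < c"
  then show "\<forall>\<^sub>F m in sequentially. envelope f m x < c"
    using envelope_le[of f x] f x by (intro always_eventually allI) (metis order_le_less_trans)
next
  fix c' assume "c' < f x"
  then obtain c where c: "c' < c" "c < f x" using dense by blast
  have "x \<in> {y \<in> cadlag_paths. c < f y}" using x c by simp
  then obtain T e where T: "T > 0" "e > 0" and sub: "skorokhod_nbhd x T e \<subseteq> {y \<in> cadlag_paths. c < f y}"
    using lsc[of c] unfolding openin_skorokhod by blast
  \<comment> \<open>Below 1 the capped distance controls the true distance, so
    \<open>capped_dist m x y < r\<close> gives uniform closeness within \<open>e\<close>.\<close>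
  define r where "r = min 1 e"
  have r: "0 < r" "r \<le> 1" "r \<le> e" using T by (auto simp: r_def)
  \<comment> \<open>The first condition makes the horizon contain \<open>{0..T}\<close>. The second
    makes the penalty \<open>real m * r\<close> at least \<open>B\<close>, so competitors at capped
    distance at least \<open>r\<close> cannot bring the infimum below \<open>c\<close>.\<close>
  have "c \<le> envelope f m x" if m: "T \<le> real m" "B / r \<le> real m" for m
  proof (rule envelope_greatest)
    fix y assume y: "y \<in> cadlag_paths"
    show "c \<le> f y + real m * capped_dist m x y"
    proof (cases "capped_dist m x y < r")
      case True
      have "\<bar>y t - x t\<bar> < e" if t: "t \<in> {0..T}" for t
      proof -
        have "min 1 \<bar>x t - y t\<bar> < r"
          using capped_dist_upper[of t m x y] t m True by auto
        then show ?thesis using r by linarith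
      qed
      moreover have "(\<lambda>t. t) \<in> time_changes" by (auto simp: time_changes_def strict_mono_on_def)
      ultimately have "y \<in> skorokhod_nbhd x T e"
        using y T unfolding skorokhod_nbhd_def by (auto intro!: bexI[of _ "\<lambda>t. t"])
      then have "c < f y" using sub by auto
      moreover have "0 \<le> real m * capped_dist m x y" using capped_dist_nonneg by simp
      ultimately show ?thesis by linarith
    next
      case False
      have "c \<le> B" using c bspec[OF f x] by simp
      also have "B \<le> real m * r" using m r by (simp add: field_simps)
      also have "\<dots> \<le> real m * capped_dist m x y" using False by (intro mult_left_mono) auto
      finally show ?thesis using bspec[OF f y] by linarith
    qed
  qed
  moreover have "\<forall>\<^sub>F m in sequentially. T \<le> real m \<and> B / r \<le> real m"
    by (intro eventually_conj; use filterlim_real_sequentially in \<open>auto simp: filterlim_at_top\<close>)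
  ultimately show "\<forall>\<^sub>F m in sequentially. c' < envelope f m x"
    using c(1) by (auto elim!: eventually_mono intro: order_less_le_trans)
qed

section \<open>Continuous paths and sampling on a grid\<close>

lemma continuous_imp_cadlag:
  assumes "continuous_on {0..} x"
  shows "restrict x {0..} \<in> cadlag_paths"
  unfolding cadlag_paths_def
proof (intro CollectI conjI allI impI)
  fix t :: real assume t: "0 \<le> t"
  have "(x \<longlongrightarrow> x t) (at t within {0..})" using assms t by (simp add: continuous_on_def)
  then have "(x \<longlongrightarrow> x t) (at_right t)"
    by (rule tendsto_within_subset) (use t in auto)
  moreover have "eventually (\<lambda>s. x s = restrict x {0..} s) (at_right t)"
    using t by (auto simp: eventually_at_filter)
  ultimately have "(restrict x {0..} \<longlongrightarrow> x t) (at_right t)"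
    using tendsto_cong by blast
  then show "(restrict x {0..} \<longlongrightarrow> restrict x {0..} t) (at_right t)"
    using t by simp
next
  fix t :: real assume t: "0 < t"
  have "(x \<longlongrightarrow> x t) (at t within {0..})" using assms t by (simp add: continuous_on_def)
  then have "(x \<longlongrightarrow> x t) (at t within {0<..<t})"
    by (rule tendsto_within_subset) auto
  moreover have "at t within {0<..<t} = at_left t"
    using t by (intro at_within_nhd[of t "{0<..}"]) auto
  ultimately have lim: "(x \<longlongrightarrow> x t) (at_left t)" by simp
  have "eventually (\<lambda>s. s \<in> {0<..<t}) (at_left t)"
    using t eventually_at_left_real by blast
  then have "eventually (\<lambda>s. x s = restrict x {0..} s) (at_left t)"
    by eventually_elim auto
  with lim show "\<exists>l. (restrict x {0..} \<longlongrightarrow> l) (at_left t)"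
    using tendsto_cong by blast
qed auto

lemma sampled_index_le:
  assumes "0 \<le> t" "t \<le> real m"
  shows "nat \<lfloor>real k * t\<rfloor> \<le> k * m"
proof -
  have "real k * t \<le> real (k * m)" using assms by (simp add: mult_left_mono)
  then have "\<lfloor>real k * t\<rfloor> \<le> int (k * m)" by linarith
  then show ?thesis by linarith
qed

lemma sampled_time:
  assumes "0 < k" "0 \<le> t"
  shows "real (nat \<lfloor>real k * t\<rfloor>) / real k \<le> t" "t < real (nat \<lfloor>real k * t\<rfloor>) / real k + 1 / real k"
proof -
  have "0 \<le> real k * t" using assms by simp
  then have "real (nat \<lfloor>real k * t\<rfloor>) \<le> real k * t" "real k * t < real (nat \<lfloor>real k * t\<rfloor>) + 1"
    by linarith+
  then show "real (nat \<lfloor>real k * t\<rfloor>) / real k \<le> t" "t < real (nat \<lfloor>real k * t\<rfloor>) / real k + 1 / real k"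
    using assms by (simp_all add: field_simps)
qed

text \<open>Composed with sampling, the envelope becomes a function of finitely many coordinates;
  their sum of differences dominates the uniform distance on the horizon.\<close>

lemma envelope_sampled_lipschitz:
  assumes f: "\<forall>y\<in>cadlag_paths. 0 \<le> f y"
  shows "\<bar>envelope f m (\<lambda>t. z (nat \<lfloor>real k * t\<rfloor>)) - envelope f m (\<lambda>t. z' (nat \<lfloor>real k * t\<rfloor>))\<bar>
    \<le> real m * (\<Sum>j\<le>k * m. \<bar>z j - z' j\<bar>)"
proof -
  have "\<bar>z (nat \<lfloor>real k * t\<rfloor>) - z' (nat \<lfloor>real k * t\<rfloor>)\<bar> \<le> (\<Sum>j\<le>k * m. \<bar>z j - z' j\<bar>)"
    if "t \<in> {0..real m}" for t
    using that sampled_index_le[of t m k]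
    by (intro member_le_sum[of "nat \<lfloor>real k * t\<rfloor>" "{..k * m}" "\<lambda>j. \<bar>z j - z' j\<bar>"]) auto
  then have "envelope f m (\<lambda>t. z (nat \<lfloor>real k * t\<rfloor>)) \<le> envelope f m (\<lambda>t. z' (nat \<lfloor>real k * t\<rfloor>))
      + real m * (\<Sum>j\<le>k * m. \<bar>z j - z' j\<bar>)"
    "envelope f m (\<lambda>t. z' (nat \<lfloor>real k * t\<rfloor>)) \<le> envelope f m (\<lambda>t. z (nat \<lfloor>real k * t\<rfloor>))
      + real m * (\<Sum>j\<le>k * m. \<bar>z j - z' j\<bar>)"
    by (intro envelope_lipschitz[OF f]; simp add: abs_minus_commute)+
  then show ?thesis by linarith
qed

text \<open>Such an \<open>F\<close> is continuous for the product topology on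
  \<open>nat \<Rightarrow> real\<close>, whose Borel sets are generated by the coordinates.\<close>

lemma lipschitz_sum_measurable:
  fixes F :: "(nat \<Rightarrow> real) \<Rightarrow> real"
  assumes F: "\<And>x y. \<bar>F x - F y\<bar> \<le> L * (\<Sum>j\<in>J. \<bar>x j - y j\<bar>)"
    and J: "finite J" and Z: "\<And>j. Z j \<in> borel_measurable M"
  shows "(\<lambda>\<omega>. F (\<lambda>j. Z j \<omega>)) \<in> borel_measurable M"
proof -
  have "continuous_on UNIV F"
    unfolding continuous_on_def
  proof
    fix x :: "nat \<Rightarrow> real"
    have "((\<lambda>y. y j) \<longlongrightarrow> x j) (at x)" for j :: nat
    proof -
      have "continuous_on UNIV (\<lambda>y::nat \<Rightarrow> real. y j)" by simp
      then show ?thesis by (simp only: continuous_on_def) blast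
    qed
    then have "((\<lambda>y. L * (\<Sum>j\<in>J. \<bar>y j - x j\<bar>)) \<longlongrightarrow> L * (\<Sum>j\<in>J. \<bar>x j - x j\<bar>)) (at x)"
      by (intro tendsto_intros)
    then have "((\<lambda>y. L * (\<Sum>j\<in>J. \<bar>y j - x j\<bar>)) \<longlongrightarrow> 0) (at x)" by simp
    then have "((\<lambda>y. F y - F x) \<longlongrightarrow> 0) (at x)"
      by (rule tendsto_0_le[where K=1]) (auto intro!: always_eventually order_trans[OF F])
    then show "(F \<longlongrightarrow> F x) (at x)" by (simp add: LIM_zero_iff)
  qed
  then have "F \<in> borel_measurable borel" by (rule borel_measurable_continuous_onI)
  moreover have "(\<lambda>\<omega> j. Z j \<omega>) \<in> measurable M borel"
    using Z by (rule measurable_coordinatewise_then_product)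
  ultimately show ?thesis by measurable
qed

lemma sampled_tendsto:
  assumes x: "continuous_on {0..} x" and e: "0 < e"
  shows "\<forall>\<^sub>F k in sequentially. \<forall>t\<in>{0..real m}. \<bar>x t - sampled k x t\<bar> \<le> e"
proof -
  have "uniformly_continuous_on {0..real m} x"
    using x by (intro compact_uniformly_continuous continuous_on_subset[OF x]) auto
  then obtain r where r: "r > 0"
    and u: "\<And>s t. s \<in> {0..real m} \<Longrightarrow> t \<in> {0..real m} \<Longrightarrow> dist s t < r \<Longrightarrow> dist (x s) (x t) < e"
    using e unfolding uniformly_continuous_on_def by metis
  have "\<bar>x t - sampled k x t\<bar> \<le> e" if k: "1 / r < real k" and t: "t \<in> {0..real m}" for k t
  proof -
    have k0: "0 < k" using k r by (metis less_trans zero_less_divide_1_iff of_nat_0_less_iff)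
    have "1 / real k < r" using k k0 r by (simp add: field_simps)
    then show ?thesis
      using sampled_time[OF k0, of t] t u[of t "real (nat \<lfloor>real k * t\<rfloor>) / real k"] k0
      unfolding sampled_def dist_real_def by fastforce
  qed
  moreover have "\<forall>\<^sub>F k in sequentially. 1 / r < real k"
    using filterlim_real_sequentially by (auto simp: filterlim_at_top_dense)
  ultimately show ?thesis by (auto elim!: eventually_mono)
qed

lemma envelope_sampled_tendsto:
  assumes f: "\<forall>y\<in>cadlag_paths. 0 \<le> f y" and x: "continuous_on {0..} x"
  shows "(\<lambda>k. envelope f m (sampled k x)) \<longlonglongrightarrow> envelope f m x"
proof (rule LIMSEQ_I)
  fix r :: real assume r: "r > 0"
  define e where "e = r / (2 * (real m + 1))"
  have e: "0 < e" "real m * e < r"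
    using r by (auto simp: e_def field_simps intro!: add_nonneg_pos)
  have "\<forall>\<^sub>F k in sequentially. norm (envelope f m (sampled k x) - envelope f m x) < r"
    using sampled_tendsto[OF x e(1), of m]
  proof eventually_elim
    case (elim k)
    then have "envelope f m x \<le> envelope f m (sampled k x) + real m * e"
      "envelope f m (sampled k x) \<le> envelope f m x + real m * e"
      by (intro envelope_lipschitz[OF f]; simp add: abs_minus_commute)+
    then show ?case using e by simp
  qed
  then show "\<exists>no. \<forall>n\<ge>no. norm (envelope f m (sampled n x) - envelope f m x) < r"
    by (simp add: eventually_sequentially)
qed

text \<open>The envelope is an infimum over uncountably many paths; after sampling, its
  measurability follows from the dependence on finitely many coordinates.\<close>

lemma envelope_sampled_measurable:
  assumes f: "\<forall>y\<in>cadlag_paths. 0 \<le> f y"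
    and Z: "\<And>t. 0 \<le> t \<Longrightarrow> Z t \<in> borel_measurable M"
  shows "(\<lambda>\<omega>. envelope f m (sampled k (\<lambda>t. Z t \<omega>))) \<in> borel_measurable M"
  unfolding sampled_def
  by (rule lipschitz_sum_measurable[where F="\<lambda>z. envelope f m (\<lambda>t. z (nat \<lfloor>real k * t\<rfloor>))"
        and Z="\<lambda>j. Z (real j / real k)", OF envelope_sampled_lipschitz[OF f]])
     (auto intro!: Z)

lemma envelope_continuous_measurable:
  assumes f: "\<forall>y\<in>cadlag_paths. 0 \<le> f y"
    and Z: "\<And>t. 0 \<le> t \<Longrightarrow> Z t \<in> borel_measurable M"
    and cont: "\<And>\<omega>. \<omega> \<in> space M \<Longrightarrow> continuous_on {0..} (\<lambda>t. Z t \<omega>)"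
  shows "(\<lambda>\<omega>. envelope f m (\<lambda>t. Z t \<omega>)) \<in> borel_measurable M"
  by (rule borel_measurable_LIMSEQ_metric[OF envelope_sampled_measurable[OF f Z]])
     (auto intro!: envelope_sampled_tendsto[OF f] cont)

section \<open>Measurability of path maps into the Skorokhod space\<close>

lemma openin_skorokhod_subset: "openin skorokhod G \<Longrightarrow> G \<subseteq> cadlag_paths"
  by (simp add: openin_skorokhod)

lemma space_borel_of_skorokhod [simp]: "space (borel_of_topology skorokhod) = cadlag_paths"
  unfolding borel_of_topology_def by (subst space_measure_of) (auto dest: openin_skorokhod_subset)

lemma sets_borel_of_skorokhod:
  "sets (borel_of_topology skorokhod) = sigma_sets cadlag_paths {G. openin skorokhod G}"
  unfolding borel_of_topology_def by (subst sets_measure_of) (auto dest: openin_skorokhod_subset)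

text \<open>The indicator function of an open set is lower semicontinuous, hence a limit of envelopes.\<close>

lemma path_measurableI:
  assumes path: "\<And>\<omega>. \<omega> \<in> space M \<Longrightarrow> (\<lambda>t\<in>{0..}. Z t \<omega>) \<in> cadlag_paths"
    and env: "\<And>f m. (\<forall>y\<in>cadlag_paths. 0 \<le> f y) \<Longrightarrow>
      (\<lambda>\<omega>. envelope f m (\<lambda>t. Z t \<omega>)) \<in> borel_measurable M"
  shows "(\<lambda>\<omega>. \<lambda>t\<in>{0..}. Z t \<omega>) \<in> M \<rightarrow>\<^sub>M borel_of_topology skorokhod"
proof (rule measurable_sigma_sets[OF sets_borel_of_skorokhod])
  show "{G. openin skorokhod G} \<subseteq> Pow cadlag_paths" by (auto dest: openin_skorokhod_subset)
  show "(\<lambda>\<omega>. \<lambda>t\<in>{0..}. Z t \<omega>) \<in> space M \<rightarrow> cadlag_paths" using path by auto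
  fix G assume "G \<in> {G. openin skorokhod G}"
  then have G: "openin skorokhod G" by simp
  let ?f = "indicat_real G"
  have f0: "\<forall>y\<in>cadlag_paths. 0 \<le> ?f y" and f1: "\<forall>y\<in>cadlag_paths. 0 \<le> ?f y \<and> ?f y \<le> 1"
    by (simp_all add: indicator_def)
  have lsc: "openin skorokhod {y \<in> cadlag_paths. c < ?f y}" for c
  proof -
    have G_sub: "G \<subseteq> cadlag_paths" using openin_skorokhod_subset[OF G] .
    consider "c < 0" | "0 \<le> c" "c < 1" | "1 \<le> c" by linarith
    then show ?thesis
    proof cases
      case 1
      then have "{y \<in> cadlag_paths. c < ?f y} = cadlag_paths" by (auto intro: less_le_trans)
      then show ?thesis using openin_topspace[of skorokhod] by simp
    next
      case 2
      then have "{y \<in> cadlag_paths. c < ?f y} = G" using G_sub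
          by (auto simp: indicator_def split: if_splits)
      then show ?thesis using G by simp
    next
      case 3
      then have "{y \<in> cadlag_paths. c < ?f y} = {}" by (auto simp: indicator_def split: if_splits)
      then show ?thesis by (simp only: openin_empty)
    qed
  qed
  have "(\<lambda>\<omega>. ?f (\<lambda>t\<in>{0..}. Z t \<omega>)) \<in> borel_measurable M"
  proof (rule borel_measurable_LIMSEQ_metric)
    fix m
    have "envelope ?f m (\<lambda>t\<in>{0..}. Z t \<omega>) = envelope ?f m (\<lambda>t. Z t \<omega>)" for \<omega>
      by (rule envelope_cong[OF f0]) simp
    then show "(\<lambda>\<omega>. envelope ?f m (\<lambda>t\<in>{0..}. Z t \<omega>)) \<in> borel_measurable M"
      using env[OF f0] by (simp only:)
    show "(\<lambda>m. envelope ?f m (\<lambda>t\<in>{0..}. Z t \<omega>)) \<longlonglongrightarrow> ?f (\<lambda>t\<in>{0..}. Z t \<omega>)"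
      if "\<omega> \<in> space M" for \<omega>
      by (rule envelope_tendsto[OF f1 lsc path[OF that]])
  qed
  then have "(\<lambda>\<omega>. ?f (\<lambda>t\<in>{0..}. Z t \<omega>)) -` {1} \<inter> space M \<in> sets M"
    by (rule measurable_sets) simp
  also have "(\<lambda>\<omega>. ?f (\<lambda>t\<in>{0..}. Z t \<omega>)) -` {1} \<inter> space M = (\<lambda>\<omega>. \<lambda>t\<in>{0..}. Z t \<omega>) -` G \<inter> space M"
    by (auto simp: indicator_def)
  finally show "(\<lambda>\<omega>. \<lambda>t\<in>{0..}. Z t \<omega>) -` G \<inter> space M \<in> sets M" .
qed

section \<open>A criterion for weak convergence in the Skorokhod space\<close>

lemma continuous_map_skorokhod_measurable:
  assumes "continuous_map skorokhod euclideanreal f"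
  shows "f \<in> borel_measurable (borel_of_topology skorokhod)"
proof (rule borel_measurableI)
  fix S :: "real set" assume "open S"
  then have "openin skorokhod {x \<in> topspace skorokhod. f x \<in> S}"
    using assms by (auto simp: continuous_map_def)
  moreover have "f -` S \<inter> space (borel_of_topology skorokhod) = {x \<in> topspace skorokhod. f x \<in> S}"
    by auto
  ultimately show "f -` S \<inter> space (borel_of_topology skorokhod) \<in> sets (borel_of_topology skorokhod)"
    by (simp add: sets_borel_of_skorokhod sigma_sets.Basic)
qed

text \<open>The envelopes lie below \<open>f\<close> on every cadlag path, so replacing an envelope
  by \<open>f\<close> costs nothing along the sequence \<open>Y d\<close>. Their convergence to
  \<open>f\<close> is used only under the limit law, by dominated convergence; no uniformity in
  \<open>d\<close> is asked there. Uniformity enters solely through \<open>modulus\<close>, which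
  passes from \<open>Y d\<close> to its sampled version.\<close>

lemma weakly_converges_skorokhodI:
  fixes M :: "nat \<Rightarrow> 'a measure" and Y :: "nat \<Rightarrow> real \<Rightarrow> 'a \<Rightarrow> real"
    and N :: "'b measure" and U :: "real \<Rightarrow> 'b \<Rightarrow> real"
  assumes M: "\<And>d. prob_space (M d)" and N: "prob_space N"
    and Y_path: "\<And>d. (\<lambda>\<omega>. \<lambda>t\<in>{0..}. Y d t \<omega>) \<in> M d \<rightarrow>\<^sub>M borel_of_topology skorokhod"
    and Y: "\<And>d t. 0 \<le> t \<Longrightarrow> Y d t \<in> borel_measurable (M d)"
    and U: "\<And>t. 0 \<le> t \<Longrightarrow> U t \<in> borel_measurable N"
    and U_cont: "\<And>\<omega>. \<omega> \<in> space N \<Longrightarrow> continuous_on {0..} (\<lambda>t. U t \<omega>)"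
    and fdd: "\<And>(k::nat) n F L B. 0 < k \<Longrightarrow>
      (\<And>x y. \<bar>F x - F y\<bar> \<le> L * (\<Sum>j\<le>n. \<bar>x j - y j\<bar>)) \<Longrightarrow> (\<And>x. \<bar>F x\<bar> \<le> B) \<Longrightarrow>
      (\<lambda>d. \<integral>\<omega>. F (\<lambda>j. Y d (real j / real k) \<omega>) \<partial>M d) \<longlonglongrightarrow> (\<integral>\<omega>. F (\<lambda>j. U (real j / real k) \<omega>) \<partial>N)"
    and modulus: "\<And>m e. 0 < e \<Longrightarrow> \<forall>\<^sub>F k in sequentially. \<forall>\<^sub>F d in sequentially.
      \<exists>A\<in>sets (M d). measure (M d) A \<le> e \<and>
        (\<forall>\<omega>\<in>space (M d) - A. \<forall>t\<in>{0..real m}. \<bar>Y d t \<omega> - sampled k (\<lambda>t. Y d t \<omega>) t\<bar> \<le> e)"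
  shows "weakly_converges skorokhod (\<lambda>d. path_law (M d) (Y d)) (path_law N U)"
proof -
  interpret N: prob_space N by fact
  have U_cadlag: "(\<lambda>t\<in>{0..}. U t \<omega>) \<in> cadlag_paths" if "\<omega> \<in> space N" for \<omega>
    using continuous_imp_cadlag[OF U_cont[OF that]] .
  have U_path: "(\<lambda>\<omega>. \<lambda>t\<in>{0..}. U t \<omega>) \<in> N \<rightarrow>\<^sub>M borel_of_topology skorokhod"
    by (rule path_measurableI[OF U_cadlag envelope_continuous_measurable[OF _ U U_cont]])
  let ?Y = "\<lambda>d \<omega>. \<lambda>t\<in>{0..}. Y d t \<omega>" and ?U = "\<lambda>\<omega>. \<lambda>t\<in>{0..}. U t \<omega>"
  \<comment> \<open>Four errors of size \<open>r / 4\<close>: envelope against \<open>f\<close>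
    under \<open>U\<close> (fixes \<open>m\<close>), sampling of \<open>U\<close> (fixes
    \<open>k\<close>), convergence at the grid times, and the sampling of
    \<open>Y d\<close>.\<close>
  have lower: "\<forall>\<^sub>F d in sequentially. (\<integral>\<omega>. f (?U \<omega>) \<partial>N) - r < (\<integral>\<omega>. f (?Y d \<omega>) \<partial>M d)"
    if f_cont: "continuous_map skorokhod euclideanreal f"
      and f: "\<forall>y\<in>cadlag_paths. 0 \<le> f y \<and> f y \<le> B" and r: "0 < r" for f B and r :: real
  proof -
    have f0: "\<forall>y\<in>cadlag_paths. 0 \<le> f y" using f by blast
    have lsc: "openin skorokhod {y \<in> cadlag_paths. c < f y}" for c
    proof -
      have "openin skorokhod {y \<in> topspace skorokhod. f y \<in> {c<..}}"
        using f_cont by (rule openin_continuous_map_preimage) simp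
      then show ?thesis by simp
    qed
    have f_meas: "f \<in> borel_measurable (borel_of_topology skorokhod)"
      using continuous_map_skorokhod_measurable[OF f_cont] .
    have env_U: "envelope f m (?U \<omega>) = envelope f m (\<lambda>t. U t \<omega>)" for m \<omega>
      by (rule envelope_cong[OF f0]) auto
    have bound: "\<bar>envelope f m x\<bar> \<le> B + real m" for m x
      using envelope_nonneg[OF f0] envelope_bound[OF f] by simp
    have "(\<lambda>m. \<integral>\<omega>. envelope f m (\<lambda>t. U t \<omega>) \<partial>N) \<longlonglongrightarrow> (\<integral>\<omega>. f (?U \<omega>) \<partial>N)"
    proof (rule integral_dominated_convergence[where w="\<lambda>_. B"])
      show "AE \<omega> in N. (\<lambda>m. envelope f m (\<lambda>t. U t \<omega>)) \<longlonglongrightarrow> f (?U \<omega>)"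
        using envelope_tendsto[OF f lsc U_cadlag] by (auto simp: env_U)
      show "AE \<omega> in N. norm (envelope f m (\<lambda>t. U t \<omega>)) \<le> B" for m
      proof (rule AE_I2)
        fix \<omega> assume "\<omega> \<in> space N"
        then have "envelope f m (?U \<omega>) \<le> B"
          using envelope_le[OF f0 U_cadlag, of \<omega> m] bspec[OF f U_cadlag, of \<omega>] by linarith
        then show "norm (envelope f m (\<lambda>t. U t \<omega>)) \<le> B"
          using envelope_nonneg[OF f0] by (simp add: env_U)
      qed
      show "(\<lambda>\<omega>. f (?U \<omega>)) \<in> borel_measurable N"
        by (rule measurable_compose[OF U_path f_meas])
      show "(\<lambda>\<omega>. envelope f m (\<lambda>t. U t \<omega>)) \<in> borel_measurable N" for m
        by (rule envelope_continuous_measurable[OF f0 U U_cont])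
    qed simp
    then have "\<forall>\<^sub>F m in sequentially. (\<integral>\<omega>. f (?U \<omega>) \<partial>N) - r / 4 < (\<integral>\<omega>. envelope f m (\<lambda>t. U t \<omega>) \<partial>N)"
      using r by (intro order_tendstoD(1)) auto
    then obtain m where m: "(\<integral>\<omega>. f (?U \<omega>) \<partial>N) - r / 4 < (\<integral>\<omega>. envelope f m (\<lambda>t. U t \<omega>) \<partial>N)"
      by (auto simp: eventually_sequentially)
    have "(\<lambda>k. \<integral>\<omega>. envelope f m (sampled k (\<lambda>t. U t \<omega>)) \<partial>N) \<longlonglongrightarrow> (\<integral>\<omega>. envelope f m (\<lambda>t. U t \<omega>) \<partial>N)"
    proof (rule integral_dominated_convergence[where w="\<lambda>_. B + real m"])
      show "AE \<omega> in N. (\<lambda>k. envelope f m (sampled k (\<lambda>t. U t \<omega>))) \<longlonglongrightarrow> envelope f m (\<lambda>t. U t \<omega>)"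
        using envelope_sampled_tendsto[OF f0 U_cont] by auto
    qed (use bound envelope_continuous_measurable[OF f0 U U_cont] envelope_sampled_measurable[OF f0 U]
        in auto)
    then have ev1: "\<forall>\<^sub>F k in sequentially. (\<integral>\<omega>. envelope f m (\<lambda>t. U t \<omega>) \<partial>N) - r / 4
        < (\<integral>\<omega>. envelope f m (sampled k (\<lambda>t. U t \<omega>)) \<partial>N)"
      using r by (intro order_tendstoD(1)) auto
    \<comment> \<open>Sampling \<open>Y d\<close> costs \<open>real m * e\<close> off the
      exceptional set and at most \<open>(B + real m) * e\<close> on it; the sum has to stay below
      \<open>r / 4\<close>. The summand 1 keeps the denominator positive.\<close>
    define e where "e = r / (4 * (B + 2 * real m + 1))"
    have B: "0 \<le> B" using f cadlag_paths_nonempty by force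
    have e: "0 < e" "(B + 2 * real m) * e \<le> r / 4"
      using r B by (auto simp: e_def field_simps intro!: divide_pos_pos add_nonneg_pos)
    define P where "P k d \<longleftrightarrow> (\<exists>A\<in>sets (M d). measure (M d) A \<le> e \<and>
        (\<forall>\<omega>\<in>space (M d) - A. \<forall>t\<in>{0..real m}. \<bar>Y d t \<omega> - sampled k (\<lambda>t. Y d t \<omega>) t\<bar> \<le> e))" for k d
    have "\<forall>\<^sub>F k in sequentially. 0 < k \<and> (\<integral>\<omega>. envelope f m (\<lambda>t. U t \<omega>) \<partial>N) - r / 4
        < (\<integral>\<omega>. envelope f m (sampled k (\<lambda>t. U t \<omega>)) \<partial>N) \<and>
        (\<forall>\<^sub>F d in sequentially. P k d)"
      using ev1 modulus[OF e(1), of m, folded P_def] by (intro eventually_conj eventually_gt_at_top)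
    then obtain k where k: "0 < k"
      and k1: "(\<integral>\<omega>. envelope f m (\<lambda>t. U t \<omega>) \<partial>N) - r / 4
        < (\<integral>\<omega>. envelope f m (sampled k (\<lambda>t. U t \<omega>)) \<partial>N)"
      and k2: "\<forall>\<^sub>F d in sequentially. P k d"
      using eventually_happens'[OF sequentially_bot] by blast
    have "(\<lambda>d. \<integral>\<omega>. envelope f m (sampled k (\<lambda>t. Y d t \<omega>)) \<partial>M d)
        \<longlonglongrightarrow> (\<integral>\<omega>. envelope f m (sampled k (\<lambda>t. U t \<omega>)) \<partial>N)"
      unfolding sampled_def
      by (rule fdd[where F="\<lambda>z. envelope f m (\<lambda>t. z (nat \<lfloor>real k * t\<rfloor>))",
            OF k envelope_sampled_lipschitz[OF f0] bound])
    then have "\<forall>\<^sub>F d in sequentially. (\<integral>\<omega>. envelope f m (sampled k (\<lambda>t. U t \<omega>)) \<partial>N) - r / 4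
        < (\<integral>\<omega>. envelope f m (sampled k (\<lambda>t. Y d t \<omega>)) \<partial>M d)"
      using r by (intro order_tendstoD(1)) auto
    with k2 show ?thesis
    proof eventually_elim
      case (elim d)
      interpret Md: prob_space "M d" by fact
      obtain A where A: "A \<in> sets (M d)" "measure (M d) A \<le> e"
        and mod: "\<And>\<omega> t. \<omega> \<in> space (M d) - A \<Longrightarrow> t \<in> {0..real m} \<Longrightarrow>
          \<bar>Y d t \<omega> - sampled k (\<lambda>t. Y d t \<omega>) t\<bar> \<le> e"
        using elim(1) unfolding P_def by blast
      have cad: "?Y d \<omega> \<in> cadlag_paths" if "\<omega> \<in> space (M d)" for \<omega>
        using measurable_space[OF Y_path that] by simp
      have fY: "(\<lambda>\<omega>. f (?Y d \<omega>)) \<in> borel_measurable (M d)"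
        by (rule measurable_compose[OF Y_path f_meas])
      have eY: "(\<lambda>\<omega>. envelope f m (sampled k (\<lambda>t. Y d t \<omega>))) \<in> borel_measurable (M d)"
        by (rule envelope_sampled_measurable[OF f0 Y])
      have int: "integrable (M d) (\<lambda>\<omega>. f (?Y d \<omega>))"
        "integrable (M d) (\<lambda>\<omega>. envelope f m (sampled k (\<lambda>t. Y d t \<omega>)))"
        by (rule Md.integrable_const_bound[where B=B, OF AE_I2 fY]; use f cad in simp)
          (rule Md.integrable_const_bound[where B="B + real m", OF AE_I2 eY]; use bound in simp)
      \<comment> \<open>Off \<open>A\<close> the sampled path is within \<open>e\<close> of the true
        one and the envelope is at most \<open>f\<close>; on \<open>A\<close> only the crude bound
        \<open>B + real m\<close> is available.\<close>
      have pw: "envelope f m (sampled k (\<lambda>t. Y d t \<omega>)) \<le> f (?Y d \<omega>) + real m * e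
          + (B + real m) * indicator A \<omega>"
        if w: "\<omega> \<in> space (M d)" for \<omega>
      proof (cases "\<omega> \<in> A")
        case True
        then show ?thesis using bound[of m "sampled k (\<lambda>t. Y d t \<omega>)"] conjunct1[OF bspec[OF f
            cad[OF w]]] mult_nonneg_nonneg[OF of_nat_0_le_iff less_imp_le[OF e(1)], of m]
          by (simp only: indicator_simps abs_le_iff mult_1_right) linarith
      next
        case False
        have "envelope f m (sampled k (\<lambda>t. Y d t \<omega>)) \<le> envelope f m (?Y d \<omega>) + real m * e"
          using mod[of \<omega>] w False by (intro envelope_lipschitz[OF f0]) (auto simp: abs_minus_commute)
        then show ?thesis using envelope_le[OF f0 cad[OF w], of m] False by simp
      qed
      have iA: "integrable (M d) (indicat_real A)"
        using A by (intro integrable_real_indicator) (auto simp: Md.emeasure_finite less_top[symmetric])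
      have "(\<integral>\<omega>. envelope f m (sampled k (\<lambda>t. Y d t \<omega>)) \<partial>M d)
          \<le> (\<integral>\<omega>. f (?Y d \<omega>) + real m * e + (B + real m) * indicator A \<omega> \<partial>M d)"
        using pw int iA by (intro integral_mono) auto
      also have "\<dots> = (\<integral>\<omega>. f (?Y d \<omega>) \<partial>M d) + real m * e + (B + real m) * measure (M d) A"
        using int iA A by (simp add: Md.prob_space)
      also have "\<dots> \<le> (\<integral>\<omega>. f (?Y d \<omega>) \<partial>M d) + real m * e + (B + real m) * e"
        using A B by (intro add_left_mono mult_left_mono) auto
      also have "\<dots> \<le> (\<integral>\<omega>. f (?Y d \<omega>) \<partial>M d) + r / 4"
        using e by (simp add: algebra_simps)
      finally show ?case using elim(2) k1 m r by linarith
    qed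
  qed
  \<comment> \<open>The lower bound is applied to \<open>f + B\<close> and to \<open>B - f\<close>,
    both with values between 0 and \<open>2 * B\<close>.\<close>
  have conv: "(\<lambda>d. \<integral>\<omega>. f (?Y d \<omega>) \<partial>M d) \<longlonglongrightarrow> (\<integral>\<omega>. f (?U \<omega>) \<partial>N)"
    if f_cont: "continuous_map skorokhod euclideanreal f" and bdd: "bounded (f ` cadlag_paths)" for f
  proof -
    obtain B where B: "\<And>y. y \<in> cadlag_paths \<Longrightarrow> \<bar>f y\<bar> \<le> B"
      using bdd by (auto simp: bounded_iff)
    have f_meas: "f \<in> borel_measurable (borel_of_topology skorokhod)"
      using continuous_map_skorokhod_measurable[OF f_cont] .
    have iU: "integrable N (\<lambda>\<omega>. f (?U \<omega>))"
      using B U_cadlag measurable_compose[OF U_path f_meas]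
      by (intro N.integrable_const_bound[where B=B] AE_I2) auto
    have iY: "integrable (M d) (\<lambda>\<omega>. f (?Y d \<omega>))" for d
    proof -
      interpret Md: prob_space "M d" by fact
      show ?thesis using B measurable_space[OF Y_path] measurable_compose[OF Y_path f_meas]
        by (intro Md.integrable_const_bound[where B=B] AE_I2) auto
    qed
    have eqs: "(\<integral>\<omega>. f (?Y d \<omega>) + c \<partial>M d) = (\<integral>\<omega>. f (?Y d \<omega>) \<partial>M d) + c"
      "(\<integral>\<omega>. c - f (?Y d \<omega>) \<partial>M d) = c - (\<integral>\<omega>. f (?Y d \<omega>) \<partial>M d)" for c d
      using iY[of d] prob_space.prob_space[OF M, of d]
      by (simp_all add: finite_measure.integrable_const[OF prob_space.finite_measure[OF M]])
    show ?thesis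
    proof (rule order_tendstoI)
      fix c assume c: "c < (\<integral>\<omega>. f (?U \<omega>) \<partial>N)"
      have "\<forall>\<^sub>F d in sequentially. (\<integral>\<omega>. f (?U \<omega>) + B \<partial>N) - ((\<integral>\<omega>. f (?U \<omega>) \<partial>N) - c)
          < (\<integral>\<omega>. f (?Y d \<omega>) + B \<partial>M d)"
      proof (rule lower)
        show "continuous_map skorokhod euclideanreal (\<lambda>x. f x + B)"
          by (intro continuous_map_add f_cont) simp
        show "\<forall>y\<in>cadlag_paths. 0 \<le> f y + B \<and> f y + B \<le> 2 * B"
          using B by (fastforce simp: abs_le_iff)
      qed (use c in linarith)
      then show "\<forall>\<^sub>F d in sequentially. c < (\<integral>\<omega>. f (?Y d \<omega>) \<partial>M d)"
        using iU by (simp add: eqs N.prob_space)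
    next
      fix c assume c: "(\<integral>\<omega>. f (?U \<omega>) \<partial>N) < c"
      have "\<forall>\<^sub>F d in sequentially. (\<integral>\<omega>. B - f (?U \<omega>) \<partial>N) - (c - (\<integral>\<omega>. f (?U \<omega>) \<partial>N))
          < (\<integral>\<omega>. B - f (?Y d \<omega>) \<partial>M d)"
      proof (rule lower)
        show "continuous_map skorokhod euclideanreal (\<lambda>x. B - f x)"
          by (intro continuous_map_diff f_cont) simp
        show "\<forall>y\<in>cadlag_paths. 0 \<le> B - f y \<and> B - f y \<le> 2 * B"
          using B by (fastforce simp: abs_le_iff)
      qed (use c in linarith)
      then show "\<forall>\<^sub>F d in sequentially. (\<integral>\<omega>. f (?Y d \<omega>) \<partial>M d) < c"
        using iU by (simp add: eqs N.prob_space)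
    qed
  qed
  show ?thesis
    unfolding weakly_converges_def path_law_def topspace_skorokhod
  proof (intro conjI allI impI always_eventually)
    fix f assume f: "continuous_map skorokhod euclideanreal f \<and> bounded (f ` cadlag_paths)"
    have "f \<in> borel_measurable (borel_of_topology skorokhod)"
      using continuous_map_skorokhod_measurable f by blast
    then show "(\<lambda>d. integral\<^sup>L (distr (M d) (borel_of_topology skorokhod) (?Y d)) f)
        \<longlonglongrightarrow> integral\<^sup>L (distr N (borel_of_topology skorokhod) ?U) f"
      using conv f by (simp add: integral_distr[OF Y_path] integral_distr[OF U_path])
  qed (auto intro!: prob_space.prob_space_distr M N Y_path U_path)
qed

section \<open>The noise of the Ornstein-Uhlenbeck process\<close>

text \<open>At 0 the difference quotient is at most \<open>\<bar>h\<bar> ^ n\<close>, so the kink of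
  the positive part is smoothed. Used with powers 3 and 2: a cube of the positive part is twice
  continuously differentiable.\<close>

lemma has_real_derivative_pos_part_power:
  fixes z :: real
  assumes n: "0 < n"
  shows "((\<lambda>z. max 0 z ^ Suc n) has_real_derivative real (Suc n) * max 0 z ^ n) (at z)"
proof -
  consider "z > 0" | "z < 0" | "z = 0" by linarith
  then show ?thesis
  proof cases
    case 1
    have "((\<lambda>z. z ^ Suc n) has_real_derivative real (Suc n) * z ^ n) (at z)"
      using DERIV_pow[of "Suc n" z UNIV] by simp
    then have "((\<lambda>z. max 0 z ^ Suc n) has_real_derivative real (Suc n) * z ^ n) (at z)"
      by (rule has_field_derivative_transform_within_open[where S="{0<..}"]) (use 1 in auto)
    then show ?thesis using 1 by simp
  next
    case 2
    have "((\<lambda>z. 0) has_real_derivative 0) (at z)" by simp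
    then have "((\<lambda>z. max 0 z ^ Suc n) has_real_derivative 0) (at z)"
      by (rule has_field_derivative_transform_within_open[where S="{..<0}"]) (use 2 in auto)
    moreover have "max 0 z ^ n = 0" using 2 n by (simp add: max_absorb1)
    ultimately show ?thesis by (simp only: mult_zero_right)
  next
    case 3
    have "((\<lambda>h. \<bar>h\<bar> ^ n) \<longlongrightarrow> \<bar>0\<bar> ^ n) (at (0::real))" by (intro tendsto_intros)
    moreover have "\<bar>0::real\<bar> ^ n = 0" using n by simp
    ultimately have "((\<lambda>h::real. \<bar>h\<bar> ^ n) \<longlongrightarrow> 0) (at 0)" by (simp only:)
    then have "((\<lambda>h::real. max 0 h ^ Suc n / h) \<longlongrightarrow> 0) (at 0)"
    proof (rule tendsto_0_le[where K=1], intro always_eventually allI)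
      fix h :: real
      show "norm (max 0 h ^ Suc n / h) \<le> norm (\<bar>h\<bar> ^ n) * 1"
        by (cases "h > 0") (auto simp: max_def power_abs)
    qed
    then show ?thesis using 3 by (simp add: DERIV_def zero_power[OF n])
  qed
qed

text \<open>On the logarithmic scale both \<open>x f'\<close> and \<open>f''\<close> are \<open>O(1/R)\<close> uniformly in \<open>x\<close>, although the
  drift is unbounded.\<close>

definition cutoff :: "real \<Rightarrow> real \<Rightarrow> real" where
  "cutoff R x = max 0 (1 - ln (1 + x\<^sup>2) / R) ^ 3"

definition cutoff_deriv :: "real \<Rightarrow> real \<Rightarrow> real" where
  "cutoff_deriv R x = - (3 * max 0 (1 - ln (1 + x\<^sup>2) / R) ^ 2 * (2 * x / (1 + x\<^sup>2)) / R)"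

definition cutoff_deriv2 :: "real \<Rightarrow> real \<Rightarrow> real" where
  "cutoff_deriv2 R x = 6 * max 0 (1 - ln (1 + x\<^sup>2) / R) * (2 * x / (1 + x\<^sup>2) / R)\<^sup>2
     - 3 * max 0 (1 - ln (1 + x\<^sup>2) / R) ^ 2 * (2 * (1 - x\<^sup>2) / (1 + x\<^sup>2)\<^sup>2) / R"

lemma one_plus_square_pos: "0 < 1 + (x::real)\<^sup>2"
  by (simp add: add_pos_nonneg)

lemma cutoff_arg_deriv:
  assumes "R \<noteq> 0"
  shows "((\<lambda>x. 1 - ln (1 + x\<^sup>2) / R) has_real_derivative - (2 * x / (1 + x\<^sup>2) / R)) (at x)"
proof -
  have "((\<lambda>x. ln (1 + x\<^sup>2)) has_real_derivative 2 * x / (1 + x\<^sup>2)) (at x)"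
    using one_plus_square_pos[of x] by (auto intro!: derivative_eq_intros)
  from DERIV_diff[OF DERIV_const DERIV_cdivide[OF this]] show ?thesis by simp
qed

lemma cutoff_has_deriv:
  assumes "R \<noteq> 0"
  shows "(cutoff R has_real_derivative cutoff_deriv R x) (at x)"
proof -
  have "((\<lambda>x. max 0 (1 - ln (1 + x\<^sup>2) / R) ^ Suc 2) has_real_derivative
     (real (Suc 2) * max 0 (1 - ln (1 + x\<^sup>2) / R) ^ 2) * (- (2 * x / (1 + x\<^sup>2) / R))) (at x)"
    by (rule DERIV_chain2[OF has_real_derivative_pos_part_power cutoff_arg_deriv]) (use assms in auto)
  then show ?thesis by (simp add: cutoff_def[abs_def] cutoff_deriv_def numeral_3_eq_3)
qed

lemma cutoff_deriv_has_deriv: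
  assumes "R \<noteq> 0"
  shows "(cutoff_deriv R has_real_derivative cutoff_deriv2 R x) (at x)"
proof -
  have 1: "((\<lambda>x. max 0 (1 - ln (1 + x\<^sup>2) / R) ^ Suc 1) has_real_derivative
     (real (Suc 1) * max 0 (1 - ln (1 + x\<^sup>2) / R) ^ 1) * (- (2 * x / (1 + x\<^sup>2) / R))) (at x)"
    by (rule DERIV_chain2[OF has_real_derivative_pos_part_power cutoff_arg_deriv]) (use assms in auto)
  have 2: "((\<lambda>x. - (3 / R * (2 * x / (1 + x\<^sup>2)))) has_real_derivative
      - (3 / R * (2 * (1 - x\<^sup>2) / (1 + x\<^sup>2)\<^sup>2))) (at x)"
    using assms one_plus_square_pos[of x]
    by (auto intro!: derivative_eq_intros simp: divide_simps) (simp add: algebra_simps power2_eq_square)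
  \<comment> \<open>The product rule in letters: \<open>b\<close> is the positive part,
    \<open>y\<close> stands for \<open>2 * x / (1 + x\<^sup>2)\<close> and \<open>w\<close> for its
    derivative.\<close>
  have "real (Suc 1) * b ^ 1 * - (y / R) * - (3 / R * y) + - (3 / R * w) * b ^ Suc 1
      = 6 * b * (y / R)\<^sup>2 - 3 * b\<^sup>2 * w / R" for b y w
    by (simp add: power2_eq_square ac_simps)
  note DERIV_cong[OF DERIV_mult[OF 1 2] this]
  moreover have "cutoff_deriv R = (\<lambda>x. max 0 (1 - ln (1 + x\<^sup>2) / R) ^ Suc 1 *
      - (3 / R * (2 * x / (1 + x\<^sup>2))))"
    by (rule ext) (simp add: cutoff_deriv_def power2_eq_square ac_simps)
  ultimately show ?thesis by (simp only: cutoff_deriv2_def)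
qed

lemma cutoff_support:
  assumes "0 < R" "cutoff R x \<noteq> 0"
  shows "\<bar>x\<bar> \<le> exp R"
proof -
  have "0 < 1 - ln (1 + x\<^sup>2) / R"
    using assms by (auto simp: cutoff_def max_def split: if_splits)
  then have "ln (1 + x\<^sup>2) < R" using assms(1) by (simp add: field_simps)
  then have "1 + x\<^sup>2 < exp R" using one_plus_square_pos[of x] by (metis exp_less_mono exp_ln)
  also have "exp R \<le> (exp R)\<^sup>2" using assms(1) by (simp add: power2_eq_square)
  finally have "x\<^sup>2 \<le> (exp R)\<^sup>2" by simp
  then show ?thesis using abs_le_square_iff[of x "exp R"] by simp
qed

lemma cutoff_nonneg: "0 \<le> cutoff R x"
  by (simp add: cutoff_def)

lemma cutoff_base_le_1: "0 < R \<Longrightarrow> max 0 (1 - ln (1 + x\<^sup>2) / R) \<le> (1::real)"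
  using ln_ge_zero[of "1 + x\<^sup>2"] by (simp add: max_def)

lemma cutoff_le_1: "0 < R \<Longrightarrow> cutoff R x \<le> 1"
  unfolding cutoff_def using cutoff_base_le_1 by (intro power_le_one) auto

text \<open>With g(x) = ln(1 + x^2) one has |g'| at most 1, |x g'| at most 2 and |g''| at most 2.
  The constants 3, 6 and 12 = 6 + 6 come from differentiating the cube; \<open>1 \<le> R\<close>
  absorbs 1/R^2 into 1/R.\<close>

lemma cutoff_deriv_bounds:
  assumes R: "1 \<le> R"
  shows "\<bar>cutoff_deriv R x\<bar> \<le> 3 / R" "\<bar>x * cutoff_deriv R x\<bar> \<le> 6 / R" "\<bar>cutoff_deriv2 R x\<bar> \<le> 12 / R"
proof -
  define b where "b = max 0 (1 - ln (1 + x\<^sup>2) / R)"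
  have b: "0 \<le> b" "b \<le> 1" "b\<^sup>2 \<le> 1" using cutoff_base_le_1[of R x] R
      by (auto simp: b_def intro: power_le_one)
  have y1: "\<bar>2 * x / (1 + x\<^sup>2)\<bar> \<le> 1"
  proof -
    have "0 \<le> (1 - \<bar>x\<bar>)\<^sup>2" by simp
    then have "2 * \<bar>x\<bar> \<le> 1 + x\<^sup>2" by (simp add: power2_diff)
    then show ?thesis using one_plus_square_pos[of x] by (simp add: abs_mult abs_of_pos)
  qed
  have y2: "\<bar>x * (2 * x / (1 + x\<^sup>2))\<bar> \<le> 2"
    using one_plus_square_pos[of x] by (simp add: abs_mult divide_simps power2_eq_square)
  have y3: "\<bar>2 * (1 - x\<^sup>2) / (1 + x\<^sup>2)\<^sup>2\<bar> \<le> 2"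
  proof -
    have "\<bar>1 - x\<^sup>2\<bar> \<le> 1 + x\<^sup>2" by (simp add: abs_le_iff)
    also have "\<dots> \<le> (1 + x\<^sup>2)\<^sup>2" using self_le_power[of "1 + x\<^sup>2" 2] by simp
    finally show ?thesis using one_plus_square_pos[of x] by (simp add: abs_mult divide_simps)
  qed
  have "\<bar>cutoff_deriv R x\<bar> = 3 * (b\<^sup>2 * \<bar>2 * x / (1 + x\<^sup>2)\<bar>) / R"
    using R by (simp add: cutoff_deriv_def b_def[symmetric] abs_mult)
  also have "\<dots> \<le> 3 * (1 * 1) / R"
    using R b y1 by (intro divide_right_mono mult_left_mono mult_mono) auto
  finally show "\<bar>cutoff_deriv R x\<bar> \<le> 3 / R" by simp
  have "\<bar>x * cutoff_deriv R x\<bar> = 3 * (b\<^sup>2 * \<bar>x * (2 * x / (1 + x\<^sup>2))\<bar>) / R"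
    using R by (simp add: cutoff_deriv_def b_def[symmetric] abs_mult)
  also have "\<dots> \<le> 3 * (1 * 2) / R"
    using R b y2 by (intro divide_right_mono mult_left_mono mult_mono) auto
  finally show "\<bar>x * cutoff_deriv R x\<bar> \<le> 6 / R" by simp
  have t1: "6 * (b * (2 * x / (1 + x\<^sup>2) / R)\<^sup>2) \<le> 6 * (1 * (1 / R))"
  proof -
    have "(2 * x / (1 + x\<^sup>2) / R)\<^sup>2 = (2 * x / (1 + x\<^sup>2))\<^sup>2 * (1 / R)\<^sup>2"
      by (simp add: power_divide power_mult_distrib)
    also have "\<dots> \<le> 1 * (1 / R)"
    proof (rule mult_mono)
      show "(2 * x / (1 + x\<^sup>2))\<^sup>2 \<le> 1" using y1 abs_square_le_1 by blast
      show "(1 / R)\<^sup>2 \<le> 1 / R" using R by (simp add: power2_eq_square divide_simps)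
    qed (use R in auto)
    finally show ?thesis using b by (intro mult_left_mono mult_mono) auto
  qed
  have t2: "\<bar>3 * (b\<^sup>2 * (2 * (1 - x\<^sup>2) / (1 + x\<^sup>2)\<^sup>2)) / R\<bar> \<le> 3 * (1 * 2) / R"
  proof -
    have "\<bar>3 * (b\<^sup>2 * (2 * (1 - x\<^sup>2) / (1 + x\<^sup>2)\<^sup>2)) / R\<bar> = 3 * (b\<^sup>2 * \<bar>2 * (1 - x\<^sup>2) / (1 + x\<^sup>2)\<^sup>2\<bar>) /
        R"
      using R by (simp add: abs_mult)
    also have "\<dots> \<le> 3 * (1 * 2) / R"
      using R b y3 by (intro divide_right_mono mult_left_mono mult_mono) auto
    finally show ?thesis .
  qed
  have t0: "0 \<le> 6 * (b * (2 * x / (1 + x\<^sup>2) / R)\<^sup>2)" using b by simp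
  have eq: "cutoff_deriv2 R x = 6 * (b * (2 * x / (1 + x\<^sup>2) / R)\<^sup>2) - 3 * (b\<^sup>2 * (2 * (1 - x\<^sup>2) / (1
      + x\<^sup>2)\<^sup>2)) / R"
    by (simp add: cutoff_deriv2_def b_def[symmetric])
  have "12 / R = 6 * (1 * (1 / R)) + 3 * (1 * 2) / R" using R by (simp add: field_simps)
  then show "\<bar>cutoff_deriv2 R x\<bar> \<le> 12 / R"
    unfolding eq using t0 t1 t2 by linarith
qed

lemma cutoff_tendsto: "(\<lambda>n. cutoff (real (Suc n)) x) \<longlonglongrightarrow> 1"
proof -
  have "(\<lambda>n. max 0 (1 - ln (1 + x\<^sup>2) * inverse (real (Suc n))) ^ 3) \<longlonglongrightarrow> max 0 (1 - ln (1 + x\<^sup>2) * 0) ^ 3"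
    by (intro tendsto_intros LIMSEQ_inverse_real_of_nat)
  then show ?thesis by (simp add: cutoff_def divide_inverse)
qed

text \<open>A cosine wave with amplitude \<open>A\<close>, frequency \<open>l\<close> and phase
  \<open>a\<close>, cut off. The phase makes real test functions sufficient for complex
  exponentials: a shift by \<open>- (pi / 2)\<close> turns the cosine into a sine.\<close>

definition wave :: "real \<Rightarrow> real \<Rightarrow> real \<Rightarrow> real \<Rightarrow> real \<Rightarrow> real" where
  "wave R A l a x = A * (cos (l * x + a) * cutoff R x)"

definition wave_deriv :: "real \<Rightarrow> real \<Rightarrow> real \<Rightarrow> real \<Rightarrow> real \<Rightarrow> real" where
  "wave_deriv R A l a x = A * (- l * sin (l * x + a) * cutoff R x + cos (l * x + a) * cutoff_deriv R x)"

definition wave_deriv2 :: "real \<Rightarrow> real \<Rightarrow> real \<Rightarrow> real \<Rightarrow> real \<Rightarrow> real" where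
  "wave_deriv2 R A l a x = A * (- l\<^sup>2 * cos (l * x + a) * cutoff R x - 2 * l * sin (l * x
      + a) * cutoff_deriv R x
     + cos (l * x + a) * cutoff_deriv2 R x)"

lemma wave_has_deriv:
  assumes "R \<noteq> 0"
  shows "(wave R A l a has_real_derivative wave_deriv R A l a x) (at x)"
  unfolding wave_def[abs_def] wave_deriv_def
  by (auto intro!: derivative_eq_intros cutoff_has_deriv[OF assms] simp: algebra_simps)

lemma wave_deriv_has_deriv:
  assumes "R \<noteq> 0"
  shows "(wave_deriv R A l a has_real_derivative wave_deriv2 R A l a x) (at x)"
  unfolding wave_deriv_def[abs_def] wave_deriv2_def
  by (auto intro!: derivative_eq_intros cutoff_has_deriv[OF assms] cutoff_deriv_has_deriv[OF assms]
      simp: algebra_simps power2_eq_square)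

lemma deriv_wave:
  assumes "R \<noteq> 0"
  shows "deriv (wave R A l a) = wave_deriv R A l a" "deriv (wave_deriv R A l a) = wave_deriv2 R A l a"
  using DERIV_imp_deriv[OF wave_has_deriv[OF assms]] DERIV_imp_deriv[OF wave_deriv_has_deriv[OF assms]]
  by auto

lemma continuous_on_cutoff [continuous_intros]:
  assumes "continuous_on S h"
  shows "continuous_on S (\<lambda>x. cutoff R (h x))" "continuous_on S (\<lambda>x. cutoff_deriv R (h x))"
    "continuous_on S (\<lambda>x. cutoff_deriv2 R (h x))"
proof -
  have pos: "1 + (h x)\<^sup>2 \<noteq> 0" for x using one_plus_square_pos[of "h x"] by simp
  show "continuous_on S (\<lambda>x. cutoff R (h x))" "continuous_on S (\<lambda>x. cutoff_deriv R (h x))"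
    "continuous_on S (\<lambda>x. cutoff_deriv2 R (h x))"
    unfolding cutoff_def cutoff_deriv_def cutoff_deriv2_def divide_inverse
    using pos by (intro continuous_intros assms ballI; simp)+
qed

lemma wave_C2:
  assumes R: "0 < R"
  shows "wave R A l a \<in> C2_compact_support"
proof -
  have R': "R \<noteq> 0" using R by simp
  have "{v. wave R A l a v \<noteq> 0} \<subseteq> {- exp R..exp R}"
    using cutoff_support[OF R] by (force simp: wave_def abs_le_iff)
  then have "compact (closure {v. wave R A l a v \<noteq> 0})"
    by (meson bounded_closed_interval bounded_subset compact_closure)
  moreover have "continuous_on UNIV (wave_deriv2 R A l a)"
    unfolding wave_deriv2_def[abs_def] by (intro continuous_intros)
  ultimately show ?thesis
    using wave_has_deriv[OF R'] wave_deriv_has_deriv[OF R']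
    unfolding C2_compact_support_def real_differentiable_def mem_Collect_eq deriv_wave[OF R'] by blast
qed

abbreviation ou_gen :: "(real \<Rightarrow> real) \<Rightarrow> real \<Rightarrow> real" where
  "ou_gen \<equiv> diffusion_generator (\<lambda>v. - v) (\<lambda>v. 2)"

lemma ou_gen_wave:
  assumes "R \<noteq> 0"
  shows "ou_gen (wave R A l a) x = wave_deriv2 R A l a x - x * wave_deriv R A l a x"
  using deriv_wave[OF assms] by (simp add: diffusion_generator_def)

text \<open>Differentiating a wave with moving frequency in time produces a factor \<open>x\<close>;
  the support of the cutoff keeps it bounded.\<close>

lemma cutoff_mult_bound:
  assumes "0 < R"
  shows "\<bar>x\<bar> * cutoff R x \<le> exp R"
proof (cases "cutoff R x = 0")
  case False
  then have "\<bar>x\<bar> * cutoff R x \<le> exp R * 1"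
    using cutoff_support[OF assms] cutoff_le_1[OF assms] cutoff_nonneg by (intro mult_mono) auto
  then show ?thesis by simp
qed simp

section \<open>The martingale problem tested on time-dependent functions\<close>

lemma natural_filtration_generators:
  "{U r -` A \<inter> space M | r A. 0 \<le> r \<and> r \<le> t \<and> A \<in> sets borel} \<subseteq> Pow (space M)"
  by auto

lemma space_natural_filtration [simp]: "space (natural_filtration M U t) = space M"
  unfolding natural_filtration_def by (rule space_measure_of[OF natural_filtration_generators])

lemma sets_natural_filtration:
  "sets (natural_filtration M U t) =
     sigma_sets (space M) {U r -` A \<inter> space M | r A. 0 \<le> r \<and> r \<le> t \<and> A \<in> sets borel}"
  unfolding natural_filtration_def by (rule sets_measure_of[OF natural_filtration_generators])

lemma natural_filtration_measurable:
  fixes U :: "real \<Rightarrow> 'a \<Rightarrow> real"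
  assumes "0 \<le> r" "r \<le> t"
  shows "U r \<in> borel_measurable (natural_filtration M U t)"
proof (rule measurableI)
  fix A :: "real set" assume "A \<in> sets borel"
  then show "U r -` A \<inter> space (natural_filtration M U t) \<in> sets (natural_filtration M U t)"
    using assms by (auto simp: sets_natural_filtration intro!: sigma_sets.Basic)
qed simp

lemma natural_filtration_subalgebra:
  assumes "\<And>r. 0 \<le> r \<Longrightarrow> U r \<in> borel_measurable M"
  shows "subalgebra M (natural_filtration M U t)"
proof -
  have "{U r -` A \<inter> space M | r A. 0 \<le> r \<and> r \<le> t \<and> A \<in> sets borel} \<subseteq> sets M"
    using measurable_sets[OF assms] by blast
  then show ?thesis
    by (simp add: subalgebra_def sets_natural_filtration sets.sigma_sets_subset)
qed

locale ou_process = prob_space N for N :: "'b measure" +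
  fixes U :: "real \<Rightarrow> 'b \<Rightarrow> real" and u :: real
  assumes ou: "ornstein_uhlenbeck_from u N U"
begin

lemma measurable_U [measurable]: "0 \<le> t \<Longrightarrow> U t \<in> borel_measurable N"
  using ou by (auto simp: ornstein_uhlenbeck_from_def diffusion_from_def)

lemma continuous_U: "\<omega> \<in> space N \<Longrightarrow> continuous_on {0..} (\<lambda>t. U t \<omega>)"
  using ou by (auto simp: ornstein_uhlenbeck_from_def diffusion_from_def)

lemma start_U: "AE \<omega> in N. U 0 \<omega> = u"
  using ou by (auto simp: ornstein_uhlenbeck_from_def diffusion_from_def)

lemma martingale_U:
  assumes "f \<in> C2_compact_support"
  shows "martingale N (natural_filtration N U)
     (\<lambda>t \<omega>. f (U t \<omega>) - f (U 0 \<omega>) - integral {0..t} (\<lambda>s. ou_gen f (U s \<omega>)))"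
  using ou assms by (auto simp: ornstein_uhlenbeck_from_def diffusion_from_def)

text \<open>The weak form of the martingale property, in which conditional expectations disappear:
  increments after time \<open>s\<close> are orthogonal to bounded weights known at time
  \<open>s\<close>.\<close>

lemma martingale_expectation:
  assumes Z: "martingale N (natural_filtration N U) Z" and st: "0 \<le> s" "s \<le> t"
    and g: "g \<in> borel_measurable (natural_filtration N U s)" "\<And>\<omega>. \<bar>g \<omega>\<bar> \<le> 1"
  shows "(\<integral>\<omega>. g \<omega> * Z t \<omega> \<partial>N) = (\<integral>\<omega>. g \<omega> * Z s \<omega> \<partial>N)"
proof -
  let ?F = "natural_filtration N U s"
  have sub: "subalgebra N ?F" by (rule natural_filtration_subalgebra) simp
  interpret F: finite_measure_subalgebra N ?F
    by unfold_locales (rule sub)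
  have Zt: "integrable N (Z t)" using Z st unfolding martingale_def by auto
  have gN: "g \<in> borel_measurable N" using g(1) sub measurable_from_subalg by blast
  have int: "integrable N (\<lambda>\<omega>. g \<omega> * Z t \<omega>)"
  proof (rule Bochner_Integration.integrable_bound[OF Zt])
    show "(\<lambda>\<omega>. g \<omega> * Z t \<omega>) \<in> borel_measurable N" using gN Zt by measurable
    show "AE \<omega> in N. norm (g \<omega> * Z t \<omega>) \<le> norm (Z t \<omega>)"
      using g(2) mult_right_mono[of "\<bar>g _\<bar>" 1 "\<bar>Z t _\<bar>"] by (auto simp: abs_mult)
  qed
  have "(\<integral>\<omega>. g \<omega> * Z t \<omega> \<partial>N) = (\<integral>\<omega>. g \<omega> * real_cond_exp N ?F (Z t) \<omega> \<partial>N)"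
    using F.real_cond_exp_intg(2)[OF int g(1)] Zt by simp
  also have "\<dots> = (\<integral>\<omega>. g \<omega> * Z s \<omega> \<partial>N)"
  proof (rule integral_cong_AE)
    have "AE \<omega> in N. real_cond_exp N ?F (Z t) \<omega> = Z s \<omega>"
      using Z st unfolding martingale_def by auto
    then show "AE \<omega> in N. g \<omega> * real_cond_exp N ?F (Z t) \<omega> = g \<omega> * Z s \<omega>" by eventually_elim simp
    show "(\<lambda>\<omega>. g \<omega> * Z s \<omega>) \<in> borel_measurable N"
      using gN Z st unfolding martingale_def by auto
    show "(\<lambda>\<omega>. g \<omega> * real_cond_exp N ?F (Z t) \<omega>) \<in> borel_measurable N"
      using gN by measurable
  qed
  finally show ?thesis .
qed

text \<open>Dynkin's formula for time-dependent functions, under a weight \<open>g\<close> from time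
  \<open>s\<close>. The increment of \<open>f r (U r)\<close> splits into a change of the function
  at a fixed position, governed by \<open>ft\<close> through the mean value theorem, and a change of
  position for the fixed function \<open>f r\<close>, whose weighted expectation equals that of the
  increment of the integral \<open>J\<close>. Both difference quotients are bounded by
  \<open>B\<close>, so dominated convergence applies.\<close>

lemma dynkin_derivative:
  fixes f ft :: "real \<Rightarrow> real \<Rightarrow> real"
  assumes g: "g \<in> borel_measurable (natural_filtration N U s)" "\<And>\<omega>. \<bar>g \<omega>\<bar> \<le> 1"
    and s: "0 \<le> s" and r: "r \<in> {s..T}"
    and f: "\<And>r. f r \<in> C2_compact_support" "\<And>r. continuous_on UNIV (f r)"
    and ft: "\<And>r x. ((\<lambda>r. f r x) has_real_derivative ft r x) (at r)"
    and ft_cont: "continuous_on UNIV (\<lambda>(r, x). ft r x)"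
    and gen_cont: "continuous_on UNIV (ou_gen (f r))"
    and bounds: "\<And>r x. r \<in> {s..T} \<Longrightarrow> \<bar>ft r x\<bar> \<le> B" "\<And>x. \<bar>ou_gen (f r) x\<bar> \<le> B" "\<And>r x. r \<in> {s..T} \<Longrightarrow> \<bar>f r x\<bar>
        \<le> B"
  shows "((\<lambda>r. \<integral>\<omega>. g \<omega> * f r (U r \<omega>) \<partial>N) has_real_derivative
    (\<integral>\<omega>. g \<omega> * (ft r (U r \<omega>) + ou_gen (f r) (U r \<omega>)) \<partial>N)) (at r within {s..T})"
proof -
  define J where "J t \<omega> = integral {0..t} (\<lambda>v. ou_gen (f r) (U v \<omega>))" for t \<omega>
  have B: "0 \<le> B" using bounds(2)[of 0] by linarith
  have r0: "0 \<le> r" "s \<le> r" using r s by auto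
  have sub: "subalgebra N (natural_filtration N U s)" by (rule natural_filtration_subalgebra) simp
  have gN [measurable]: "g \<in> borel_measurable N" using g(1) sub measurable_from_subalg by blast
  have f_meas [measurable]: "f r \<in> borel_measurable borel" for r
    using f(2) by (rule borel_measurable_continuous_onI)
  have gen_meas [measurable]: "ou_gen (f r) \<in> borel_measurable borel"
    using gen_cont by (rule borel_measurable_continuous_onI)
  have ftr_meas [measurable]: "ft r \<in> borel_measurable borel"
  proof (rule borel_measurable_continuous_onI)
    have "continuous_on UNIV (\<lambda>x. (\<lambda>(r, x). ft r x) (r, x))"
      by (rule continuous_on_compose2[OF ft_cont, of UNIV "\<lambda>x. (r, x)"])
         (auto intro: continuous_on_Pair continuous_on_const continuous_on_id)
    then show "continuous_on UNIV (ft r)" by simp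
  qed
  have mart: "martingale N (natural_filtration N U) (\<lambda>t \<omega>. f r (U t \<omega>) - f r (U 0 \<omega>) - J t \<omega>)"
    unfolding J_def by (rule martingale_U[OF f(1)])
  \<comment> \<open>Measurability of the time integral in \<omega> is read off from the martingale,
    from which \<open>J\<close> is recovered by subtraction.\<close>
  have J_meas [measurable]: "J t \<in> borel_measurable N" if "0 \<le> t" for t
  proof -
    have "(\<lambda>\<omega>. f r (U t \<omega>) - f r (U 0 \<omega>) - J t \<omega>) \<in> borel_measurable N"
      using mart that unfolding martingale_def by auto
    then have "(\<lambda>\<omega>. (f r (U t \<omega>) - f r (U 0 \<omega>)) - (f r (U t \<omega>) - f r (U 0 \<omega>) - J t \<omega>)) \<in>
        borel_measurable N"
      using that by measurable
    then show ?thesis by simp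
  qed
  have path_cont: "continuous_on {0..t} (\<lambda>v. ou_gen (f r) (U v \<omega>))" if "\<omega> \<in> space N" for \<omega> t
    by (rule continuous_on_compose2[OF gen_cont continuous_on_subset[OF continuous_U[OF that]]]) auto
  have J_deriv: "((\<lambda>t. J t \<omega>) has_real_derivative ou_gen (f r) (U t \<omega>)) (at t within {0..T'})"
    if "\<omega> \<in> space N" "t \<in> {0..T'}" for \<omega> t T'
    unfolding J_def by (rule integral_has_real_derivative[OF path_cont[OF that(1)] that(2)])
  have J_lip: "\<bar>J y \<omega> - J t \<omega>\<bar> \<le> B * \<bar>y - t\<bar>" if "\<omega> \<in> space N" "0 \<le> y" "0 \<le> t" for \<omega> y t
    using field_differentiable_bound[of "{0..max y t}" "\<lambda>t. J t \<omega>" "\<lambda>t. ou_gen (f r) (U t \<omega>)" B y t]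
      J_deriv[OF that(1)] bounds(2) that by auto
  have J_bound: "\<bar>J t \<omega>\<bar> \<le> B * t" if "\<omega> \<in> space N" "0 \<le> t" for \<omega> t
    using J_lip[of \<omega> t 0] that by (simp add: J_def)
  have gB: "\<bar>g \<omega> * z\<bar> \<le> c" if "\<bar>z\<bar> \<le> c" for \<omega> z c
    using mult_mono[OF g(2)[of \<omega>] that] by (simp add: abs_mult)
  have int_f: "integrable N (\<lambda>\<omega>. g \<omega> * f q (U t \<omega>))" if "q \<in> {s..T}" "0 \<le> t" for q t
    using bounds(3)[OF that(1)] that(2) by (intro integrable_const_bound[where B=B] AE_I2) (auto intro!:
        gB)
  have int_J: "integrable N (\<lambda>\<omega>. g \<omega> * J t \<omega>)" if "0 \<le> t" for t
    using J_bound that by (intro integrable_const_bound[where B="B * t"] AE_I2) (auto intro!: gB)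
  \<comment> \<open>Equating the weighted expectations of the martingale at times \<open>t\<close>
    and \<open>s\<close>; the contribution of \<open>f r (U 0 \<omega>)\<close> cancels.\<close>
  have inv: "(\<integral>\<omega>. g \<omega> * f r (U t \<omega>) \<partial>N) - (\<integral>\<omega>. g \<omega> * J t \<omega> \<partial>N)
      = (\<integral>\<omega>. g \<omega> * f r (U s \<omega>) \<partial>N) - (\<integral>\<omega>. g \<omega> * J s \<omega> \<partial>N)" if "s \<le> t" for t
  proof -
    have *: "(\<integral>\<omega>. g \<omega> * (f r (U q \<omega>) - f r (U 0 \<omega>) - J q \<omega>) \<partial>N) = (\<integral>\<omega>. g \<omega> * f r (U q \<omega>) \<partial>N)
        - (\<integral>\<omega>. g \<omega> * f r (U 0 \<omega>) \<partial>N) - (\<integral>\<omega>. g \<omega> * J q \<omega> \<partial>N)" if "0 \<le> q" for q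
      using int_f[OF r that] int_f[OF r, of 0] int_J[OF that] by (simp add: right_diff_distrib)
    show ?thesis
      using martingale_expectation[OF mart s that g] *[of t] *[of s] s that by simp
  qed
  \<comment> \<open>The derivative is tested along sequences, because dominated convergence is
    stated for them.\<close>
  show ?thesis
    unfolding has_field_derivative_iff tendsto_at_iff_sequentially
  proof (intro allI impI)
    fix X assume X: "\<forall>i. X i \<in> {s..T} - {r}" and lim: "X \<longlonglongrightarrow> r"
    have X0: "0 \<le> X i" "s \<le> X i" "X i \<in> {s..T}" "X i \<noteq> r" for i using X s by (auto simp: order_trans)
    let ?q = "\<lambda>i \<omega>. g \<omega> * ((f (X i) (U (X i) \<omega>) - f r (U (X i) \<omega>)) / (X i - r)) + g \<omega> * ((J (X i) \<omega>
        - J r \<omega>) / (X i - r))"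
    have mvt: "\<exists>z\<in>{s..T}. \<bar>z - r\<bar> \<le> \<bar>y - r\<bar> \<and> (f y x - f r x) / (y - r) = ft z x"
        if y: "y \<in> {s..T}" "y \<noteq> r" for y x
    proof (cases "y < r")
      case True
      obtain z where "y < z" "z < r" "f r x - f y x = (r - y) * ft z x"
        using MVT2[OF True, of "\<lambda>r. f r x" "\<lambda>r. ft r x"] ft by auto
      then show ?thesis using True y r by (intro bexI[of _ z]) (auto simp: field_simps)
    next
      case False
      then have "r < y" using y by simp
      then obtain z where "r < z" "z < y" "f y x - f r x = (y - r) * ft z x"
        using MVT2[of r y "\<lambda>r. f r x" "\<lambda>r. ft r x"] ft by auto
      then show ?thesis using y r by (intro bexI[of _ z]) (auto simp: field_simps)
    qed
    have ftq: "\<bar>(f y x - f r x) / (y - r)\<bar> \<le> B" if "y \<in> {s..T}" "y \<noteq> r" for y x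
      using mvt[OF that, of x] bounds(1) by metis
    have Jq: "\<bar>(J y \<omega> - J r \<omega>) / (y - r)\<bar> \<le> B" if "0 \<le> y" "y \<noteq> r" "\<omega> \<in> space N" for y \<omega>
      using J_lip[OF that(3,1) r0(1)] that(2) by (simp add: abs_divide pos_divide_le_eq)
    have "(\<lambda>i. \<integral>\<omega>. ?q i \<omega> \<partial>N) \<longlonglongrightarrow> (\<integral>\<omega>. g \<omega> * ft r (U r \<omega>) + g \<omega> * ou_gen (f r) (U r \<omega>) \<partial>N)"
    proof (rule integral_dominated_convergence[where w="\<lambda>_. B + B"])
      show "AE \<omega> in N. (\<lambda>i. ?q i \<omega>) \<longlonglongrightarrow> g \<omega> * ft r (U r \<omega>) + g \<omega> * ou_gen (f r) (U r \<omega>)"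
      proof (rule AE_I2, intro tendsto_add tendsto_mult tendsto_const)
        fix \<omega> assume w: "\<omega> \<in> space N"
        have "((\<lambda>t. U t \<omega>) \<longlongrightarrow> U r \<omega>) (at r within {0..})"
          using continuous_U[OF w] r0 by (simp add: continuous_on_def)
        then have UX: "(\<lambda>i. U (X i) \<omega>) \<longlonglongrightarrow> U r \<omega>"
          using lim X0 unfolding tendsto_at_iff_sequentially comp_def by auto
        \<comment> \<open>The intermediate time depends on \<omega>. It is used at this fixed
          \<omega> only: it is squeezed towards \<open>r\<close>, and joint continuity of
          \<open>ft\<close> gives the limit.\<close>
        have "\<forall>i. \<exists>z. \<bar>z - r\<bar> \<le> \<bar>X i - r\<bar> \<and>
            (f (X i) (U (X i) \<omega>) - f r (U (X i) \<omega>)) / (X i - r) = ft z (U (X i) \<omega>)"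
          using mvt[OF X0(3,4)] by blast
        from choice[OF this] obtain z where z': "\<forall>i. \<bar>z i - r\<bar> \<le> \<bar>X i - r\<bar> \<and>
            (f (X i) (U (X i) \<omega>) - f r (U (X i) \<omega>)) / (X i - r) = ft (z i) (U (X i) \<omega>)" ..
        then have z: "\<And>i. \<bar>z i - r\<bar> \<le> \<bar>X i - r\<bar>"
          "\<And>i. (f (X i) (U (X i) \<omega>) - f r (U (X i) \<omega>)) / (X i - r) = ft (z i) (U (X i) \<omega>)"
          by blast+
        have "(\<lambda>i. X i - r) \<longlonglongrightarrow> 0" using lim LIM_zero by blast
        then have "(\<lambda>i. z i - r) \<longlonglongrightarrow> 0"
          by (rule tendsto_0_le[where K=1]) (use z(1) in auto)
        then have "z \<longlonglongrightarrow> r" using LIM_zero_cancel by blast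
        then have "(\<lambda>i. (z i, U (X i) \<omega>)) \<longlonglongrightarrow> (r, U r \<omega>)" using UX by (intro tendsto_Pair)
        then have "(\<lambda>i. (\<lambda>(r, x). ft r x) (z i, U (X i) \<omega>)) \<longlonglongrightarrow> (\<lambda>(r, x). ft r x) (r, U r \<omega>)"
          by (rule continuous_on_tendsto_compose[OF ft_cont]) auto
        then show "(\<lambda>i. (f (X i) (U (X i) \<omega>) - f r (U (X i) \<omega>)) / (X i - r)) \<longlonglongrightarrow> ft r (U r \<omega>)"
          by (simp add: z(2))
        have "((\<lambda>t. J t \<omega>) has_real_derivative ou_gen (f r) (U r \<omega>)) (at r within {0..T})"
          using w r s by (intro J_deriv) auto
        then show "(\<lambda>i. (J (X i) \<omega> - J r \<omega>) / (X i - r)) \<longlonglongrightarrow> ou_gen (f r) (U r \<omega>)"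
          using lim X0 unfolding has_field_derivative_iff tendsto_at_iff_sequentially comp_def by auto
      qed
      show "AE \<omega> in N. norm (?q i \<omega>) \<le> B + B" for i
        unfolding real_norm_def
        by (intro AE_I2 order_trans[OF abs_triangle_ineq] add_mono gB ftq Jq X0)
      show "(\<lambda>\<omega>. ?q i \<omega>) \<in> borel_measurable N" for i
        using X0[of i] r0 by measurable
    qed (use r0 in auto)
    also have "(\<lambda>i. \<integral>\<omega>. ?q i \<omega> \<partial>N) = ((\<lambda>y. ((\<integral>\<omega>. g \<omega> * f y (U y \<omega>) \<partial>N) - (\<integral>\<omega>. g \<omega> * f r (U r \<omega>) \<partial>N)) /
        (y - r)) \<circ> X)"
    proof (rule ext, unfold comp_def)
      fix i
      have "(\<integral>\<omega>. ?q i \<omega> \<partial>N) = ((\<integral>\<omega>. g \<omega> * f (X i) (U (X i) \<omega>) \<partial>N) - (\<integral>\<omega>. g \<omega> * f r (U (X i) \<omega>) \<partial>N)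
          + (\<integral>\<omega>. g \<omega> * J (X i) \<omega> \<partial>N) - (\<integral>\<omega>. g \<omega> * J r \<omega> \<partial>N)) / (X i - r)"
        using int_f[OF X0(3,1), of i] int_f[OF r X0(1), of i] int_J[OF X0(1), of i] int_J[OF r0(1)]
        by (simp add: right_diff_distrib add_divide_distrib diff_divide_distrib)
      also have "\<dots> = ((\<integral>\<omega>. g \<omega> * f (X i) (U (X i) \<omega>) \<partial>N) - (\<integral>\<omega>. g \<omega> * f r (U r \<omega>) \<partial>N)) / (X i - r)"
        using inv[OF X0(2), of i] inv[OF r0(2)] by (simp add: algebra_simps)
      finally show "(\<integral>\<omega>. ?q i \<omega> \<partial>N) = ((\<integral>\<omega>. g \<omega> * f (X i) (U (X i) \<omega>) \<partial>N) - (\<integral>\<omega>. g \<omega> * f r (U r \<omega>) \<partial>N))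
          / (X i - r)" .
    qed
    finally show "((\<lambda>y. ((\<integral>\<omega>. g \<omega> * f y (U y \<omega>) \<partial>N) - (\<integral>\<omega>. g \<omega> * f r (U r \<omega>) \<partial>N)) / (y - r)) \<circ> X)
        \<longlonglongrightarrow> (\<integral>\<omega>. g \<omega> * (ft r (U r \<omega>) + ou_gen (f r) (U r \<omega>)) \<partial>N)"
      unfolding distrib_left .
  qed
qed

end

text \<open>If \<open>f\<close> is not integrable, its integral is 0 by convention and
  \<open>0 \<le> c\<close> settles the claim.\<close>

lemma (in prob_space) norm_integral_le_const:
  fixes f :: "'a \<Rightarrow> 'b :: {banach, second_countable_topology}"
  assumes "\<And>\<omega>. \<omega> \<in> space M \<Longrightarrow> norm (f \<omega>) \<le> c" "0 \<le> c"
  shows "norm (integral\<^sup>L M f) \<le> c"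
proof (cases "integrable M f")
  case True
  have "norm (integral\<^sup>L M f) \<le> (\<integral>\<omega>. norm (f \<omega>) \<partial>M)" by (rule integral_norm_bound)
  also have "\<dots> \<le> (\<integral>\<omega>. c \<partial>M)" using True assms by (intro integral_mono) auto
  finally show ?thesis by (simp add: prob_space)
qed (use assms in \<open>simp add: not_integrable_integral_eq\<close>)

section \<open>The backward equation and the Gaussian increments\<close>

context ou_process
begin

text \<open>Without the cutoff the amplitude and frequency make \<open>f\<close> below a solution of the backward equation,
  so that only the terms containing derivatives of the cutoff survive.\<close>

lemma wave_expectation_step:
  fixes l a s T R :: real
  assumes g: "g \<in> borel_measurable (natural_filtration N U s)" "\<And>\<omega>. \<bar>g \<omega>\<bar> \<le> 1"
    and sT: "0 \<le> s" "s \<le> T" and R: "1 \<le> R"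
  defines "\<psi> \<equiv> exp (- (l\<^sup>2 * (1 - exp (2 * (s - T))) / 2))"
  shows "\<bar>(\<integral>\<omega>. g \<omega> * wave R 1 l a (U T \<omega>) \<partial>N) - (\<integral>\<omega>. g \<omega> * wave R \<psi> (l * exp (s - T)) a (U s \<omega>) \<partial>N)\<bar>
    \<le> (6 * \<bar>l\<bar> + 18) / R * (T - s)"
proof -
  \<comment> \<open>Amplitude and frequency solve A' = A L^2 and L' = L with terminal values A(T) =
    1 and L(T) = l.\<close>
  define A where "A r = exp (- (l\<^sup>2 * (1 - exp (2 * (r - T))) / 2))" for r
  define L where "L r = l * exp (r - T)" for r
  define f where "f r = wave R (A r) (L r) a" for r
  define ft where "ft r x = A r * ((L r)\<^sup>2 * cos (L r * x + a) - L r * x * sin (L r * x + a)) * cutoff R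
      x" for r x
  have R0: "0 < R" "R \<noteq> 0" using R by auto
  \<comment> \<open>One constant for all three bounds: the first two summands bound
    \<open>ft\<close>, the fraction bounds the sum of \<open>ft\<close> and the generator, and 1
    bounds \<open>f\<close>.\<close>
  define B where "B = l\<^sup>2 + \<bar>l\<bar> * exp R + (6 * \<bar>l\<bar> + 18) / R + 1"
  have A_deriv: "(A has_real_derivative A r * (L r)\<^sup>2) (at r)" for r
    unfolding A_def[abs_def] L_def
    by (auto intro!: derivative_eq_intros simp: power_mult_distrib exp_double[symmetric])
  have L_deriv: "(L has_real_derivative L r) (at r)" for r
    unfolding L_def[abs_def] by (auto intro!: derivative_eq_intros)
  have ft: "((\<lambda>r. f r x) has_real_derivative ft r x) (at r)" for r x
    unfolding f_def ft_def wave_def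
    by (auto intro!: derivative_eq_intros A_deriv L_deriv simp: algebra_simps)
  have AL_cont: "continuous_on S (\<lambda>p. A (h p))" "continuous_on S (\<lambda>p. L (h p))" if "continuous_on S h"
      for S :: "(real \<times> real) set" and h
    unfolding A_def L_def using that by (auto intro!: continuous_intros)
  have ft_cont: "continuous_on UNIV (\<lambda>(r, x). ft r x)"
    unfolding ft_def case_prod_beta by (intro continuous_intros AL_cont)
  have A_bound: "0 \<le> A r" "A r \<le> 1" and L_bound: "\<bar>L r\<bar> \<le> \<bar>l\<bar>" if "r \<in> {s..T}" for r
  proof -
    have "exp (2 * (r - T)) \<le> 1" "exp (r - T) \<le> 1" using that by auto
    then show "0 \<le> A r" "A r \<le> 1" "\<bar>L r\<bar> \<le> \<bar>l\<bar>"
      by (auto simp: A_def L_def abs_mult intro: mult_left_le)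
  qed
  \<comment> \<open>The terms in which the cutoff is not differentiated, -L^2 cos + L x sin, cancel
    against \<open>ft\<close>.\<close>
  have gen: "ou_gen (f r) x + ft r x = A r * (- 2 * L r * sin (L r * x + a) * cutoff_deriv R x
      + cos (L r * x + a) * (cutoff_deriv2 R x - x * cutoff_deriv R x))" for r x
    unfolding f_def ou_gen_wave[OF R0(2)] ft_def wave_deriv_def wave_deriv2_def
        by (simp add: algebra_simps)
  \<comment> \<open>The mixed term gives 2 |l| times 3/R, the two others 12/R and 6/R; the amplitude
    is at most 1 before time \<open>T\<close>.\<close>
  have gen_bound: "\<bar>ou_gen (f r) x + ft r x\<bar> \<le> (6 * \<bar>l\<bar> + 18) / R" if r: "r \<in> {s..T}" for r x
  proof -
    have "\<bar>- 2 * L r * sin (L r * x + a) * cutoff_deriv R x\<bar>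
        = 2 * (\<bar>L r\<bar> * (\<bar>sin (L r * x + a)\<bar> * \<bar>cutoff_deriv R x\<bar>))"
      by (simp add: abs_mult)
    also have "\<dots> \<le> 2 * (\<bar>l\<bar> * (1 * (3 / R)))"
      using L_bound[OF r] cutoff_deriv_bounds(1)[OF R] by (intro mult_left_mono mult_mono) auto
    finally have 1: "\<bar>- 2 * L r * sin (L r * x + a) * cutoff_deriv R x\<bar> \<le> 6 * \<bar>l\<bar> / R" by simp
    have "\<bar>cos (L r * x + a) * (cutoff_deriv2 R x - x * cutoff_deriv R x)\<bar> \<le> 1 * (12 / R + 6 / R)"
      unfolding abs_mult
      by (intro mult_mono order_trans[OF abs_triangle_ineq4] add_mono cutoff_deriv_bounds[OF R]) auto
    then have 2: "\<bar>cos (L r * x + a) * (cutoff_deriv2 R x - x * cutoff_deriv R x)\<bar> \<le> 18 / R"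
      by (simp add: add_divide_distrib[symmetric])
    have "\<bar>ou_gen (f r) x + ft r x\<bar> \<le> 1 * (6 * \<bar>l\<bar> / R + 18 / R)"
      unfolding gen abs_mult
      using A_bound[OF r] by (intro mult_mono order_trans[OF abs_triangle_ineq] add_mono 1 2) auto
    then show ?thesis by (simp add: add_divide_distrib)
  qed
  have ft_bound: "\<bar>ft r x\<bar> \<le> l\<^sup>2 + \<bar>l\<bar> * exp R" if r: "r \<in> {s..T}" for r x
  proof -
    have c: "\<bar>cos (L r * x + a)\<bar> \<le> 1" "\<bar>sin (L r * x + a)\<bar> \<le> 1" by auto
    have "\<bar>(L r)\<^sup>2 * cos (L r * x + a) * cutoff R x\<bar> \<le> l\<^sup>2 * 1 * 1"
      unfolding abs_mult using L_bound[OF r] cutoff_le_1[OF R0(1)] cutoff_nonneg[of R x]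
      by (intro mult_mono) (auto simp: abs_le_square_iff)
    moreover have "\<bar>L r * sin (L r * x + a) * (x * cutoff R x)\<bar> \<le> \<bar>l\<bar> * 1 * exp R"
      unfolding abs_mult using L_bound[OF r] cutoff_mult_bound[OF R0(1), of x] cutoff_nonneg[of R x]
      by (intro mult_mono) (auto simp: abs_of_nonneg)
    ultimately have "\<bar>(L r)\<^sup>2 * cos (L r * x + a) * cutoff R x - L r * sin (L r * x
        + a) * (x * cutoff R x)\<bar> \<le> l\<^sup>2 + \<bar>l\<bar> * exp R"
      by linarith
    moreover have "ft r x = A r * ((L r)\<^sup>2 * cos (L r * x + a) * cutoff R x - L r * sin (L r * x
        + a) * (x * cutoff R x))"
      by (simp add: ft_def algebra_simps)
    ultimately have "\<bar>ft r x\<bar> \<le> 1 * (l\<^sup>2 + \<bar>l\<bar> * exp R)"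
      using A_bound[OF r] by (simp only: abs_mult) (intro mult_mono, auto)
    then show ?thesis by simp
  qed
  have f_bound: "\<bar>f r x\<bar> \<le> 1" if r: "r \<in> {s..T}" for r x
  proof -
    have "\<bar>f r x\<bar> \<le> 1 * (1 * 1)"
      unfolding f_def wave_def abs_mult
      using A_bound[OF r] cutoff_le_1[OF R0(1)] cutoff_nonneg[of R x] by (intro mult_mono) auto
    then show ?thesis by simp
  qed
  have nn: "0 \<le> l\<^sup>2" "0 \<le> \<bar>l\<bar> * exp R" "0 \<le> (6 * \<bar>l\<bar> + 18) / R" using R0 by auto
  have deriv: "((\<lambda>r. \<integral>\<omega>. g \<omega> * f r (U r \<omega>) \<partial>N) has_real_derivative
    (\<integral>\<omega>. g \<omega> * (ft r (U r \<omega>) + ou_gen (f r) (U r \<omega>)) \<partial>N)) (at r within {s..T})" if r: "r \<in> {s..T}" for r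
  proof (rule dynkin_derivative[OF g sT(1) r _ _ ft ft_cont, where B=B])
    show "f q \<in> C2_compact_support" for q unfolding f_def by (rule wave_C2[OF R0(1)])
    show "continuous_on UNIV (f q)" for q
      unfolding f_def wave_def[abs_def] by (intro continuous_intros)
    show "continuous_on UNIV (ou_gen (f r))"
      unfolding f_def ou_gen_wave[OF R0(2), abs_def] wave_deriv_def wave_deriv2_def
      by (intro continuous_intros)
    show "\<bar>ft q x\<bar> \<le> B" if "q \<in> {s..T}" for q x
      using ft_bound[OF that, of x] nn unfolding B_def by linarith
    show "\<bar>ou_gen (f r) x\<bar> \<le> B" for x
      using ft_bound[OF r, of x] gen_bound[OF r, of x] unfolding B_def by linarith
    show "\<bar>f q x\<bar> \<le> B" if "q \<in> {s..T}" for q x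
      using f_bound[OF that, of x] nn unfolding B_def by linarith
  qed
  have deriv_bound: "\<bar>\<integral>\<omega>. g \<omega> * (ft r (U r \<omega>) + ou_gen (f r) (U r \<omega>)) \<partial>N\<bar> \<le> (6 * \<bar>l\<bar> + 18) / R"
      if r: "r \<in> {s..T}" for r
  proof -
    have pw: "\<bar>g \<omega> * (ft r (U r \<omega>) + ou_gen (f r) (U r \<omega>))\<bar> \<le> (6 * \<bar>l\<bar> + 18) / R" for \<omega>
      using mult_mono[OF g(2)[of \<omega>] gen_bound[OF r, of "U r \<omega>"]] by (simp add: abs_mult add.commute)
    show ?thesis
      using norm_integral_le_const[of "\<lambda>\<omega>. g \<omega> * (ft r (U r \<omega>) + ou_gen (f r) (U r \<omega>))", OF _ nn(3)] pw
          by simp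
  qed
  have "norm ((\<integral>\<omega>. g \<omega> * f T (U T \<omega>) \<partial>N) - (\<integral>\<omega>. g \<omega> * f s (U s \<omega>) \<partial>N)) \<le> (6 * \<bar>l\<bar> + 18) / R * norm (T
      - s)"
    by (rule field_differentiable_bound[of "{s..T}", OF _ deriv]) (use deriv_bound sT in auto)
  moreover have "f T = wave R 1 l a" "f s = wave R \<psi> (l * exp (s - T)) a"
    by (simp_all add: f_def A_def L_def \<psi>_def)
  ultimately show ?thesis using sT by simp
qed

lemma integral_wave_tendsto:
  assumes g: "g \<in> borel_measurable N" "\<And>\<omega>. \<bar>g \<omega>\<bar> \<le> 1" and t: "0 \<le> t"
  shows "(\<lambda>n. \<integral>\<omega>. g \<omega> * wave (real (Suc n)) A l a (U t \<omega>) \<partial>N)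
      \<longlonglongrightarrow> (\<integral>\<omega>. g \<omega> * (A * cos (l * U t \<omega> + a)) \<partial>N)"
proof (rule integral_dominated_convergence[where w="\<lambda>_. \<bar>A\<bar>"])
  have "(\<lambda>n. g \<omega> * (A * (cos (l * U t \<omega> + a) * cutoff (real (Suc n)) (U t \<omega>))))
      \<longlonglongrightarrow> g \<omega> * (A * (cos (l * U t \<omega> + a) * 1))" for \<omega>
    by (intro tendsto_intros cutoff_tendsto)
  then show "AE \<omega> in N. (\<lambda>n. g \<omega> * wave (real (Suc n)) A l a (U t \<omega>)) \<longlonglongrightarrow> g \<omega> * (A * cos (l * U t \<omega> + a))"
    by (simp add: wave_def)
  have "continuous_on UNIV (wave (real (Suc n)) A l a)" for n
    unfolding wave_def[abs_def] by (intro continuous_intros)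
  then have [measurable]: "wave (real (Suc n)) A l a \<in> borel_measurable borel" for n
    by (rule borel_measurable_continuous_onI)
  show "(\<lambda>\<omega>. g \<omega> * wave (real (Suc n)) A l a (U t \<omega>)) \<in> borel_measurable N" for n
    using g t by measurable
  show "AE \<omega> in N. norm (g \<omega> * wave (real (Suc n)) A l a (U t \<omega>)) \<le> \<bar>A\<bar>" for n
  proof (rule AE_I2)
    fix \<omega>
    have "\<bar>g \<omega>\<bar> * (\<bar>A\<bar> * (\<bar>cos (l * U t \<omega> + a)\<bar> * \<bar>cutoff (real (Suc n)) (U t \<omega>)\<bar>))
        \<le> 1 * (\<bar>A\<bar> * (1 * 1))"
      using g(2) cutoff_le_1[of "real (Suc n)" "U t \<omega>"] cutoff_nonneg[of "real (Suc n)" "U t \<omega>"]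
      by (intro mult_mono) auto
    then show "norm (g \<omega> * wave (real (Suc n)) A l a (U t \<omega>)) \<le> \<bar>A\<bar>" by (simp add: wave_def abs_mult)
  qed
qed (use g t in measurable)

text \<open>The cutoff is removed: with \<open>R = Suc n\<close> the error of
  \<open>wave_expectation_step\<close> is O(1/R). The result is Mehler's formula for waves, tested
  against the past.\<close>

lemma cos_expectation_step:
  assumes g: "g \<in> borel_measurable (natural_filtration N U s)" "\<And>\<omega>. \<bar>g \<omega>\<bar> \<le> 1"
    and sT: "0 \<le> s" "s \<le> T"
  shows "(\<integral>\<omega>. g \<omega> * cos (l * U T \<omega> + a) \<partial>N) =
    exp (- (l\<^sup>2 * (1 - exp (2 * (s - T))) / 2)) * (\<integral>\<omega>. g \<omega> * cos (l * exp (s - T) * U s \<omega> + a) \<partial>N)"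
proof -
  define \<psi> where "\<psi> = exp (- (l\<^sup>2 * (1 - exp (2 * (s - T))) / 2))"
  have gN: "g \<in> borel_measurable N"
    using g(1) natural_filtration_subalgebra[of U N s] measurable_from_subalg by (metis measurable_U)
  let ?D = "\<lambda>n. (\<integral>\<omega>. g \<omega> * wave (real (Suc n)) 1 l a (U T \<omega>) \<partial>N)
      - (\<integral>\<omega>. g \<omega> * wave (real (Suc n)) \<psi> (l * exp (s - T)) a (U s \<omega>) \<partial>N)"
  have "?D \<longlonglongrightarrow> (\<integral>\<omega>. g \<omega> * (1 * cos (l * U T \<omega> + a)) \<partial>N) - (\<integral>\<omega>. g \<omega> * (\<psi> * cos (l * exp (s - T) * U s \<omega>
      + a)) \<partial>N)"
    by (intro tendsto_diff integral_wave_tendsto gN g(2)) (use sT in auto)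
  moreover have "?D \<longlonglongrightarrow> 0"
  proof (rule tendsto_0_le[where K=1])
    have "(\<lambda>n. (6 * \<bar>l\<bar> + 18) * (T - s) * inverse (real (Suc n))) \<longlonglongrightarrow> (6 * \<bar>l\<bar> + 18) * (T - s) * 0"
      by (intro tendsto_intros LIMSEQ_inverse_real_of_nat)
    then show "(\<lambda>n. (6 * \<bar>l\<bar> + 18) * (T - s) * inverse (real (Suc n))) \<longlonglongrightarrow> 0" by simp
    show "\<forall>\<^sub>F n in sequentially. norm (?D n) \<le> norm ((6 * \<bar>l\<bar> + 18) * (T - s) * inverse (real (Suc n)))
        * 1"
    proof (intro always_eventually allI)
      fix n
      have "\<bar>?D n\<bar> \<le> (6 * \<bar>l\<bar> + 18) / real (Suc n) * (T - s)"
        unfolding \<psi>_def by (rule wave_expectation_step[OF g sT]) simp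
      also have "\<dots> \<le> \<bar>(6 * \<bar>l\<bar> + 18) * (T - s) * inverse (real (Suc n))\<bar>"
        by (rule order_trans[OF _ abs_ge_self]) (simp add: divide_inverse)
      finally show "norm (?D n) \<le> norm ((6 * \<bar>l\<bar> + 18) * (T - s) * inverse (real (Suc n))) * 1" by simp
    qed
  qed
  ultimately have "(\<integral>\<omega>. g \<omega> * (1 * cos (l * U T \<omega> + a)) \<partial>N) - (\<integral>\<omega>. g \<omega> * (\<psi> * cos (l * exp (s
      - T) * U s \<omega> + a)) \<partial>N) = 0"
    by (rule LIMSEQ_unique)
  then show ?thesis by (simp only: \<psi>_def[symmetric] mult.left_commute[of _ \<psi>]) simp
qed

text \<open>The phase \<open>l * exp (s - T) * U s\<close> is known at time \<open>s\<close>, so by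
  the addition theorem its cosine and sine can be moved into the weight and
  \<open>cos_expectation_step\<close> applies. The real part collapses by cos^2 + sin^2 = 1 and the
  imaginary part cancels. As the answer depends on \<open>A\<close> only through
  \<open>prob A\<close>, the increment is independent of the past.\<close>

lemma increment_char:
  assumes A: "A \<in> sets (natural_filtration N U s)" and sT: "0 \<le> s" "s \<le> T"
  shows "(CLINT \<omega>|N. indicator A \<omega> * iexp (l * (U T \<omega> - exp (s - T) * U s \<omega>)))
     = prob A * exp (- (l\<^sup>2 * (1 - exp (2 * (s - T))) / 2))"
proof -
  define \<psi> where "\<psi> = exp (- (l\<^sup>2 * (1 - exp (2 * (s - T))) / 2))"
  define b where "b \<omega> = l * exp (s - T) * U s \<omega>" for \<omega>
  let ?F = "natural_filtration N U s"
  have sub: "subalgebra N ?F" by (rule natural_filtration_subalgebra) simp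
  have AN [measurable]: "A \<in> sets N" using A sub by (auto simp: subalgebra_def)
  have T0: "0 \<le> T" using sT by simp
  have bF [measurable]: "b \<in> borel_measurable ?F"
    unfolding b_def using natural_filtration_measurable[of s s U N] sT by measurable
  have bN [measurable]: "b \<in> borel_measurable N" using bF sub measurable_from_subalg by blast
  have AF: "indicat_real A \<in> borel_measurable ?F" using A by (rule borel_measurable_indicator)
  have step: "(\<integral>\<omega>. indicator A \<omega> * h (b \<omega>) * cos (l * U T \<omega> + a) \<partial>N)
      = \<psi> * (\<integral>\<omega>. indicator A \<omega> * h (b \<omega>) * cos (b \<omega> + a) \<partial>N)"
    if h: "h \<in> borel_measurable borel" "\<And>z. \<bar>h z\<bar> \<le> 1" for h :: "real \<Rightarrow> real" and a
  proof -
    have "(\<lambda>\<omega>. indicat_real A \<omega> * h (b \<omega>)) \<in> borel_measurable ?F"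
      by (intro borel_measurable_times AF measurable_compose[OF bF h(1)])
    moreover have "\<bar>indicat_real A \<omega> * h (b \<omega>)\<bar> \<le> 1" for \<omega>
      using h(2) by (simp add: indicator_def)
    ultimately show ?thesis
      using cos_expectation_step[of "\<lambda>\<omega>. indicat_real A \<omega> * h (b \<omega>)", OF _ _ sT, of l a]
      by (simp only: \<psi>_def b_def)
  qed
  \<comment> \<open>Sine waves are covered by the phase \<open>- (pi / 2)\<close>.\<close>
  have sin: "cos (z - pi / 2) = sin z" for z :: real by (simp add: cos_diff)
  have int: "integrable N (\<lambda>\<omega>. indicator A \<omega> * h (b \<omega>) * k (U T \<omega>))"
    if "h \<in> borel_measurable borel" "\<And>z. \<bar>h z\<bar> \<le> 1" "k \<in> borel_measurable borel" "\<And>z. \<bar>k z\<bar> \<le> 1"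
        for h k :: "real \<Rightarrow> real"
    using that T0 by (intro integrable_const_bound[where B=1] AE_I2) (auto simp: abs_mult indicator_def
        intro: mult_le_one)
  have int': "integrable N (\<lambda>\<omega>. indicator A \<omega> * h (b \<omega>) * k (b \<omega>))"
    if "h \<in> borel_measurable borel" "\<And>z. \<bar>h z\<bar> \<le> 1" "k \<in> borel_measurable borel" "\<And>z. \<bar>k z\<bar> \<le> 1"
        for h k :: "real \<Rightarrow> real"
    using that T0 by (intro integrable_const_bound[where B=1] AE_I2) (auto simp: abs_mult indicator_def
        intro: mult_le_one)
  have i1: "integrable N (\<lambda>\<omega>. indicator A \<omega> * cos (b \<omega>) * cos (l * U T \<omega> + a))" for a
    by (rule int[of cos "\<lambda>z. cos (l * z + a)"]) auto
  have i2: "integrable N (\<lambda>\<omega>. indicator A \<omega> * sin (b \<omega>) * cos (l * U T \<omega> + a))" for a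
    by (rule int[of sin "\<lambda>z. cos (l * z + a)"]) auto
  have j1: "integrable N (\<lambda>\<omega>. indicator A \<omega> * cos (b \<omega>) * cos (b \<omega> + a))" for a
    by (rule int'[of cos "\<lambda>z. cos (z + a)"]) auto
  have j2: "integrable N (\<lambda>\<omega>. indicator A \<omega> * sin (b \<omega>) * cos (b \<omega> + a))" for a
    by (rule int'[of sin "\<lambda>z. cos (z + a)"]) auto
  have s1: "(\<integral>\<omega>. indicator A \<omega> * cos (b \<omega>) * cos (l * U T \<omega> + a) \<partial>N)
      = \<psi> * (\<integral>\<omega>. indicator A \<omega> * cos (b \<omega>) * cos (b \<omega> + a) \<partial>N)" for a
    by (rule step) auto
  have s2: "(\<integral>\<omega>. indicator A \<omega> * sin (b \<omega>) * cos (l * U T \<omega> + a) \<partial>N)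
      = \<psi> * (\<integral>\<omega>. indicator A \<omega> * sin (b \<omega>) * cos (b \<omega> + a) \<partial>N)" for a
    by (rule step) auto
  have arg: "l * (U T \<omega> - exp (s - T) * U s \<omega>) = l * U T \<omega> - b \<omega>" for \<omega>
    by (simp add: b_def algebra_simps)
  have "(\<integral>\<omega>. indicator A \<omega> * cos (l * U T \<omega> - b \<omega>) \<partial>N)
      = (\<integral>\<omega>. indicator A \<omega> * cos (b \<omega>) * cos (l * U T \<omega> + 0) \<partial>N) + (\<integral>\<omega>. indicator A \<omega> * sin (b \<omega>) * cos
          (l * U T \<omega> + - (pi / 2)) \<partial>N)"
    unfolding Bochner_Integration.integral_add[OF i1 i2, symmetric]
    by (intro Bochner_Integration.integral_cong) (auto simp: cos_diff sin algebra_simps)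
  also have "\<dots> = \<psi> * ((\<integral>\<omega>. indicator A \<omega> * cos (b \<omega>) * cos (b \<omega> + 0) \<partial>N)
      + (\<integral>\<omega>. indicator A \<omega> * sin (b \<omega>) * cos (b \<omega> + - (pi / 2)) \<partial>N))"
    unfolding s1 s2 distrib_left ..
  also have "\<dots> = \<psi> * (\<integral>\<omega>. indicator A \<omega> \<partial>N)"
    unfolding Bochner_Integration.integral_add[OF j1 j2, symmetric]
    by (intro arg_cong[where f="\<lambda>z. \<psi> * z"] Bochner_Integration.integral_cong)
       (auto simp: sin power2_eq_square[symmetric] distrib_left[symmetric] mult.assoc)
  finally have re: "(\<integral>\<omega>. indicator A \<omega> * cos (l * U T \<omega> - b \<omega>) \<partial>N) = prob A * \<psi>" by simp
  have "(\<integral>\<omega>. indicator A \<omega> * sin (l * U T \<omega> - b \<omega>) \<partial>N)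
      = (\<integral>\<omega>. indicator A \<omega> * cos (b \<omega>) * cos (l * U T \<omega> + - (pi / 2)) \<partial>N)
          - (\<integral>\<omega>. indicator A \<omega> * sin (b \<omega>) * cos (l * U T \<omega> + 0) \<partial>N)"
    unfolding Bochner_Integration.integral_diff[OF i1 i2, symmetric]
    by (intro Bochner_Integration.integral_cong) (auto simp: sin_diff sin algebra_simps)
  also have "\<dots> = \<psi> * ((\<integral>\<omega>. indicator A \<omega> * cos (b \<omega>) * cos (b \<omega> + - (pi / 2)) \<partial>N)
      - (\<integral>\<omega>. indicator A \<omega> * sin (b \<omega>) * cos (b \<omega> + 0) \<partial>N))"
    unfolding s1 s2 right_diff_distrib ..
  also have "\<dots> = 0" by (simp add: sin mult.commute mult.left_commute)
  finally have im: "(\<integral>\<omega>. indicator A \<omega> * sin (l * U T \<omega> - b \<omega>) \<partial>N) = 0" .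
  have iexp_parts: "Re (iexp z) = cos z" "Im (iexp z) = sin z" for z
    by (simp_all add: cis_conv_exp[symmetric])
  have cint: "integrable N (\<lambda>\<omega>. indicator A \<omega> * iexp (l * U T \<omega> - b \<omega>))"
    using T0 by (intro integrable_const_bound[where B=1] AE_I2) (auto simp: indicator_def norm_mult)
  have "(CLINT \<omega>|N. indicator A \<omega> * iexp (l * U T \<omega> - b \<omega>)) = complex_of_real (prob A * \<psi>)"
  proof (rule complex_eqI)
    have "Re (CLINT \<omega>|N. indicator A \<omega> * iexp (l * U T \<omega> - b \<omega>))
        = (\<integral>\<omega>. Re (indicator A \<omega> * iexp (l * U T \<omega> - b \<omega>)) \<partial>N)"
      by (rule integral_bounded_linear[OF bounded_linear_Re cint, symmetric])
    also have "\<dots> = (\<integral>\<omega>. indicator A \<omega> * cos (l * U T \<omega> - b \<omega>) \<partial>N)"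
      by (intro Bochner_Integration.integral_cong) (auto simp: indicator_def iexp_parts simp del:
          of_real_diff of_real_mult)
    finally show "Re (CLINT \<omega>|N. indicator A \<omega> * iexp (l * U T \<omega> - b \<omega>))
        = Re (complex_of_real (prob A * \<psi>))"
      by (simp add: re)
    have "Im (CLINT \<omega>|N. indicator A \<omega> * iexp (l * U T \<omega> - b \<omega>))
        = (\<integral>\<omega>. Im (indicator A \<omega> * iexp (l * U T \<omega> - b \<omega>)) \<partial>N)"
      by (rule integral_bounded_linear[OF bounded_linear_Im cint, symmetric])
    also have "\<dots> = (\<integral>\<omega>. indicator A \<omega> * sin (l * U T \<omega> - b \<omega>) \<partial>N)"
      by (intro Bochner_Integration.integral_cong) (auto simp: indicator_def iexp_parts simp del:
          of_real_diff of_real_mult)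
    finally show "Im (CLINT \<omega>|N. indicator A \<omega> * iexp (l * U T \<omega> - b \<omega>))
        = Im (complex_of_real (prob A * \<psi>))"
      by (simp add: im)
  qed
  then show ?thesis unfolding arg \<psi>_def .
qed

end

section \<open>Convergence of box probabilities from characteristic functions\<close>

text \<open>Off \<open>A\<close> the variable is replaced by an independent one with law \<open>\<gamma>\<close>; this turns the
  conditional statement into the ordinary continuity theorem and avoids dividing by the
  probability of \<open>A\<close>, which may vanish.\<close>

lemma conditional_levy_continuity:
  fixes M :: "nat \<Rightarrow> 'a measure" and W :: "nat \<Rightarrow> 'a \<Rightarrow> real"
  assumes M: "\<And>d. prob_space (M d)" and W: "\<And>d. W d \<in> borel_measurable (M d)"
    and A: "\<And>d. A d \<in> sets (M d)" and \<gamma>: "real_distribution \<gamma>" and b: "isCont (cdf \<gamma>) b"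
    and char_conv: "\<And>t. (\<lambda>d. (CLINT \<omega>|M d. indicator (A d) \<omega> * iexp (t * W d \<omega>))
      - measure (M d) (A d) * char \<gamma> t) \<longlonglongrightarrow> 0"
  shows "(\<lambda>d. measure (M d) {\<omega> \<in> A d. W d \<omega> \<le> b} - measure (M d) (A d) * cdf \<gamma> b) \<longlonglongrightarrow> 0"
proof -
  interpret \<gamma>: real_distribution \<gamma> by fact
  define V where "V d p = (if fst p \<in> A d then W d (fst p) else snd p)" for d and p :: "'a \<times> real"
  define \<nu> where "\<nu> d = distr (M d \<Otimes>\<^sub>M \<gamma>) borel (V d)" for d
  have V [measurable]: "V d \<in> borel_measurable (M d \<Otimes>\<^sub>M \<gamma>)" for d
    unfolding V_def using A[of d] W[of d] by measurable
  \<comment> \<open>Kept polymorphic in the value type: it is used for complex exponentials, giving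
    the characteristic function, and for a real indicator, giving the distribution function.\<close>
  have mix: "(\<integral>z. h z \<partial>\<nu> d) = (\<integral>\<omega>. indicator (A d) \<omega> *\<^sub>R h (W d \<omega>) \<partial>M d) + (1 - measure (M d) (A d)) *\<^sub>R
      (\<integral>z. h z \<partial>\<gamma>)"
    if h: "h \<in> borel_measurable borel" and hB: "\<And>z. norm (h z) \<le> 1"
    for d and h :: "real \<Rightarrow> 'b :: {banach, second_countable_topology}"
  proof -
    interpret Md: prob_space "M d" by fact
    interpret P: pair_prob_space "M d" \<gamma> ..
    have [measurable]: "A d \<in> sets (M d)" "W d \<in> borel_measurable (M d)" "h \<in> borel_measurable borel"
        using A W h by auto
    have int: "integrable (M d \<Otimes>\<^sub>M \<gamma>) (\<lambda>p. h (V d p))"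
      using hB by (intro P.integrable_const_bound[where B=1]) auto
    have i1: "integrable (M d) (\<lambda>\<omega>. indicator (A d) \<omega> *\<^sub>R h (W d \<omega>))"
      using hB by (intro Md.integrable_const_bound[where B=1]) (auto simp: indicator_def)
    have i2: "integrable (M d) (\<lambda>\<omega>. indicator (space (M d) - A d) \<omega> *\<^sub>R (\<integral>z. h z \<partial>\<gamma>))"
      by (intro Md.integrable_const_bound[where B="norm (\<integral>z. h z \<partial>\<gamma>)"]) (auto simp: indicator_def)
    have ic: "integrable (M d) (indicat_real (space (M d) - A d))"
      by (intro Md.integrable_const_bound[where B=1]) (auto simp: indicator_def)
    have "(\<integral>z. h z \<partial>\<nu> d) = (\<integral>p. h (V d p) \<partial>(M d \<Otimes>\<^sub>M \<gamma>))"
      unfolding \<nu>_def by (intro integral_distr) auto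
    also have "\<dots> = (\<integral>\<omega>. (\<integral>z. h (V d (\<omega>, z)) \<partial>\<gamma>) \<partial>M d)"
      using P.integral_fst'[OF int] by simp
    also have "\<dots> = (\<integral>\<omega>. indicator (A d) \<omega> *\<^sub>R h (W d \<omega>) + indicator (space (M d)
        - A d) \<omega> *\<^sub>R (\<integral>z. h z \<partial>\<gamma>) \<partial>M d)"
    proof (intro Bochner_Integration.integral_cong refl)
      fix \<omega> assume "\<omega> \<in> space (M d)"
      then show "(\<integral>z. h (V d (\<omega>, z)) \<partial>\<gamma>)
          = indicator (A d) \<omega> *\<^sub>R h (W d \<omega>) + indicator (space (M d) - A d) \<omega> *\<^sub>R (\<integral>z. h z \<partial>\<gamma>)"
        using \<gamma>.prob_space by (cases "\<omega> \<in> A d") (simp_all add: V_def)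
    qed
    also have "\<dots> = (\<integral>\<omega>. indicator (A d) \<omega> *\<^sub>R h (W d \<omega>) \<partial>M d) + measure (M d) (space (M d)
        - A d) *\<^sub>R (\<integral>z. h z \<partial>\<gamma>)"
      unfolding Bochner_Integration.integral_add[OF i1 i2] using ic by simp
    finally show ?thesis using Md.prob_compl[of "A d"] by simp
  qed
  have \<nu>: "real_distribution (\<nu> d)" for d
  proof -
    interpret Md: prob_space "M d" by fact
    interpret P: pair_prob_space "M d" \<gamma> ..
    show ?thesis unfolding \<nu>_def using P.prob_space_distr[OF V]
        by (simp add: real_distribution_def real_distribution_axioms_def)
  qed
  have "weak_conv_m \<nu> \<gamma>"
  proof (rule levy_continuity[OF \<nu> \<gamma>])
    fix t
    have "char (\<nu> d) t = ((CLINT \<omega>|M d. indicator (A d) \<omega> * iexp (t * W d \<omega>))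
        - measure (M d) (A d) * char \<gamma> t) + char \<gamma> t" for d
    proof -
      have "(CLINT \<omega>|M d. indicator (A d) \<omega> *\<^sub>R iexp (t * W d \<omega>))
          = (CLINT \<omega>|M d. indicator (A d) \<omega> * iexp (t * W d \<omega>))"
        by (intro Bochner_Integration.integral_cong) (auto simp: indicator_def)
      then show ?thesis
        unfolding char_def using mix[of "\<lambda>z. iexp (t * z)" d]
            by (simp add: scaleR_conv_of_real algebra_simps)
    qed
    then show "(\<lambda>d. char (\<nu> d) t) \<longlonglongrightarrow> char \<gamma> t"
      using tendsto_add[OF char_conv tendsto_const, of t "char \<gamma> t"] by simp
  qed
  then have "(\<lambda>d. cdf (\<nu> d) b) \<longlonglongrightarrow> cdf \<gamma> b"
    using b by (simp add: weak_conv_m_def weak_conv_def)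
  then have "(\<lambda>d. cdf (\<nu> d) b - cdf \<gamma> b) \<longlonglongrightarrow> 0" by (simp add: LIM_zero)
  also have "(\<lambda>d. cdf (\<nu> d) b - cdf \<gamma> b) = (\<lambda>d. measure (M d) {\<omega> \<in> A d. W d \<omega>
      \<le> b} - measure (M d) (A d) * cdf \<gamma> b)"
  proof (rule ext)
    fix d
    interpret \<nu>d: real_distribution "\<nu> d" by (rule \<nu>)
    have sub: "A d \<subseteq> space (M d)" using A sets.sets_into_space by blast
    have S: "{\<omega> \<in> A d. W d \<omega> \<le> b} \<in> sets (M d)"
    proof -
      have "A d \<inter> {\<omega> \<in> space (M d). W d \<omega> \<le> b} \<in> sets (M d)" using A W by measurable
      moreover have "A d \<inter> {\<omega> \<in> space (M d). W d \<omega> \<le> b} = {\<omega> \<in> A d. W d \<omega> \<le> b}" using sub by auto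
      ultimately show ?thesis by simp
    qed
    have "(\<integral>\<omega>. indicator (A d) \<omega> *\<^sub>R indicat_real {..b} (W d \<omega>) \<partial>M d) = (\<integral>\<omega>. indicator {\<omega> \<in> A d. W d \<omega>
        \<le> b} \<omega> \<partial>M d)"
      by (intro Bochner_Integration.integral_cong) (auto simp: indicator_def)
    also have "\<dots> = measure (M d) {\<omega> \<in> A d. W d \<omega> \<le> b}" using S sets.sets_into_space[OF S]
        by (simp add: Int_absorb2)
    finally have "(\<integral>z. indicat_real {..b} z \<partial>\<nu> d) = measure (M d) {\<omega> \<in> A d. W d \<omega>
        \<le> b} + (1 - measure (M d) (A d)) * (\<integral>z. indicat_real {..b} z \<partial>\<gamma>)"
      using mix[of "indicat_real {..b}" d] by simp
    then show "cdf (\<nu> d) b - cdf \<gamma> b = measure (M d) {\<omega> \<in> A d. W d \<omega>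
        \<le> b} - measure (M d) (A d) * cdf \<gamma> b"
      by (simp add: cdf_def algebra_simps)
  qed
  finally show ?thesis .
qed

text \<open>Half-open sides, so that one-dimensional masses are differences of distribution
  functions and the cells of a grid partition the space. For \<open>n = 0\<close> the event is the
  whole space.\<close>

definition box_event :: "'a measure \<Rightarrow> (nat \<Rightarrow> 'a \<Rightarrow> real) \<Rightarrow> nat \<Rightarrow> (nat \<Rightarrow> real) \<Rightarrow> (nat \<Rightarrow> real) \<Rightarrow> 'a set"
    where
  "box_event M W n a b = {\<omega> \<in> space M. \<forall>j<n. a j < W j \<omega> \<and> W j \<omega> \<le> b j}"

lemma box_event_measurable:
  assumes "\<And>j. W j \<in> borel_measurable M"
  shows "box_event M W n a b \<in> sets M"
  unfolding box_event_def using assms by measurable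

text \<open>\<open>char_conv\<close> says that coordinate \<open>i\<close> is asymptotically
  independent of the box event of the earlier coordinates and has law \<gamma>. By induction each
  coordinate contributes one factor through \<open>conditional_levy_continuity\<close>.\<close>

lemma box_probability_tendsto:
  fixes M :: "nat \<Rightarrow> 'a measure" and W :: "nat \<Rightarrow> nat \<Rightarrow> 'a \<Rightarrow> real"
  assumes M: "\<And>d. prob_space (M d)" and W: "\<And>d j. W d j \<in> borel_measurable (M d)"
    and \<gamma>: "real_distribution \<gamma>" and cont: "\<And>z. isCont (cdf \<gamma>) z"
    and char_conv: "\<And>i t. i < n \<Longrightarrow> (\<lambda>d. (CLINT \<omega>|M d. indicator (box_event (M d) (W d) i a b) \<omega> * iexp
        (t * W d i \<omega>))
      - measure (M d) (box_event (M d) (W d) i a b) * char \<gamma> t) \<longlonglongrightarrow> 0"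
    and ab: "\<And>j. a j \<le> b j"
  shows "(\<lambda>d. measure (M d) (box_event (M d) (W d) n a b)) \<longlonglongrightarrow> (\<Prod>j<n. cdf \<gamma> (b j) - cdf \<gamma> (a j))"
  using char_conv
proof (induction n)
  case 0
  show ?case using prob_space.prob_space[OF M] by (simp add: box_event_def)
next
  case (Suc i)
  let ?A = "\<lambda>d. box_event (M d) (W d) i a b"
  have A: "?A d \<in> sets (M d)" for d using W by (rule box_event_measurable)
  have IH: "(\<lambda>d. measure (M d) (?A d)) \<longlonglongrightarrow> (\<Prod>j<i. cdf \<gamma> (b j) - cdf \<gamma> (a j))"
    using Suc.prems by (intro Suc.IH) auto
  have lim: "(\<lambda>d. measure (M d) {\<omega> \<in> ?A d. W d i \<omega> \<le> z} - measure (M d) (?A d) * cdf \<gamma> z) \<longlonglongrightarrow> 0" for z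
    by (rule conditional_levy_continuity[OF M W A \<gamma> cont]) (use Suc.prems in auto)
  \<comment> \<open>The limiting products are subtracted and added back, so that both brackets tend
    to 0 by \<open>lim\<close>.\<close>
  have eq: "measure (M d) (box_event (M d) (W d) (Suc i) a b)
      = (measure (M d) {\<omega> \<in> ?A d. W d i \<omega> \<le> b i} - measure (M d) (?A d) * cdf \<gamma> (b i))
      - (measure (M d) {\<omega> \<in> ?A d. W d i \<omega> \<le> a i} - measure (M d) (?A d) * cdf \<gamma> (a i))
      + measure (M d) (?A d) * (cdf \<gamma> (b i) - cdf \<gamma> (a i))" for d
  proof -
    interpret Md: prob_space "M d" by fact
    have S: "{\<omega> \<in> ?A d. W d i \<omega> \<le> z} \<in> sets (M d)" for z
    proof -
      have "?A d \<inter> {\<omega> \<in> space (M d). W d i \<omega> \<le> z} \<in> sets (M d)" using A W by measurable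
      moreover have "?A d \<inter> {\<omega> \<in> space (M d). W d i \<omega> \<le> z} = {\<omega> \<in> ?A d. W d i \<omega> \<le> z}"
          by (auto simp: box_event_def)
      ultimately show ?thesis by simp
    qed
    have "box_event (M d) (W d) (Suc i) a b = {\<omega> \<in> ?A d. W d i \<omega> \<le> b i} - {\<omega> \<in> ?A d. W d i \<omega> \<le> a i}"
      by (auto simp: box_event_def less_Suc_eq)
    then have "measure (M d) (box_event (M d) (W d) (Suc i) a b)
        = measure (M d) {\<omega> \<in> ?A d. W d i \<omega> \<le> b i} - measure (M d) {\<omega> \<in> ?A d. W d i \<omega> \<le> a i}"
      using Md.finite_measure_Diff[OF S S, of "a i" "b i"] ab[of i] by (auto intro: order_trans)
    then show ?thesis by (simp add: algebra_simps)
  qed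
  have "(\<lambda>d. measure (M d) (box_event (M d) (W d) (Suc i) a b)) \<longlonglongrightarrow> 0 - 0 + (\<Prod>j<i. cdf \<gamma> (b j)
      - cdf \<gamma> (a j)) * (cdf \<gamma> (b i) - cdf \<gamma> (a i))"
    unfolding eq by (intro tendsto_intros lim IH)
  then show ?case by (simp add: mult.commute)
qed

text \<open>\<open>F\<close> is replaced by a step function on small cubes inside a large one. The
  mass outside the large cube is small for \<open>N\<close>, and hence for all large
  \<open>d\<close>, because the large cube is itself one of the boxes in the hypothesis.\<close>

lemma lipschitz_expectation_tendsto:
  fixes M :: "nat \<Rightarrow> 'a measure" and W :: "nat \<Rightarrow> nat \<Rightarrow> 'a \<Rightarrow> real" and N :: "'b measure"
      and V :: "nat \<Rightarrow> 'b \<Rightarrow> real"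
  assumes M: "\<And>d. prob_space (M d)" and W: "\<And>d j. W d j \<in> borel_measurable (M d)"
    and N: "prob_space N" and V: "\<And>j. V j \<in> borel_measurable N"
    and boxes: "\<And>a b. (\<And>j. a j \<le> b j) \<Longrightarrow>
      (\<lambda>d. measure (M d) (box_event (M d) (W d) n a b)) \<longlonglongrightarrow> measure N (box_event N V n a b)"
    and F: "\<And>x y. \<bar>F x - F y\<bar> \<le> L * (\<Sum>j<n. \<bar>x j - y j\<bar>)" and F_bound: "\<And>x. \<bar>F x\<bar> \<le> B"
    and F_meas: "\<And>d. (\<lambda>\<omega>. F (\<lambda>j. W d j \<omega>)) \<in> borel_measurable (M d)" "(\<lambda>\<omega>. F (\<lambda>j. V j \<omega>)) \<in>
        borel_measurable N"
  shows "(\<lambda>d. \<integral>\<omega>. F (\<lambda>j. W d j \<omega>) \<partial>M d) \<longlonglongrightarrow> (\<integral>\<omega>. F (\<lambda>j. V j \<omega>) \<partial>N)"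
proof (rule LIMSEQ_I)
  fix r :: real assume r: "0 < r"
  have B: "0 \<le> B" using F_bound[of undefined] by linarith
  \<comment> \<open>Inside a cell every coordinate moves by at most \<eta>, so \<open>F\<close>
    changes by at most \<open>\<bar>L\<bar> * (real n * \<eta>)\<close>.\<close>
  define \<eta> where "\<eta> = r / (8 * (\<bar>L\<bar> * real n + 1))"
  have \<eta>: "0 < \<eta>" "\<bar>L\<bar> * (real n * \<eta>) \<le> r / 8"
  proof -
    have "0 < \<bar>L\<bar> * real n + 1" by (simp add: add_nonneg_pos)
    then show "0 < \<eta>" "\<bar>L\<bar> * (real n * \<eta>) \<le> r / 8" using r by (auto simp: \<eta>_def field_simps)
  qed
  define C where "C K = ({..<n} \<rightarrow>\<^sub>E {- int K..<int K})" for K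
  define G where "G c = F (\<lambda>j. \<eta> * real_of_int (c j))" for c :: "nat \<Rightarrow> int"
  define lo hi where "lo c j = \<eta> * real_of_int (c j)" and "hi c j = \<eta> * (real_of_int (c j) + 1)"
      for c :: "nat \<Rightarrow> int" and j :: nat
  define q :: "nat \<Rightarrow> real" where "q K = \<eta> * real K" for K
  have finC: "finite (C K)" for K unfolding C_def by (intro finite_PiE) auto
  have pw: "\<bar>F (\<lambda>j. Z j \<omega>) - (\<Sum>c\<in>C K. G c * indicator (box_event S Z n (lo c) (hi c)) \<omega>)\<bar>
      \<le> r / 8 + B * (1 - indicator (box_event S Z n (\<lambda>_. - q K) (\<lambda>_. q K)) \<omega>)"
    if w: "\<omega> \<in> space S" for S :: "'c measure" and Z \<omega> K
  proof -
    \<comment> \<open>The index of the cell containing the point. Half-open intervals closed on the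
      right call for the ceiling minus 1; the restriction makes it comparable with the extensional
      elements of \<open>C K\<close>.\<close>
    define c0 where "c0 = (\<lambda>j\<in>{..<n}. \<lceil>Z j \<omega> / \<eta>\<rceil> - 1)"
    have cell: "lo c j < Z j \<omega> \<and> Z j \<omega> \<le> hi c j \<longleftrightarrow> c j = \<lceil>Z j \<omega> / \<eta>\<rceil> - 1" for c j
    proof -
      have "lo c j < Z j \<omega> \<and> Z j \<omega> \<le> hi c j \<longleftrightarrow> real_of_int (c j + 1) - 1 < Z j \<omega> / \<eta> \<and> Z j \<omega> / \<eta>
          \<le> real_of_int (c j + 1)"
        using \<eta>(1) by (simp add: lo_def hi_def pos_less_divide_eq pos_divide_le_eq mult.commute)
      also have "\<dots> \<longleftrightarrow> \<lceil>Z j \<omega> / \<eta>\<rceil> = c j + 1" by (simp only: ceiling_eq_iff)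
      finally show ?thesis by auto
    qed
    have mem: "\<omega> \<in> box_event S Z n (lo c) (hi c) \<longleftrightarrow> c = c0" if "c \<in> C K" for c
    proof -
      have "\<omega> \<in> box_event S Z n (lo c) (hi c) \<longleftrightarrow> (\<forall>j<n. c j = \<lceil>Z j \<omega> / \<eta>\<rceil> - 1)"
        using w cell by (simp add: box_event_def)
      also have "\<dots> \<longleftrightarrow> c = c0" using that
        by (auto simp: C_def c0_def PiE_def extensional_def fun_eq_iff)
      finally show ?thesis .
    qed
    \<comment> \<open>The cells with index in \<open>C K\<close> fill exactly the cube from
      \<open>- q K\<close> to \<open>q K\<close>.\<close>
    have inC: "c0 \<in> C K \<longleftrightarrow> \<omega> \<in> box_event S Z n (\<lambda>_. - q K) (\<lambda>_. q K)"
    proof -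
      have "- int K \<le> \<lceil>Z j \<omega> / \<eta>\<rceil> - 1 \<and> \<lceil>Z j \<omega> / \<eta>\<rceil> - 1 < int K \<longleftrightarrow> - q K < Z j \<omega> \<and> Z j \<omega> \<le> q K" for j
      proof -
        have "- int K \<le> \<lceil>Z j \<omega> / \<eta>\<rceil> - 1 \<longleftrightarrow> - real K < Z j \<omega> / \<eta>" by linarith
        moreover have "\<lceil>Z j \<omega> / \<eta>\<rceil> - 1 < int K \<longleftrightarrow> Z j \<omega> / \<eta> \<le> real K" by linarith
        ultimately show ?thesis
          using \<eta>(1) by (simp add: q_def pos_less_divide_eq pos_divide_le_eq mult.commute)
      qed
      then show ?thesis using w by (auto simp: C_def c0_def box_event_def PiE_iff)
    qed
    have "(\<Sum>c\<in>C K. G c * indicator (box_event S Z n (lo c) (hi c)) \<omega>) = (\<Sum>c\<in>C K. if c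
        = c0 then G c else 0)"
      by (intro sum.cong refl) (simp add: indicator_def mem)
    also have "\<dots> = (if c0 \<in> C K then G c0 else 0)" using finC by simp
    finally have sum: "(\<Sum>c\<in>C K. G c * indicator (box_event S Z n (lo c) (hi c)) \<omega>)
        = (if c0 \<in> C K then G c0 else 0)" .
    show ?thesis
    proof (cases "c0 \<in> C K")
      case True
      have "\<bar>Z j \<omega> - \<eta> * real_of_int (c0 j)\<bar> \<le> \<eta>" if "j < n" for j
        using cell[of c0 j] that by (simp add: c0_def lo_def hi_def algebra_simps abs_le_iff)
      then have "(\<Sum>j<n. \<bar>Z j \<omega> - \<eta> * real_of_int (c0 j)\<bar>) \<le> real n * \<eta>"
        using sum_mono[of "{..<n}" "\<lambda>j. \<bar>Z j \<omega> - \<eta> * real_of_int (c0 j)\<bar>" "\<lambda>_. \<eta>"] by simp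
      then have "\<bar>L\<bar> * (\<Sum>j<n. \<bar>Z j \<omega> - \<eta> * real_of_int (c0 j)\<bar>) \<le> \<bar>L\<bar> * (real n * \<eta>)"
          by (intro mult_left_mono) auto
      moreover have "L * (\<Sum>j<n. \<bar>Z j \<omega> - \<eta> * real_of_int (c0 j)\<bar>)
          \<le> \<bar>L\<bar> * (\<Sum>j<n. \<bar>Z j \<omega> - \<eta> * real_of_int (c0 j)\<bar>)"
        by (intro mult_right_mono sum_nonneg) auto
      ultimately have "\<bar>F (\<lambda>j. Z j \<omega>) - G c0\<bar> \<le> r / 8"
        using F[of "\<lambda>j. Z j \<omega>" "\<lambda>j. \<eta> * real_of_int (c0 j)"] \<eta>(2) unfolding G_def by linarith
      then show ?thesis using True inC by (simp add: sum)
    next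
      case False
      then show ?thesis using inC F_bound[of "\<lambda>j. Z j \<omega>"] r by (simp add: sum)
    qed
  qed
  have approx: "\<bar>(\<integral>\<omega>. F (\<lambda>j. Z j \<omega>) \<partial>S) - (\<Sum>c\<in>C K. G c * measure S (box_event S Z n (lo c) (hi c)))\<bar>
      \<le> r / 8 + B * (1 - measure S (box_event S Z n (\<lambda>_. - q K) (\<lambda>_. q K)))"
    if S: "prob_space S" and Z: "\<And>j. Z j \<in> borel_measurable S"
        and FZ: "(\<lambda>\<omega>. F (\<lambda>j. Z j \<omega>)) \<in> borel_measurable S"
    for S :: "'c measure" and Z K
  proof -
    interpret S: prob_space S by fact
    note [measurable] = box_event_measurable[OF Z]
    have iF: "integrable S (\<lambda>\<omega>. F (\<lambda>j. Z j \<omega>))"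
      using F_bound FZ by (intro S.integrable_const_bound[where B=B] AE_I2) auto
    have ib: "integrable S (indicat_real (box_event S Z n a b))" for a b
      by (intro S.integrable_const_bound[where B=1] AE_I2) (auto simp: indicator_def)
    have int_box: "(\<integral>\<omega>. indicator (box_event S Z n a b) \<omega> \<partial>S) = measure S (box_event S Z n a b)" for a b
      by (simp add: box_event_def Int_absorb2 Collect_mono_iff)
    have isum: "integrable S (\<lambda>\<omega>. \<Sum>c\<in>C K. G c * indicator (box_event S Z n (lo c) (hi c)) \<omega>)"
      using ib by (intro Bochner_Integration.integrable_sum) auto
    have "(\<integral>\<omega>. F (\<lambda>j. Z j \<omega>) \<partial>S) - (\<Sum>c\<in>C K. G c * measure S (box_event S Z n (lo c) (hi c)))
        = (\<integral>\<omega>. F (\<lambda>j. Z j \<omega>) - (\<Sum>c\<in>C K. G c * indicator (box_event S Z n (lo c) (hi c)) \<omega>) \<partial>S)"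
      using iF isum ib by (simp add: int_box)
    also have "\<bar>\<dots>\<bar> \<le> (\<integral>\<omega>. \<bar>F (\<lambda>j. Z j \<omega>) - (\<Sum>c\<in>C K. G c * indicator (box_event S Z n (lo c) (hi c)) \<omega>)\<bar>
        \<partial>S)"
      by (rule integral_abs_bound)
    also have "\<dots> \<le> (\<integral>\<omega>. r / 8 + B * (1 - indicator (box_event S Z n (\<lambda>_. - q K) (\<lambda>_. q K)) \<omega>) \<partial>S)"
      using iF isum ib by (intro integral_mono pw) auto
    also have "\<dots> = r / 8 + B * (1 - measure S (box_event S Z n (\<lambda>_. - q K) (\<lambda>_. q K)))"
      using ib by (simp add: int_box S.prob_space)
    finally show ?thesis .
  qed
  interpret N: prob_space N by fact
  \<comment> \<open>Continuity from below: the growing cubes exhaust the space, so some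
    \<open>K\<close> leaves little mass outside.\<close>
  have "(\<lambda>K. measure N (box_event N V n (\<lambda>_. - q K) (\<lambda>_. q K))) \<longlonglongrightarrow> measure N (\<Union>K. box_event N V n (\<lambda>_.
      - q K) (\<lambda>_. q K))"
  proof (rule N.finite_Lim_measure_incseq)
    show "range (\<lambda>K. box_event N V n (\<lambda>_. - q K) (\<lambda>_. q K)) \<subseteq> N.events"
      using box_event_measurable[OF V] by auto
    have "q K \<le> q K'" if "K \<le> K'" for K K' using \<eta>(1) that by (simp add: q_def)
    then show "incseq (\<lambda>K. box_event N V n (\<lambda>_. - q K) (\<lambda>_. q K))"
      by (force simp: incseq_def box_event_def)
  qed
  also have "(\<Union>K. box_event N V n (\<lambda>_. - q K) (\<lambda>_. q K)) = space N"
  proof -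
    have "\<exists>K. \<forall>j<n. - q K < V j \<omega> \<and> V j \<omega> \<le> q K" for \<omega>
    proof -
      obtain K where K: "(\<Sum>j<n. \<bar>V j \<omega>\<bar>) / \<eta> < real K" using reals_Archimedean2 by blast
      have "\<bar>V j \<omega>\<bar> < q K" if "j < n" for j
      proof -
        have "\<bar>V j \<omega>\<bar> \<le> (\<Sum>j<n. \<bar>V j \<omega>\<bar>)" using that by (intro member_le_sum) auto
        also have "\<dots> < q K" using K \<eta>(1) by (simp add: q_def field_simps)
        finally show ?thesis .
      qed
      then have "- q K < V j \<omega> \<and> V j \<omega> \<le> q K" if "j < n" for j
        using that by (fastforce simp: abs_less_iff)
      then show ?thesis by blast
    qed
    then show ?thesis by (auto simp: box_event_def)
  qed
  finally have "(\<lambda>K. B * (1 - measure N (box_event N V n (\<lambda>_. - q K) (\<lambda>_. q K)))) \<longlonglongrightarrow> B * (1 - 1)"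
    by (intro tendsto_intros) (simp add: N.prob_space)
  then have "\<forall>\<^sub>F K in sequentially. B * (1 - measure N (box_event N V n (\<lambda>_. - q K) (\<lambda>_. q K))) < r / 8"
    using r by (intro order_tendstoD(2)[where y=0]) auto
  then obtain K where K: "B * (1 - measure N (box_event N V n (\<lambda>_. - q K) (\<lambda>_. q K))) < r / 8"
    using eventually_happens'[OF sequentially_bot] by blast
  have qK: "0 \<le> q K" using \<eta>(1) by (simp add: q_def)
  have "(\<lambda>d. B * (1 - measure (M d) (box_event (M d) (W d) n (\<lambda>_. - q K) (\<lambda>_. q K))))
      \<longlonglongrightarrow> B * (1 - measure N (box_event N V n (\<lambda>_. - q K) (\<lambda>_. q K)))"
    by (intro tendsto_intros boxes) (use qK in auto)
  then have ev1: "\<forall>\<^sub>F d in sequentially. B * (1 - measure (M d) (box_event (M d) (W d) n (\<lambda>_.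
      - q K) (\<lambda>_. q K))) < r / 8"
    using K by (rule order_tendstoD(2))
  have "(\<lambda>d. \<Sum>c\<in>C K. G c * measure (M d) (box_event (M d) (W d) n (lo c) (hi c)))
      \<longlonglongrightarrow> (\<Sum>c\<in>C K. G c * measure N (box_event N V n (lo c) (hi c)))"
    by (intro tendsto_intros boxes) (use \<eta>(1) in \<open>auto simp: lo_def hi_def\<close>)
  then have ev2: "\<forall>\<^sub>F d in sequentially. \<bar>(\<Sum>c\<in>C K. G c * measure (M d) (box_event (M d) (W d) n (lo c)
      (hi c)))
      - (\<Sum>c\<in>C K. G c * measure N (box_event N V n (lo c) (hi c)))\<bar> < r / 8"
    unfolding dist_real_def[symmetric] by (rule tendstoD) (use r in simp)
  have "\<forall>\<^sub>F d in sequentially. norm ((\<integral>\<omega>. F (\<lambda>j. W d j \<omega>) \<partial>M d) - (\<integral>\<omega>. F (\<lambda>j. V j \<omega>) \<partial>N)) < r"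
    using ev1 ev2
  proof eventually_elim
    \<comment> \<open>Five errors of size \<open>r / 8\<close>: cell size and outside mass for
      \<open>M d\<close> and for \<open>N\<close>, and the difference of the two finite
      sums.\<close>
    case (elim d)
    show ?case
      using approx[OF M[of d] W[of d] F_meas(1)[of d], of K] approx[OF N V F_meas(2), of K] elim K r
          unfolding real_norm_def by linarith
  qed
  then show "\<exists>no. \<forall>d\<ge>no. norm ((\<integral>\<omega>. F (\<lambda>j. W d j \<omega>) \<partial>M d) - (\<integral>\<omega>. F (\<lambda>j. V j \<omega>) \<partial>N)) < r"
    by (simp add: eventually_sequentially)
qed

section \<open>The lazy walk\<close>

lemma finite_hypercube: "finite (hypercube d)"
  unfolding hypercube_def by (intro finite_PiE) auto

text \<open>A single walk in a fixed dimension, so that all estimates are explicit in \<delta>,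
  \<kappa> and the start. In the end \<kappa> is the maximum norm of \<theta>.\<close>

locale lazy_walk = prob_space M for M :: "'a measure" +
  fixes d :: nat and p :: real and x :: "nat \<Rightarrow> real" and X :: "nat \<Rightarrow> 'a \<Rightarrow> nat \<Rightarrow> real"
    and \<theta> :: "nat \<Rightarrow> real" and \<kappa> :: real
  assumes d_pos: "1 \<le> d" and p: "0 < p" "p \<le> 1"
    and walk: "lnnrw d p x M X"
    and theta_norm: "(\<Sum>i<d. (\<theta> i)\<^sup>2) = 1" and theta_bound: "\<And>i. i < d \<Longrightarrow> \<bar>\<theta> i\<bar> \<le> \<kappa>"
begin

definition \<delta> :: real where "\<delta> = 2 * p / real d"

text \<open>The index \<open>d\<close> stands for staying put, so that a transition is a single sum over \<open>i \<le> d\<close>.\<close>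

definition move :: "nat \<Rightarrow> (nat \<Rightarrow> real) \<Rightarrow> nat \<Rightarrow> real" where
  "move i v = (if i < d then v(i := - v i) else v)"

definition move_prob :: "nat \<Rightarrow> real" where
  "move_prob i = (if i < d then p / real d else 1 - p)"

definition proj :: "(nat \<Rightarrow> real) \<Rightarrow> real" where
  "proj v = (\<Sum>i<d. \<theta> i * v i)"

definition incr :: "nat \<Rightarrow> (nat \<Rightarrow> real) \<Rightarrow> real" where
  "incr i v = proj (move i v) - (1 - \<delta>) * proj v"

definition Y :: "nat \<Rightarrow> 'a \<Rightarrow> real" where
  "Y n \<omega> = proj (X n \<omega>)"

definition \<xi> :: "nat \<Rightarrow> 'a \<Rightarrow> real" where
  "\<xi> n \<omega> = Y (Suc n) \<omega> - (1 - \<delta>) * Y n \<omega>"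

text \<open>Adaptedness as pointwise dependence on the history. Histories take finitely many values,
  so this yields measurability and integrability; the free result type admits predicates, pairs and
  complex values alike.\<close>

definition adapted :: "nat \<Rightarrow> ('a \<Rightarrow> 'c) \<Rightarrow> bool" where
  "adapted n G \<longleftrightarrow> (\<forall>\<omega>\<in>space M. \<forall>\<omega>'\<in>space M. (\<forall>k\<le>n. X k \<omega> = X k \<omega>') \<longrightarrow> G \<omega> = G \<omega>')"

lemma X_measurable [measurable]: "X n \<in> M \<rightarrow>\<^sub>M count_space (hypercube d)"
  using walk by (simp add: lnnrw_def)

lemma X_hypercube: "\<omega> \<in> space M \<Longrightarrow> X n \<omega> \<in> hypercube d"
  using measurable_space[OF X_measurable] by simp

lemma hypercube_values: "v \<in> hypercube d \<Longrightarrow> i < d \<Longrightarrow> v i = 1 \<or> v i = - 1"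
  by (auto simp: hypercube_def)

text \<open>With values in {-1, 1}, changing a coordinate means negating it.\<close>

lemma neighbours_eq:
  assumes v: "v \<in> hypercube d"
  shows "{w \<in> hypercube d. nearest_neighbours d v w} = (\<lambda>i. v(i := - v i)) ` {..<d}"
proof (intro equalityI subsetI)
  fix w assume "w \<in> {w \<in> hypercube d. nearest_neighbours d v w}"
  then have w: "w \<in> hypercube d" "card {i \<in> {..<d}. v i \<noteq> w i} = 1"
    by (auto simp: nearest_neighbours_def)
  then obtain i where i: "{i \<in> {..<d}. v i \<noteq> w i} = {i}" by (auto simp: card_1_singleton_iff)
  then have id: "i < d" "v i \<noteq> w i" by auto
  have "w j = (v(i := - v i)) j" for j
  proof (cases "j < d")
    case True
    show ?thesis
    proof (cases "j = i")
      case True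
      then show ?thesis using id hypercube_values[OF v id(1)] hypercube_values[OF w(1) id(1)] by auto
    next
      case False
      then have "j \<notin> {i \<in> {..<d}. v i \<noteq> w i}" using i by auto
      then show ?thesis using True False by auto
    qed
  next
    case False
    then show ?thesis using v w(1) id(1) by (auto simp: hypercube_def PiE_def extensional_def)
  qed
  then have "w = v(i := - v i)" by (rule ext)
  then show "w \<in> (\<lambda>i. v(i := - v i)) ` {..<d}" using id(1) by (intro image_eqI[of _ _ i]) auto
next
  fix w assume "w \<in> (\<lambda>i. v(i := - v i)) ` {..<d}"
  then obtain i where i: "i < d" "w = v(i := - v i)" by auto
  have "v i \<noteq> 0" using hypercube_values[OF v i(1)] by auto
  then have "{j \<in> {..<d}. v j \<noteq> w j} = {i}" using i by auto
  moreover have "w \<in> hypercube d"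
    using v i hypercube_values[OF v i(1)] by (auto simp: hypercube_def PiE_def extensional_def Pi_def)
  ultimately show "w \<in> {w \<in> hypercube d. nearest_neighbours d v w}"
    by (simp add: nearest_neighbours_def)
qed

text \<open>Turns the transition matrix into an average over flips. Distinct flips lead to distinct
  vertices because no coordinate of \<open>v\<close> equals its negative.\<close>

lemma transition_sum:
  fixes \<psi> :: "(nat \<Rightarrow> real) \<Rightarrow> 'c::real_vector"
  assumes v: "v \<in> hypercube d"
  shows "(\<Sum>w\<in>hypercube d. lnnrw_transition d p v w *\<^sub>R \<psi> w) = (\<Sum>i\<le>d. move_prob i *\<^sub>R \<psi> (move i v))"
proof -
  let ?N = "{w \<in> hypercube d. nearest_neighbours d v w}"
  have vN: "v \<notin> ?N" by (simp add: nearest_neighbours_def)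
  have fN: "finite ?N" using finite_hypercube by simp
  have inj: "inj_on (\<lambda>i. v(i := - v i)) {..<d}"
  proof (rule inj_onI)
    fix i j assume ij: "i \<in> {..<d}" "j \<in> {..<d}" "v(i := - v i) = v(j := - v j)"
    show "i = j"
    proof (rule ccontr)
      assume "i \<noteq> j"
      then have "- v i = v i" using fun_cong[OF ij(3), of i] by simp
      then show False using hypercube_values[OF v, of i] ij by auto
    qed
  qed
  have "(\<Sum>w\<in>hypercube d. lnnrw_transition d p v w *\<^sub>R \<psi> w)
      = (\<Sum>w\<in>insert v ?N. lnnrw_transition d p v w *\<^sub>R \<psi> w)"
    using v by (intro sum.mono_neutral_right finite_hypercube) (auto simp: lnnrw_transition_def)
  also have "\<dots> = (1 - p) *\<^sub>R \<psi> v + (\<Sum>w\<in>?N. lnnrw_transition d p v w *\<^sub>R \<psi> w)"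
    using vN fN by (simp add: lnnrw_transition_def)
  also have "(\<Sum>w\<in>?N. lnnrw_transition d p v w *\<^sub>R \<psi> w) = (\<Sum>w\<in>?N. (p / real d) *\<^sub>R \<psi> w)"
    using vN by (intro sum.cong) (auto simp: lnnrw_transition_def)
  also have "\<dots> = (\<Sum>i<d. (p / real d) *\<^sub>R \<psi> (v(i := - v i)))"
    unfolding neighbours_eq[OF v] by (simp add: sum.reindex[OF inj])
  also have "(1 - p) *\<^sub>R \<psi> v + \<dots> = (\<Sum>i\<le>d. move_prob i *\<^sub>R \<psi> (move i v))"
    by (simp add: lessThan_Suc_atMost[symmetric] move_prob_def move_def)
  finally show ?thesis .
qed

lemma finite_valued_integral:
  fixes f :: "'s \<Rightarrow> 'c :: {banach, second_countable_topology}"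
  assumes Z: "Z \<in> M \<rightarrow>\<^sub>M count_space T" and T: "finite T"
  shows "integrable M (\<lambda>\<omega>. f (Z \<omega>))"
    and "(\<integral>\<omega>. f (Z \<omega>) \<partial>M) = (\<Sum>z\<in>T. prob {\<omega> \<in> space M. Z \<omega> = z} *\<^sub>R f z)"
proof -
  have S [measurable]: "{\<omega> \<in> space M. Z \<omega> = z} \<in> events" if "z \<in> T" for z
  proof -
    have "Z -` {z} \<inter> space M \<in> events" using Z that by (intro measurable_sets) auto
    moreover have "Z -` {z} \<inter> space M = {\<omega> \<in> space M. Z \<omega> = z}" by auto
    ultimately show ?thesis by simp
  qed
  have eq: "f (Z \<omega>) = (\<Sum>z\<in>T. indicat_real {\<omega> \<in> space M. Z \<omega> = z} \<omega> *\<^sub>R f z)" if "\<omega> \<in> space M" for \<omega>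
  proof -
    have "Z \<omega> \<in> T" using measurable_space[OF Z that] by simp
    then have "(\<Sum>z\<in>T. if Z \<omega> = z then f z else 0) = f (Z \<omega>)" using T by simp
    moreover have "indicat_real {\<omega> \<in> space M. Z \<omega> = z} \<omega> *\<^sub>R f z = (if Z \<omega> = z then f z else 0)" for z
      using that by (simp add: indicator_def)
    ultimately show ?thesis by simp
  qed
  have ind: "integrable M (indicat_real {\<omega> \<in> space M. Z \<omega> = z})" if "z \<in> T" for z
    using S[OF that] by (intro integrable_const_bound[where B=1]) (auto simp: indicator_def)
  have "integrable M (\<lambda>\<omega>. \<Sum>z\<in>T. indicat_real {\<omega> \<in> space M. Z \<omega> = z} \<omega> *\<^sub>R f z)"
    using ind by (intro Bochner_Integration.integrable_sum) auto
  then show "integrable M (\<lambda>\<omega>. f (Z \<omega>))"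
    by (subst Bochner_Integration.integrable_cong[OF refl eq]) auto
  have "(\<integral>\<omega>. f (Z \<omega>) \<partial>M) = (\<integral>\<omega>. (\<Sum>z\<in>T. indicat_real {\<omega> \<in> space M. Z \<omega> = z} \<omega> *\<^sub>R f z) \<partial>M)"
    by (rule Bochner_Integration.integral_cong[OF refl eq])
  also have "\<dots> = (\<Sum>z\<in>T. \<integral>\<omega>. indicat_real {\<omega> \<in> space M. Z \<omega> = z} \<omega> *\<^sub>R f z \<partial>M)"
    using ind by (intro Bochner_Integration.integral_sum) auto
  also have "\<dots> = (\<Sum>z\<in>T. prob {\<omega> \<in> space M. Z \<omega> = z} *\<^sub>R f z)"
  proof (intro sum.cong refl)
    fix z assume "z \<in> T"
    have "{\<omega> \<in> space M. Z \<omega> = z} \<inter> space M = {\<omega> \<in> space M. Z \<omega> = z}" by auto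
    then show "(\<integral>\<omega>. indicat_real {\<omega> \<in> space M. Z \<omega> = z} \<omega> *\<^sub>R f z \<partial>M) = prob {\<omega> \<in> space M. Z \<omega>
        = z} *\<^sub>R f z"
      using ind[OF \<open>z \<in> T\<close>] by simp
  qed
  finally show "(\<integral>\<omega>. f (Z \<omega>) \<partial>M) = (\<Sum>z\<in>T. prob {\<omega> \<in> space M. Z \<omega> = z} *\<^sub>R f z)" .
qed

definition hist :: "nat \<Rightarrow> 'a \<Rightarrow> nat \<Rightarrow> nat \<Rightarrow> real" where
  "hist n \<omega> = (\<lambda>k\<in>{..n}. X k \<omega>)"

definition hists :: "nat \<Rightarrow> (nat \<Rightarrow> nat \<Rightarrow> real) set" where
  "hists n = {..n} \<rightarrow>\<^sub>E hypercube d"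

lemma finite_hists: "finite (hists n)"
  unfolding hists_def by (intro finite_PiE finite_hypercube) auto

lemma hist_eq_iff: "h \<in> hists n \<Longrightarrow> hist n \<omega> = h \<longleftrightarrow> (\<forall>k\<le>n. X k \<omega> = h k)"
  by (auto simp: hist_def hists_def PiE_def extensional_def fun_eq_iff)

lemma X_event: "w \<in> hypercube d \<Longrightarrow> {\<omega> \<in> space M. X n \<omega> = w} \<in> events"
proof -
  assume "w \<in> hypercube d"
  then have "X n -` {w} \<inter> space M \<in> events" by (intro measurable_sets[OF X_measurable]) auto
  moreover have "X n -` {w} \<inter> space M = {\<omega> \<in> space M. X n \<omega> = w}" by auto
  ultimately show ?thesis by simp
qed

lemma hist_event:
  assumes h: "h \<in> hists n"
  shows "{\<omega> \<in> space M. hist n \<omega> = h} \<in> events"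
proof -
  have "(\<Inter>k\<in>{..n}. {\<omega> \<in> space M. X k \<omega> = h k}) \<in> events"
    using h by (intro sets.finite_INT X_event) (auto simp: hists_def)
  moreover have "(\<Inter>k\<in>{..n}. {\<omega> \<in> space M. X k \<omega> = h k}) = {\<omega> \<in> space M. hist n \<omega> = h}"
    using hist_eq_iff[OF h] by auto
  ultimately show ?thesis by simp
qed

lemma hist_measurable: "hist n \<in> M \<rightarrow>\<^sub>M count_space (hists n)"
proof (rule measurable_count_space_eq2[OF finite_hists, THEN iffD2], intro conjI ballI)
  show "hist n \<in> space M \<rightarrow> hists n"
    using X_hypercube by (auto simp: hist_def hists_def)
  fix h assume "h \<in> hists n"
  moreover have "hist n -` {h} \<inter> space M = {\<omega> \<in> space M. hist n \<omega> = h}" by auto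
  ultimately show "hist n -` {h} \<inter> space M \<in> events" using hist_event by simp
qed

text \<open>The factor is obtained by choosing one representative \<omega>' for every
  history.\<close>

lemma adapted_factor:
  assumes "adapted n G"
  shows "\<exists>\<Phi>. \<forall>\<omega>\<in>space M. G \<omega> = \<Phi> (hist n \<omega>)"
proof (intro exI ballI)
  fix \<omega> assume w: "\<omega> \<in> space M"
  define \<omega>' where "\<omega>' = (SOME \<omega>'. \<omega>' \<in> space M \<and> hist n \<omega>' = hist n \<omega>)"
  have \<omega>': "\<omega>' \<in> space M \<and> hist n \<omega>' = hist n \<omega>"
    unfolding \<omega>'_def by (rule someI[of _ \<omega>]) (use w in simp)
  have "X k \<omega> = X k \<omega>'" if "k \<le> n" for k
    using fun_cong[OF conjunct2[OF \<omega>'], of k] that by (simp add: hist_def)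
  then have "G \<omega> = G \<omega>'" using assms w \<omega>' unfolding adapted_def by blast
  then show "G \<omega> = (\<lambda>h. G (SOME \<omega>'. \<omega>' \<in> space M \<and> hist n \<omega>' = h)) (hist n \<omega>)"
    by (simp only: \<omega>'_def)
qed

text \<open>An adapted function factors through the finite-valued \<open>hist n\<close> and is
  therefore simple.\<close>

lemma adapted_integrable:
  fixes G :: "'a \<Rightarrow> 'c :: {banach, second_countable_topology}"
  assumes "adapted n G"
  shows "integrable M G"
proof -
  obtain \<Phi> where \<Phi>: "\<And>\<omega>. \<omega> \<in> space M \<Longrightarrow> G \<omega> = \<Phi> (hist n \<omega>)"
    using adapted_factor[OF assms] by blast
  have "integrable M (\<lambda>\<omega>. \<Phi> (hist n \<omega>))"
    by (rule finite_valued_integral(1)[OF hist_measurable finite_hists])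
  moreover have "integrable M G \<longleftrightarrow> integrable M (\<lambda>\<omega>. \<Phi> (hist n \<omega>))"
    by (intro Bochner_Integration.integrable_cong refl \<Phi>)
  ultimately show ?thesis by simp
qed

lemma adapted_measurable:
  fixes G :: "'a \<Rightarrow> real"
  assumes "adapted n G"
  shows "G \<in> borel_measurable M"
  using adapted_integrable[OF assms] by auto

lemma adapted_comp: "adapted n G \<Longrightarrow> adapted n (\<lambda>\<omega>. f (G \<omega>))"
  unfolding adapted_def by (intro ballI impI arg_cong[where f=f]) blast

lemma adapted_event:
  assumes "adapted n P"
  shows "{\<omega> \<in> space M. P \<omega>} \<in> events"
proof -
  have "adapted n (\<lambda>\<omega>. of_bool (P \<omega>) :: real)" using assms by (rule adapted_comp)
  then have [measurable]: "(\<lambda>\<omega>. of_bool (P \<omega>) :: real) \<in> borel_measurable M"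
      by (rule adapted_measurable)
  have "{\<omega> \<in> space M. of_bool (P \<omega>) = (1::real)} \<in> events" by measurable
  then show ?thesis by simp
qed

text \<open>In product form the side condition on the conditional probability disappears: for a
  history of probability 0 both sides vanish.\<close>

lemma transition_prob:
  assumes h: "h \<in> hists n" and w: "w \<in> hypercube d"
  shows "prob {\<omega> \<in> space M. hist n \<omega> = h \<and> X (Suc n) \<omega> = w}
    = prob {\<omega> \<in> space M. hist n \<omega> = h} * lnnrw_transition d p (h n) w"
proof (cases "prob {\<omega> \<in> space M. hist n \<omega> = h} = 0")
  case True
  have "prob {\<omega> \<in> space M. hist n \<omega> = h \<and> X (Suc n) \<omega> = w} \<le> prob {\<omega> \<in> space M. hist n \<omega> = h}"
    by (intro finite_measure_mono hist_event h) auto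
  then show ?thesis using True by (simp add: measure_le_0_iff)
next
  case False
  then have "\<P>(\<omega> in M. X (Suc n) \<omega> = w \<bar> \<forall>k\<le>n. X k \<omega> = h k) = lnnrw_transition d p (h n) w"
    using walk w by (simp add: lnnrw_def hist_eq_iff[OF h])
  then have "prob {\<omega> \<in> space M. X (Suc n) \<omega> = w \<and> hist n \<omega> = h} / prob {\<omega> \<in> space M. hist n \<omega> = h}
      = lnnrw_transition d p (h n) w"
    by (simp add: cond_prob_def hist_eq_iff[OF h])
  then show ?thesis using False by (simp add: field_simps conj_commute)
qed

text \<open>The Markov property integrated against a function of the past, proved by summing over
  all pairs of a history and a next position.\<close>

lemma one_step:
  fixes \<psi> :: "'s \<Rightarrow> (nat \<Rightarrow> real) \<Rightarrow> 'c :: {banach, second_countable_topology}"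
  assumes G: "adapted n G"
  shows "(\<integral>\<omega>. \<psi> (G \<omega>) (X (Suc n) \<omega>) \<partial>M) = (\<integral>\<omega>. (\<Sum>i\<le>d. move_prob i *\<^sub>R \<psi> (G \<omega>) (move i (X n \<omega>))) \<partial>M)"
proof -
  obtain \<Phi> where \<Phi>: "\<And>\<omega>. \<omega> \<in> space M \<Longrightarrow> G \<omega> = \<Phi> (hist n \<omega>)"
    using adapted_factor[OF G] by blast
  let ?T = "hists n \<times> hypercube d"
  have finT: "finite ?T" using finite_hists finite_hypercube by auto
  have Z: "(\<lambda>\<omega>. (hist n \<omega>, X (Suc n) \<omega>)) \<in> M \<rightarrow>\<^sub>M count_space ?T"
  proof (rule measurable_count_space_eq2[OF finT, THEN iffD2], intro conjI ballI)
    show "(\<lambda>\<omega>. (hist n \<omega>, X (Suc n) \<omega>)) \<in> space M \<rightarrow> ?T"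
      using measurable_space[OF hist_measurable] X_hypercube by auto
    fix z assume "z \<in> ?T"
    then have "{\<omega> \<in> space M. hist n \<omega> = fst z} \<inter> {\<omega> \<in> space M. X (Suc n) \<omega> = snd z} \<in> events"
      by (intro sets.Int hist_event X_event) auto
    moreover have "{\<omega> \<in> space M. hist n \<omega> = fst z} \<inter> {\<omega> \<in> space M. X (Suc n) \<omega> = snd z}
        = (\<lambda>\<omega>. (hist n \<omega>, X (Suc n) \<omega>)) -` {z} \<inter> space M" by auto
    ultimately show "(\<lambda>\<omega>. (hist n \<omega>, X (Suc n) \<omega>)) -` {z} \<inter> space M \<in> events" by simp
  qed
  have "(\<integral>\<omega>. \<psi> (G \<omega>) (X (Suc n) \<omega>) \<partial>M) = (\<integral>\<omega>. (\<lambda>z. \<psi> (\<Phi> (fst z)) (snd z)) (hist n \<omega>, X (Suc n) \<omega>) \<partial>M)"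
    using \<Phi> by (intro Bochner_Integration.integral_cong) auto
  also have "\<dots> = (\<Sum>z\<in>?T. prob {\<omega> \<in> space M. (hist n \<omega>, X (Suc n) \<omega>) = z} *\<^sub>R \<psi> (\<Phi> (fst z)) (snd z))"
    by (rule finite_valued_integral(2)[OF Z]) (use finite_hists finite_hypercube in auto)
  also have "\<dots> = (\<Sum>h\<in>hists n. \<Sum>w\<in>hypercube d. prob {\<omega> \<in> space M. hist n \<omega> = h \<and> X (Suc n) \<omega>
      = w} *\<^sub>R \<psi> (\<Phi> h) w)"
    by (simp add: sum.cartesian_product case_prod_beta prod_eq_iff)
  also have "\<dots> = (\<Sum>h\<in>hists n. prob {\<omega> \<in> space M. hist n \<omega>
      = h} *\<^sub>R (\<Sum>w\<in>hypercube d. lnnrw_transition d p (h n) w *\<^sub>R \<psi> (\<Phi> h) w))"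
    by (intro sum.cong refl) (simp add: transition_prob scaleR_sum_right)
  also have "\<dots> = (\<Sum>h\<in>hists n. prob {\<omega> \<in> space M. hist n \<omega>
      = h} *\<^sub>R (\<Sum>i\<le>d. move_prob i *\<^sub>R \<psi> (\<Phi> h) (move i (h n))))"
    by (intro sum.cong refl arg_cong2[where f=scaleR] transition_sum) (auto simp: hists_def)
  also have "\<dots> = (\<integral>\<omega>. (\<Sum>i\<le>d. move_prob i *\<^sub>R \<psi> (\<Phi> (hist n \<omega>)) (move i (hist n \<omega> n))) \<partial>M)"
    by (rule finite_valued_integral(2)[OF hist_measurable finite_hists, symmetric])
  also have "\<dots> = (\<integral>\<omega>. (\<Sum>i\<le>d. move_prob i *\<^sub>R \<psi> (G \<omega>) (move i (X n \<omega>))) \<partial>M)"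
    using \<Phi> by (intro Bochner_Integration.integral_cong) (auto simp: hist_def)
  finally show ?thesis .
qed

lemma move_prob_nonneg: "0 \<le> move_prob i"
  using p by (simp add: move_prob_def)

lemma sum_move: "(\<Sum>i\<le>d. f i) = (\<Sum>i<d. f i) + f d"
  by (simp add: lessThan_Suc_atMost[symmetric])

lemma sum_move_prob: "(\<Sum>i\<le>d. move_prob i) = 1"
  using d_pos by (simp add: sum_move move_prob_def)

lemma \<delta>_pos: "0 < \<delta>"
  using p d_pos by (simp add: \<delta>_def)

lemma proj_move: "i < d \<Longrightarrow> proj (move i v) = proj v - 2 * (\<theta> i * v i)"
proof -
  assume i: "i < d"
  have "proj (move i v) - proj v = (\<Sum>j<d. \<theta> j * (move i v j - v j))"
    by (simp add: proj_def sum_subtractf right_diff_distrib)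
  also have "\<dots> = (\<Sum>j<d. if j = i then - 2 * (\<theta> i * v i) else 0)"
    using i by (intro sum.cong) (auto simp: move_def)
  also have "\<dots> = - 2 * (\<theta> i * v i)" using i by simp
  finally show ?thesis by simp
qed

lemma incr_eq: "incr i v = (if i < d then \<delta> * proj v - 2 * (\<theta> i * v i) else \<delta> * proj v)"
  by (auto simp: incr_def proj_move algebra_simps) (simp add: move_def)

text \<open>Flipping coordinate \<open>i\<close> changes the projection by
  \<open>- 2 * (\<theta> i * v i)\<close>, and the average of these changes is -\<delta> times the
  projection: linear functions are eigenfunctions with eigenvalue 1 - \<delta>.\<close>

lemma incr_mean: "(\<Sum>i\<le>d. move_prob i * incr i v) = 0"
proof -
  have "(\<Sum>i<d. p / real d * (\<delta> * proj v - 2 * (\<theta> i * v i))) = p * \<delta> * proj v - \<delta> * proj v"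
  proof -
    have "(\<Sum>i<d. p / real d * (\<delta> * proj v - 2 * (\<theta> i * v i))) = p / real d * (real d * (\<delta> * proj v)
        - 2 * proj v)"
      by (simp only: sum_distrib_left[symmetric] sum_subtractf) (simp add: proj_def)
    also have "\<dots> = p * \<delta> * proj v - \<delta> * proj v" using d_pos by (simp add: \<delta>_def field_simps)
    finally show ?thesis .
  qed
  then show ?thesis by (simp add: sum_move incr_eq move_prob_def algebra_simps)
qed

text \<open>As \<open>v i\<close> is 1 or -1 and \<theta> has norm 1, the mean squared jump is 4 p /
  d = 2 \<delta> at every vertex; the subtracted term is the square of the mean jump.\<close>

lemma incr_square:
  assumes v: "v \<in> hypercube d"
  shows "(\<Sum>i\<le>d. move_prob i * (incr i v)\<^sup>2) = 2 * \<delta> - \<delta>\<^sup>2 * (proj v)\<^sup>2"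
proof -
  have sq: "(\<Sum>i<d. (\<theta> i * v i)\<^sup>2) = 1"
  proof -
    have "(\<theta> i * v i)\<^sup>2 = (\<theta> i)\<^sup>2" if "i < d" for i
      using hypercube_values[OF v that] by (auto simp: power_mult_distrib)
    then show ?thesis using theta_norm by simp
  qed
  have "(\<Sum>i<d. (\<delta> * proj v - 2 * (\<theta> i * v i))\<^sup>2)
      = (\<Sum>i<d. (\<delta> * proj v)\<^sup>2 - 4 * \<delta> * proj v * (\<theta> i * v i) + 4 * (\<theta> i * v i)\<^sup>2)"
    by (intro sum.cong refl) (simp add: power2_diff power_mult_distrib)
  also have "\<dots> = real d * (\<delta> * proj v)\<^sup>2 - 4 * \<delta> * proj v * proj v + 4"
    by (simp only: sum.distrib sum_subtractf sum_distrib_left[symmetric] sq proj_def[symmetric]) simp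
  finally have "(\<Sum>i<d. p / real d * (\<delta> * proj v - 2 * (\<theta> i * v i))\<^sup>2)
      = p / real d * (real d * (\<delta> * proj v)\<^sup>2 - 4 * \<delta> * proj v * proj v + 4)"
    by (simp only: sum_distrib_left[symmetric])
  also have "\<dots> = p * (\<delta> * proj v)\<^sup>2 - 2 * \<delta>\<^sup>2 * (proj v)\<^sup>2 + 2 * \<delta>"
    using d_pos by (simp add: \<delta>_def field_simps power2_eq_square)
  finally show ?thesis by (simp add: sum_move incr_eq move_prob_def algebra_simps power_mult_distrib)
qed

lemma kappa_nonneg: "0 \<le> \<kappa>"
  using theta_bound[of 0] d_pos by (simp add: order_trans[OF abs_ge_zero])

text \<open>A flip contributes at most 2 \<kappa>, and the compensator at most \<delta> d \<kappa> =
  2 p \<kappa>, hence also at most 2 \<kappa>.\<close>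

lemma incr_bound:
  assumes v: "v \<in> hypercube d"
  shows "\<bar>incr i v\<bar> \<le> 4 * \<kappa>"
proof -
  have tv: "\<bar>\<theta> i * v i\<bar> \<le> \<kappa>" if "i < d" for i
    using hypercube_values[OF v that] theta_bound[OF that] by (auto simp: abs_mult)
  have "\<bar>proj v\<bar> \<le> (\<Sum>i<d. \<bar>\<theta> i * v i\<bar>)" unfolding proj_def by (rule sum_abs)
  also have "\<dots> \<le> (\<Sum>i<d. \<kappa>)" using tv by (intro sum_mono) auto
  finally have "\<delta> * \<bar>proj v\<bar> \<le> \<delta> * (real d * \<kappa>)" using \<delta>_pos by (intro mult_left_mono) auto
  also have "\<dots> = 2 * p * \<kappa>" using d_pos by (simp add: \<delta>_def)
  also have "\<dots> \<le> 2 * \<kappa>" using p kappa_nonneg by (simp add: mult_left_le_one_le)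
  finally have "\<bar>\<delta> * proj v\<bar> \<le> 2 * \<kappa>" using \<delta>_pos by (simp add: abs_mult)
  then show ?thesis using tv[of i] kappa_nonneg by (auto simp: incr_eq abs_le_iff)
qed

end

section \<open>Moments and oscillation of the walk\<close>

context lazy_walk
begin

lemma adaptedI:
  "(\<And>\<omega> \<omega>'. \<omega> \<in> space M \<Longrightarrow> \<omega>' \<in> space M \<Longrightarrow> (\<And>k. k \<le> n \<Longrightarrow> X k \<omega> = X k \<omega>') \<Longrightarrow> G \<omega> = G \<omega>') \<Longrightarrow> adapted n G"
  unfolding adapted_def by blast

lemma adaptedD:
  "adapted n G \<Longrightarrow> \<omega> \<in> space M \<Longrightarrow> \<omega>' \<in> space M \<Longrightarrow> (\<And>k. k \<le> n \<Longrightarrow> X k \<omega> = X k \<omega>') \<Longrightarrow> G \<omega> = G \<omega>'"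
  unfolding adapted_def by blast

lemma adapted_mono: "adapted n G \<Longrightarrow> n \<le> n' \<Longrightarrow> adapted n' G"
  unfolding adapted_def by (meson order_trans)

lemma adapted_X: "k \<le> n \<Longrightarrow> adapted n (X k)"
  by (rule adaptedI) auto

lemma adapted_Y: "k \<le> n \<Longrightarrow> adapted n (Y k)"
  unfolding Y_def[abs_def] by (rule adapted_comp[OF adapted_X])

lemma adapted_Pair: "adapted n G \<Longrightarrow> adapted n H \<Longrightarrow> adapted n (\<lambda>\<omega>. (G \<omega>, H \<omega>))"
  unfolding adapted_def by blast

lemma adapted_comp2: "adapted n G \<Longrightarrow> adapted n H \<Longrightarrow> adapted n (\<lambda>\<omega>. f (G \<omega>) (H \<omega>))"
  using adapted_comp[OF adapted_Pair, of n G H "\<lambda>z. f (fst z) (snd z)"] by simp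

lemma adapted_const: "adapted n (\<lambda>_. c)"
  by (rule adaptedI) simp

lemma adapted_sum:
  assumes "\<And>j. j \<in> J \<Longrightarrow> adapted n (G j)"
  shows "adapted n (\<lambda>\<omega>. \<Sum>j\<in>J. G j \<omega>)"
  by (rule adaptedI, rule sum.cong) (auto intro: adaptedD[OF assms])

lemma adapted_All:
  assumes "\<And>j. j \<in> J \<Longrightarrow> adapted n (G j)"
  shows "adapted n (\<lambda>\<omega>. \<forall>j\<in>J. G j \<omega>)"
  by (rule adaptedI, rule ball_cong) (auto dest: adaptedD[OF assms])

lemma adapted_\<xi>: "Suc k \<le> n \<Longrightarrow> adapted n (\<xi> k)"
  unfolding \<xi>_def[abs_def] by (intro adapted_comp2[of n "Y (Suc k)" "Y k" "\<lambda>a b. a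
      - (1 - \<delta>) * b"] adapted_Y) auto

lemma Y_step:
  fixes \<psi> :: "'s \<Rightarrow> real \<Rightarrow> real \<Rightarrow> 'c :: {banach, second_countable_topology}"
  assumes G: "adapted n G"
  shows "(\<integral>\<omega>. \<psi> (G \<omega>) (Y n \<omega>) (\<xi> n \<omega>) \<partial>M)
      = (\<integral>\<omega>. (\<Sum>i\<le>d. move_prob i *\<^sub>R \<psi> (G \<omega>) (Y n \<omega>) (incr i (X n \<omega>))) \<partial>M)"
  using one_step[OF adapted_Pair[OF G adapted_X[of n n]],
      of "\<lambda>z w. \<psi> (fst z) (proj (snd z)) (proj w - (1 - \<delta>) * proj (snd z))"]
  by (simp add: \<xi>_def Y_def incr_def)

lemma incr_square_X:
  "\<omega> \<in> space M \<Longrightarrow> (\<Sum>i\<le>d. move_prob i * (incr i (X n \<omega>))\<^sup>2) = 2 * \<delta> - \<delta>\<^sup>2 * (Y n \<omega>)\<^sup>2"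
  unfolding Y_def by (rule incr_square[OF X_hypercube])

lemma incr_square_le:
  assumes "\<omega> \<in> space M"
  shows "(\<Sum>i\<le>d. move_prob i * (incr i (X n \<omega>))\<^sup>2) \<le> 2 * \<delta>"
  by (simp add: incr_square_X[OF assms])

lemma expectation_mono:
  fixes G H :: "'a \<Rightarrow> real"
  assumes "adapted n G" "adapted n' H" "\<And>\<omega>. \<omega> \<in> space M \<Longrightarrow> G \<omega> \<le> H \<omega>"
  shows "expectation G \<le> expectation H"
  by (rule integral_mono[OF adapted_integrable[OF assms(1)] adapted_integrable[OF assms(2)] assms(3)])

lemma kernel_adapted:
  fixes G :: "'a \<Rightarrow> 's" and \<psi> :: "'s \<Rightarrow> real \<Rightarrow> real \<Rightarrow> 'c :: real_vector"
  assumes "adapted n G"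
  shows "adapted n (\<lambda>\<omega>. \<Sum>i\<le>d. move_prob i *\<^sub>R \<psi> (G \<omega>) (Y n \<omega>) (incr i (X n \<omega>)))"
proof -
  have "adapted n (\<lambda>\<omega>. (\<lambda>z. \<Sum>i\<le>d. move_prob i *\<^sub>R \<psi> (fst z) (proj (snd z)) (incr i (snd z))) (G \<omega>, X n
      \<omega>))"
    by (rule adapted_comp[OF adapted_Pair[OF assms adapted_X[OF order_refl]]])
  then show ?thesis by (simp add: Y_def)
qed

text \<open>One step turns y^2 into y^2 + 2 \<delta> - 2 \<delta> y^2 on average. Dropping the
  negative term leaves linear growth, which is enough since \<delta> n is bounded by the time
  horizon.\<close>

lemma Y_second_moment:
  "expectation (\<lambda>\<omega>. (Y n \<omega>)\<^sup>2) \<le> (proj x)\<^sup>2 + 2 * \<delta> * real n"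
proof (induction n)
  case 0
  have "AE \<omega> in M. (Y 0 \<omega>)\<^sup>2 = (proj x)\<^sup>2"
    using walk by (auto simp: lnnrw_def Y_def)
  moreover have "Y 0 \<in> borel_measurable M" by (rule adapted_measurable[OF adapted_Y]) simp
  ultimately have "expectation (\<lambda>\<omega>. (Y 0 \<omega>)\<^sup>2) = expectation (\<lambda>_. (proj x)\<^sup>2)"
    by (intro integral_cong_AE) auto
  then show ?case by (simp add: prob_space)
next
  case (Suc n)
  have "expectation (\<lambda>\<omega>. (Y (Suc n) \<omega>)\<^sup>2) = expectation (\<lambda>\<omega>. ((1 - \<delta>) * Y n \<omega> + \<xi> n \<omega>)\<^sup>2)"
    by (simp add: \<xi>_def)
  also have "\<dots> = expectation (\<lambda>\<omega>. \<Sum>i\<le>d. move_prob i *\<^sub>R ((1 - \<delta>) * Y n \<omega> + incr i (X n \<omega>))\<^sup>2)"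
    by (rule Y_step[OF adapted_const[of n "()"], of "\<lambda>_ y z. ((1 - \<delta>) * y + z)\<^sup>2"])
  also have "\<dots> \<le> expectation (\<lambda>\<omega>. (Y n \<omega>)\<^sup>2 + 2 * \<delta>)"
  proof (rule expectation_mono)
    show "adapted n (\<lambda>\<omega>. \<Sum>i\<le>d. move_prob i *\<^sub>R ((1 - \<delta>) * Y n \<omega> + incr i (X n \<omega>))\<^sup>2)"
      by (rule kernel_adapted[OF adapted_const[of n "()"], of "\<lambda>_ y z. ((1 - \<delta>) * y + z)\<^sup>2"])
    show "adapted n (\<lambda>\<omega>. (Y n \<omega>)\<^sup>2 + 2 * \<delta>)" by (intro adapted_comp[of n "Y n" "\<lambda>y. y\<^sup>2
        + 2 * \<delta>"] adapted_Y) simp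
    fix \<omega> assume w: "\<omega> \<in> space M"
    define y where "y = Y n \<omega>"
    define c where "c = (1 - \<delta>) * y"
    have "(\<Sum>i\<le>d. move_prob i *\<^sub>R (c + incr i (X n \<omega>))\<^sup>2)
      = (\<Sum>i\<le>d. c\<^sup>2 * move_prob i + 2 * c * (move_prob i * incr i (X n \<omega>))
          + move_prob i * (incr i (X n \<omega>))\<^sup>2)"
      by (intro sum.cong refl) (simp add: power2_sum algebra_simps)
    also have "\<dots> = c\<^sup>2 + (2 * \<delta> - \<delta>\<^sup>2 * y\<^sup>2)"
      unfolding sum.distrib sum_distrib_left[symmetric] sum_move_prob incr_mean incr_square_X[OF w]
          by (simp add: y_def)
    also have "\<dots> = y\<^sup>2 + 2 * \<delta> - 2 * \<delta> * y\<^sup>2"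
      by (simp add: c_def power2_eq_square algebra_simps)
    also have "\<dots> \<le> y\<^sup>2 + 2 * \<delta>" using \<delta>_pos by simp
    finally show "(\<Sum>i\<le>d. move_prob i *\<^sub>R ((1 - \<delta>) * Y n \<omega> + incr i (X n \<omega>))\<^sup>2) \<le> (Y n \<omega>)\<^sup>2 + 2 * \<delta>"
      by (simp add: y_def c_def)
  qed
  also have "\<dots> = expectation (\<lambda>\<omega>. (Y n \<omega>)\<^sup>2) + 2 * \<delta>"
    using adapted_integrable[OF adapted_comp[OF adapted_Y[of n n], where f="\<lambda>y. y\<^sup>2"]]
        by (simp add: prob_space)
  also have "\<dots> \<le> (proj x)\<^sup>2 + 2 * \<delta> * real (Suc n)"
    using Suc by (simp add: algebra_simps)
  finally show ?case .
qed

text \<open>\<open>H\<close> is a 0-1 strategy fixed before the increment it multiplies, so the sum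
  remains a martingale; freezing a sum at a stopping time has this form. Terms linear in the
  increment average to 0, and the second moment bound feeds the recursion for the fourth.\<close>

lemma stopped_sum_moments:
  fixes H :: "nat \<Rightarrow> 'a \<Rightarrow> real"
  assumes H: "\<And>j. adapted (N + j) (H j)" and H01: "\<And>j \<omega>. H j \<omega> = 0 \<or> H j \<omega> = 1"
  defines "S \<equiv> \<lambda>m \<omega>. \<Sum>j<m. H j \<omega> * \<xi> (N + j) \<omega>"
  shows "adapted (N + m) (S m)"
    and "expectation (\<lambda>\<omega>. (S m \<omega>)\<^sup>2) \<le> 2 * \<delta> * real m"
    and "expectation (\<lambda>\<omega>. (S m \<omega>) ^ 4) \<le> 32 * (\<delta> * real m)\<^sup>2 + 96 * \<kappa>\<^sup>2 * (\<delta> * real m)"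
proof -
  have ad: "adapted (N + m) (S m)" for m
    unfolding S_def
    by (intro adapted_sum adapted_comp2[where f="\<lambda>a b. a * b"] adapted_mono[OF H] adapted_\<xi>) auto
  then show "adapted (N + m) (S m)" .
  have S_Suc: "S (Suc m) \<omega> = S m \<omega> + H m \<omega> * \<xi> (N + m) \<omega>" for m \<omega> by (simp add: S_def)
  have adG: "adapted (N + m) (\<lambda>\<omega>. (S m \<omega>, H m \<omega>))" for m
    by (intro adapted_Pair ad H)
  have int: "integrable M (\<lambda>\<omega>. f (S m \<omega>))" for f :: "real \<Rightarrow> real" and m
    by (rule adapted_integrable[OF adapted_comp[OF ad]])
  have sq: "expectation (\<lambda>\<omega>. (S m \<omega>)\<^sup>2) \<le> 2 * \<delta> * real m" for m
  proof (induction m)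
    case 0
    show ?case by (simp add: S_def)
  next
    case (Suc m)
    have "expectation (\<lambda>\<omega>. (S (Suc m) \<omega>)\<^sup>2)
        = expectation (\<lambda>\<omega>. \<Sum>i\<le>d. move_prob i *\<^sub>R (fst (S m \<omega>, H m \<omega>) + snd (S m \<omega>, H m \<omega>) * incr i (X (N
            + m) \<omega>))\<^sup>2)"
      unfolding S_Suc using Y_step[OF adG[of m], where \<psi>="\<lambda>g y z. (fst g + snd g * z)\<^sup>2"] by simp
    also have "\<dots> \<le> expectation (\<lambda>\<omega>. (S m \<omega>)\<^sup>2 + 2 * \<delta>)"
    proof (rule expectation_mono)
      show "adapted (N + m) (\<lambda>\<omega>. \<Sum>i\<le>d. move_prob i *\<^sub>R (fst (S m \<omega>, H m \<omega>) + snd (S m \<omega>, H m \<omega>) * incr i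
          (X (N + m) \<omega>))\<^sup>2)"
        by (rule kernel_adapted[OF adG[of m], where \<psi>="\<lambda>g y z. (fst g + snd g * z)\<^sup>2"])
      show "adapted (N + m) (\<lambda>\<omega>. (S m \<omega>)\<^sup>2 + 2 * \<delta>)" by (rule adapted_comp[OF ad, where f="\<lambda>s. s\<^sup>2
          + 2 * \<delta>"])
      fix \<omega> assume w: "\<omega> \<in> space M"
      define s h where "s = S m \<omega>" and "h = H m \<omega>"
      have h: "h\<^sup>2 = h" "0 \<le> h" "h \<le> 1" using H01[of m \<omega>] by (auto simp: h_def)
      have "(\<Sum>i\<le>d. move_prob i *\<^sub>R (s + h * incr i (X (N + m) \<omega>))\<^sup>2)
        = (\<Sum>i\<le>d. s\<^sup>2 * move_prob i + 2 * s * h * (move_prob i * incr i (X (N + m) \<omega>))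
            + h\<^sup>2 * (move_prob i * (incr i (X (N + m) \<omega>))\<^sup>2))"
        by (intro sum.cong refl) (simp add: power2_sum power_mult_distrib algebra_simps)
      also have "\<dots> = s\<^sup>2 + h\<^sup>2 * (\<Sum>i\<le>d. move_prob i * (incr i (X (N + m) \<omega>))\<^sup>2)"
        unfolding sum.distrib sum_distrib_left[symmetric] sum_move_prob incr_mean by simp
      also have "\<dots> \<le> s\<^sup>2 + 1 * (2 * \<delta>)"
        using h incr_square_le[OF w, of "N + m"] \<delta>_pos
        by (intro add_left_mono mult_mono sum_nonneg mult_nonneg_nonneg move_prob_nonneg) auto
      finally show "(\<Sum>i\<le>d. move_prob i *\<^sub>R (fst (S m \<omega>, H m \<omega>) + snd (S m \<omega>, H m \<omega>) * incr i (X (N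
          + m) \<omega>))\<^sup>2) \<le> (S m \<omega>)\<^sup>2 + 2 * \<delta>"
        by (simp add: s_def h_def)
    qed
    also have "\<dots> = expectation (\<lambda>\<omega>. (S m \<omega>)\<^sup>2) + 2 * \<delta>"
      using int[of "\<lambda>s. s\<^sup>2"] by (simp add: prob_space)
    also have "\<dots> \<le> 2 * \<delta> * real (Suc m)" using Suc by (simp add: algebra_simps)
    finally show ?case .
  qed
  then show "expectation (\<lambda>\<omega>. (S m \<omega>)\<^sup>2) \<le> 2 * \<delta> * real m" .
  show "expectation (\<lambda>\<omega>. (S m \<omega>) ^ 4) \<le> 32 * (\<delta> * real m)\<^sup>2 + 96 * \<kappa>\<^sup>2 * (\<delta> * real m)"
  proof (induction m)
    case 0
    show ?case by (simp add: S_def)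
  next
    case (Suc m)
    have "expectation (\<lambda>\<omega>. (S (Suc m) \<omega>) ^ 4)
        = expectation (\<lambda>\<omega>. \<Sum>i\<le>d. move_prob i *\<^sub>R (fst (S m \<omega>, H m \<omega>) + snd (S m \<omega>, H m \<omega>) * incr i (X (N
            + m) \<omega>)) ^ 4)"
      unfolding S_Suc using Y_step[OF adG[of m], where \<psi>="\<lambda>g y z. (fst g + snd g * z) ^ 4"] by simp
    also have "\<dots> \<le> expectation (\<lambda>\<omega>. (S m \<omega>) ^ 4 + 16 * \<delta> * (S m \<omega>)\<^sup>2 + 96 * \<kappa>\<^sup>2 * \<delta>)"
    proof (rule expectation_mono)
      show "adapted (N + m) (\<lambda>\<omega>. \<Sum>i\<le>d. move_prob i *\<^sub>R (fst (S m \<omega>, H m \<omega>) + snd (S m \<omega>, H m \<omega>) * incr i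
          (X (N + m) \<omega>)) ^ 4)"
        by (rule kernel_adapted[OF adG[of m], where \<psi>="\<lambda>g y z. (fst g + snd g * z) ^ 4"])
      show "adapted (N + m) (\<lambda>\<omega>. (S m \<omega>) ^ 4 + 16 * \<delta> * (S m \<omega>)\<^sup>2 + 96 * \<kappa>\<^sup>2 * \<delta>)"
        by (rule adapted_comp[OF ad, where f="\<lambda>s. s ^ 4 + 16 * \<delta> * s\<^sup>2 + 96 * \<kappa>\<^sup>2 * \<delta>"])
      fix \<omega> assume w: "\<omega> \<in> space M"
      define s h where "s = S m \<omega>" and "h = H m \<omega>"
      define z where "z i = incr i (X (N + m) \<omega>)" for i
      have h: "h = 0 \<or> h = 1" using H01[of m \<omega>] by (auto simp: h_def)
      \<comment> \<open>The constant 48 is 3 times 16, from z^4 \<le> 16 \<kappa>^2 z^2. Averaging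
        z^2 to at most 2 \<delta> then produces 16 \<delta> s^2 and 96 \<kappa>^2 \<delta>.\<close>
      have pw: "(s + h * z i) ^ 4 \<le> s ^ 4 + 4 * s ^ 3 * h * z i + (8 * s\<^sup>2 + 48 * \<kappa>\<^sup>2) * (z i)\<^sup>2" for i
      proof -
        have zb: "(z i)\<^sup>2 \<le> 16 * \<kappa>\<^sup>2"
        proof -
          have "\<bar>z i\<bar> \<le> \<bar>4 * \<kappa>\<bar>" using incr_bound[OF X_hypercube[OF w], of i "N + m"]
              by (simp add: z_def)
          then have "(z i)\<^sup>2 \<le> (4 * \<kappa>)\<^sup>2" using abs_le_square_iff by blast
          then show ?thesis by (simp add: power_mult_distrib)
        qed
        have z4: "(z i) ^ 4 \<le> 16 * \<kappa>\<^sup>2 * (z i)\<^sup>2"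
          using mult_right_mono[OF zb, of "(z i)\<^sup>2"]
              by (simp add: power2_eq_square power4_eq_xxxx mult.assoc)
        \<comment> \<open>The cubic term 4 s z^3 is absorbed by 2 s^2 z^2 + 2 z^4; the slack is
          exactly 2 z^2 (s - z)^2.\<close>
        have key: "(s + z i) ^ 4 \<le> s ^ 4 + 4 * s ^ 3 * z i + 8 * s\<^sup>2 * (z i)\<^sup>2 + 3 * (z i) ^ 4"
        proof -
          have "0 \<le> 2 * (z i)\<^sup>2 * (s - z i)\<^sup>2" by simp
          also have "\<dots> = s ^ 4 + 4 * s ^ 3 * z i + 8 * s\<^sup>2 * (z i)\<^sup>2 + 3 * (z i) ^ 4 - (s + z i) ^ 4"
            by (simp add: power2_eq_square power4_eq_xxxx power3_eq_cube algebra_simps)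
          finally show ?thesis by simp
        qed
        show ?thesis
        proof (cases "h = 0")
          case True
          then show ?thesis by simp
        next
          case False
          then have "h = 1" using h by simp
          then show ?thesis using key z4 by (simp add: algebra_simps)
        qed
      qed
      have "(\<Sum>i\<le>d. move_prob i *\<^sub>R (s + h * z i) ^ 4)
        \<le> (\<Sum>i\<le>d. move_prob i * (s ^ 4 + 4 * s ^ 3 * h * z i + (8 * s\<^sup>2 + 48 * \<kappa>\<^sup>2) * (z i)\<^sup>2))"
        unfolding real_scaleR_def by (intro sum_mono mult_left_mono pw move_prob_nonneg)
      also have "\<dots> = (\<Sum>i\<le>d. s ^ 4 * move_prob i + 4 * s ^ 3 * h * (move_prob i * z i) + (8 * s\<^sup>2
          + 48 * \<kappa>\<^sup>2) * (move_prob i * (z i)\<^sup>2))"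
        by (intro sum.cong refl) (simp add: algebra_simps)
      also have "\<dots> = s ^ 4 + (8 * s\<^sup>2 + 48 * \<kappa>\<^sup>2) * (\<Sum>i\<le>d. move_prob i * (z i)\<^sup>2)"
        unfolding sum.distrib sum_distrib_left[symmetric] sum_move_prob incr_mean[of "X (N
            + m) \<omega>", folded z_def] by simp
      also have "\<dots> \<le> s ^ 4 + (8 * s\<^sup>2 + 48 * \<kappa>\<^sup>2) * (2 * \<delta>)"
        using incr_square_le[OF w, of "N + m"] unfolding z_def
            by (intro add_left_mono mult_left_mono) auto
      also have "\<dots> = s ^ 4 + 16 * \<delta> * s\<^sup>2 + 96 * \<kappa>\<^sup>2 * \<delta>" by (simp add: algebra_simps)
      finally show "(\<Sum>i\<le>d. move_prob i *\<^sub>R (fst (S m \<omega>, H m \<omega>) + snd (S m \<omega>, H m \<omega>) * incr i (X (N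
          + m) \<omega>)) ^ 4)
          \<le> (S m \<omega>) ^ 4 + 16 * \<delta> * (S m \<omega>)\<^sup>2 + 96 * \<kappa>\<^sup>2 * \<delta>"
        by (simp add: s_def h_def z_def)
    qed
    also have "\<dots> = expectation (\<lambda>\<omega>. (S m \<omega>) ^ 4) + 16 * \<delta> * expectation (\<lambda>\<omega>. (S m \<omega>)\<^sup>2) + 96 * \<kappa>\<^sup>2 * \<delta>"
      using int[of "\<lambda>s. s\<^sup>2"] int[of "\<lambda>s. s ^ 4"] by (simp add: prob_space)
    also have "\<dots> \<le> (32 * (\<delta> * real m)\<^sup>2 + 96 * \<kappa>\<^sup>2 * (\<delta> * real m)) + 16 * \<delta> * (2 * \<delta> * real m)
        + 96 * \<kappa>\<^sup>2 * \<delta>"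
      using Suc sq[of m] \<delta>_pos by (intro add_mono mult_left_mono) auto
    \<comment> \<open>The claimed bound grows by 64 m + 32 in units of \<delta>^2, while the
      recursion adds only 32 m.\<close>
    also have "\<dots> \<le> 32 * (\<delta> * real (Suc m))\<^sup>2 + 96 * \<kappa>\<^sup>2 * (\<delta> * real (Suc m))"
    proof -
      have "32 * (\<delta> * real (Suc m))\<^sup>2 = 32 * (\<delta> * real m)\<^sup>2 + 64 * \<delta>\<^sup>2 * real m + 32 * \<delta>\<^sup>2"
        by (simp add: power2_eq_square algebra_simps)
      moreover have "0 \<le> 32 * \<delta>\<^sup>2 * real m" "0 \<le> 32 * \<delta>\<^sup>2" by auto
      ultimately show ?thesis by (simp add: algebra_simps power2_eq_square)
    qed
    finally show ?case .
  qed
qed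

lemma markov_moment:
  fixes G :: "'a \<Rightarrow> real"
  assumes G: "adapted n G" "\<And>\<omega>. \<omega> \<in> space M \<Longrightarrow> 0 \<le> G \<omega>" and c: "0 < c" and E: "expectation G \<le> b"
  shows "prob {\<omega> \<in> space M. c \<le> G \<omega>} \<le> b / c"
proof -
  have "prob {\<omega> \<in> space M. c \<le> G \<omega>} \<le> expectation G / c"
    using integral_Markov_inequality_measure[OF adapted_integrable[OF G(1)], of "{}" c] G(2) c by auto
  also have "\<dots> \<le> b / c" using c E by (intro divide_right_mono) auto
  finally show ?thesis .
qed

text \<open>The sum frozen at its first exceedance of \<open>e\<close> exceeds \<open>e\<close> at the terminal time whenever
  the running maximum does, so its fourth moment controls the maximum.\<close>

lemma maximal_inequality:
  assumes e: "0 < e"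
  shows "prob {\<omega> \<in> space M. \<exists>j\<le>m. e < \<bar>\<Sum>l<j. \<xi> (N + l) \<omega>\<bar>} \<le> (32 * (\<delta> * real m)\<^sup>2
      + 96 * \<kappa>\<^sup>2 * (\<delta> * real m)) / e ^ 4"
proof -
  define T where "T j \<omega> = (\<Sum>l<j. \<xi> (N + l) \<omega>)" for j \<omega>
  \<comment> \<open>\<open>H j\<close> inspects the partial sums up to index \<open>j\<close>, which
    are known before the increment at \<open>N + j\<close> that it multiplies.\<close>
  define H where "H j \<omega> = (of_bool (\<forall>i\<in>{..j}. \<bar>T i \<omega>\<bar> \<le> e) :: real)" for j \<omega>
  define S where "S m \<omega> = (\<Sum>j<m. H j \<omega> * \<xi> (N + j) \<omega>)" for m \<omega>
  have adT: "adapted (N + j) (T i)" if "i \<le> j" for i j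
    unfolding T_def by (intro adapted_sum adapted_\<xi>) (use that in auto)
  have adH: "adapted (N + j) (H j)" for j
    unfolding H_def by (intro adapted_comp[where f=of_bool] adapted_All adapted_comp[where f="\<lambda>t. \<bar>t\<bar>
        \<le> e"] adT) auto
  have H01: "H j \<omega> = 0 \<or> H j \<omega> = 1" for j \<omega>
    unfolding H_def of_bool_eq_0_iff of_bool_eq_1_iff by blast
  note mom = stopped_sum_moments[of N H, OF adH H01, folded S_def]
  \<comment> \<open>The invariant: either the level has not been exceeded and both sums agree, or
    \<open>S\<close> has stayed at the first value beyond the level.\<close>
  have stop: "((\<forall>i\<le>j. \<bar>T i \<omega>\<bar> \<le> e) \<and> S j \<omega> = T j \<omega>) \<or> ((\<exists>i\<le>j. e < \<bar>T i \<omega>\<bar>) \<and> e < \<bar>S j \<omega>\<bar>)" for j \<omega>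
  proof (induction j)
    case 0
    then show ?case using e by (simp add: T_def S_def)
  next
    case (Suc j)
    then consider "\<forall>i\<le>j. \<bar>T i \<omega>\<bar> \<le> e" "S j \<omega> = T j \<omega>" | "\<exists>i\<le>j. e < \<bar>T i \<omega>\<bar>" "e < \<bar>S j \<omega>\<bar>" by blast
    then show ?case
    proof cases
      case 1
      then have "S (Suc j) \<omega> = T (Suc j) \<omega>" by (simp add: S_def T_def H_def)
      then show ?thesis using 1 by (cases "\<bar>T (Suc j) \<omega>\<bar> \<le> e") (auto simp: le_Suc_eq not_le)
    next
      case 2
      then have "H j \<omega> = 0" by (auto simp: H_def not_le[symmetric])
      then have "S (Suc j) \<omega> = S j \<omega>" by (simp add: S_def)
      then show ?thesis using 2 le_Suc_eq by auto
    qed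
  qed
  have "prob {\<omega> \<in> space M. \<exists>j\<le>m. e < \<bar>T j \<omega>\<bar>} \<le> prob {\<omega> \<in> space M. e ^ 4 \<le> (S m \<omega>) ^ 4}"
  proof (rule finite_measure_mono)
    show "{\<omega> \<in> space M. e ^ 4 \<le> (S m \<omega>) ^ 4} \<in> events"
      by (rule adapted_event[OF adapted_comp[OF mom(1)[of m], where f="\<lambda>s. e ^ 4 \<le> s ^ 4"]])
    show "{\<omega> \<in> space M. \<exists>j\<le>m. e < \<bar>T j \<omega>\<bar>} \<subseteq> {\<omega> \<in> space M. e ^ 4 \<le> (S m \<omega>) ^ 4}"
    proof clarify
      fix \<omega> j assume "j \<le> m" "e < \<bar>T j \<omega>\<bar>"
      then have "e < \<bar>S m \<omega>\<bar>" using stop[of m \<omega>] by force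
      then have "e ^ 4 \<le> \<bar>S m \<omega>\<bar> ^ 4" using e by (intro power_mono) auto
      then show "e ^ 4 \<le> (S m \<omega>) ^ 4" by (simp add: power_even_abs)
    qed
  qed
  also have "\<dots> \<le> (32 * (\<delta> * real m)\<^sup>2 + 96 * \<kappa>\<^sup>2 * (\<delta> * real m)) / e ^ 4"
    by (rule markov_moment[OF adapted_comp[OF mom(1), where f="\<lambda>s. s ^ 4"] _ _ mom(3)]) (use e in auto)
  finally show ?thesis by (simp add: T_def)
qed

text \<open>The displacement is a sum of martingale differences minus the drift, \<delta> times a
  sum of \<open>Y\<close>. One \<open>e\<close> is allotted to each:
  \<open>maximal_inequality\<close> for the first, Markov's inequality with Cauchy-Schwarz and the
  second moments for the second.\<close>

lemma oscillation_bound: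
  assumes e: "0 < e"
  shows "prob {\<omega> \<in> space M. \<exists>j\<le>m. 2 * e < \<bar>Y (N + j) \<omega> - Y N \<omega>\<bar>}
    \<le> (32 * (\<delta> * real m)\<^sup>2 + 96 * \<kappa>\<^sup>2 * (\<delta> * real m)) / e ^ 4
      + (\<delta> * real m)\<^sup>2 * ((proj x)\<^sup>2 + 2 * \<delta> * real (N + m)) / e\<^sup>2"
proof -
  let ?A = "{\<omega> \<in> space M. \<exists>j\<le>m. e < \<bar>\<Sum>l<j. \<xi> (N + l) \<omega>\<bar>}"
  \<comment> \<open>Taking absolute values and all \<open>m\<close> terms bounds the squared drift
    simultaneously for every \<open>j \<le> m\<close>.\<close>
  define D where "D \<omega> = (\<delta> * (\<Sum>l<m. \<bar>Y (N + l) \<omega>\<bar>))\<^sup>2" for \<omega>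
  let ?B = "{\<omega> \<in> space M. e\<^sup>2 \<le> D \<omega>}"
  have adD: "adapted (N + m) D"
    unfolding D_def by (intro adapted_comp[where f="\<lambda>s. (\<delta> * s)\<^sup>2"] adapted_sum adapted_comp[where
        f=abs] adapted_Y) auto
  have sumxi: "Y (N + j) \<omega> - Y N \<omega> = (\<Sum>l<j. \<xi> (N + l) \<omega>) - \<delta> * (\<Sum>l<j. Y (N + l) \<omega>)" for j \<omega>
    by (induction j) (auto simp: \<xi>_def algebra_simps)
  have A: "?A \<in> events"
  proof -
    have "adapted (N + m) (\<lambda>\<omega>. \<not> (\<forall>j\<in>{..m}. \<not> e < \<bar>\<Sum>l<j. \<xi> (N + l) \<omega>\<bar>))"
      by (intro adapted_comp[where f=Not] adapted_All adapted_comp[where f="\<lambda>t. \<not> e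
          < \<bar>t\<bar>"] adapted_sum adapted_\<xi>) auto
    note adapted_event[OF this]
    moreover have "{\<omega> \<in> space M. \<not> (\<forall>j\<in>{..m}. \<not> e < \<bar>\<Sum>l<j. \<xi> (N + l) \<omega>\<bar>)} = ?A" by blast
    ultimately show ?thesis by (simp only:)
  qed
  have B: "?B \<in> events" by (rule adapted_event[OF adapted_comp[OF adD, where f="\<lambda>z. e\<^sup>2 \<le> z"]])
  have "{\<omega> \<in> space M. \<exists>j\<le>m. 2 * e < \<bar>Y (N + j) \<omega> - Y N \<omega>\<bar>} \<subseteq> ?A \<union> ?B"
  proof clarify
    fix \<omega> j assume w: "\<omega> \<in> space M" and j: "j \<le> m" "2 * e < \<bar>Y (N + j) \<omega> - Y N \<omega>\<bar>" and nB: "\<not> e\<^sup>2 \<le> D \<omega>"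
    have "\<not> e \<le> \<delta> * (\<Sum>l<m. \<bar>Y (N + l) \<omega>\<bar>)"
    proof
      assume "e \<le> \<delta> * (\<Sum>l<m. \<bar>Y (N + l) \<omega>\<bar>)"
      from power_mono[OF this less_imp_le[OF e], of 2] nB show False by (simp add: D_def)
    qed
    then have "\<delta> * (\<Sum>l<m. \<bar>Y (N + l) \<omega>\<bar>) \<le> e" by simp
    moreover have "\<bar>\<delta> * (\<Sum>l<j. Y (N + l) \<omega>)\<bar> \<le> \<delta> * (\<Sum>l<m. \<bar>Y (N + l) \<omega>\<bar>)"
    proof -
      have "\<bar>\<Sum>l<j. Y (N + l) \<omega>\<bar> \<le> (\<Sum>l<j. \<bar>Y (N + l) \<omega>\<bar>)" by (rule sum_abs)
      also have "\<dots> \<le> (\<Sum>l<m. \<bar>Y (N + l) \<omega>\<bar>)" using j(1) by (intro sum_mono2) auto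
      finally show ?thesis using \<delta>_pos by (simp add: abs_mult)
    qed
    ultimately have "e < \<bar>\<Sum>l<j. \<xi> (N + l) \<omega>\<bar>" using j(2) sumxi[of j \<omega>] by linarith
    then show "\<exists>j\<le>m. e < \<bar>\<Sum>l<j. \<xi> (N + l) \<omega>\<bar>" using j(1) by blast
  qed
  then have "prob {\<omega> \<in> space M. \<exists>j\<le>m. 2 * e < \<bar>Y (N + j) \<omega> - Y N \<omega>\<bar>} \<le> prob (?A \<union> ?B)"
    by (rule finite_measure_mono) (rule sets.Un[OF A B])
  also have "\<dots> \<le> prob ?A + prob ?B" by (rule measure_Un_le[OF A B])
  also have "\<dots> \<le> (32 * (\<delta> * real m)\<^sup>2 + 96 * \<kappa>\<^sup>2 * (\<delta> * real m)) / e ^ 4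
      + (\<delta> * real m)\<^sup>2 * ((proj x)\<^sup>2 + 2 * \<delta> * real (N + m)) / e\<^sup>2"
  proof (intro add_mono maximal_inequality[OF e] markov_moment[OF adD])
    have "expectation D \<le> expectation (\<lambda>\<omega>. \<delta>\<^sup>2 * real m * (\<Sum>l<m. (Y (N + l) \<omega>)\<^sup>2))"
    proof (rule expectation_mono[OF adD])
      show "adapted (N + m) (\<lambda>\<omega>. \<delta>\<^sup>2 * real m * (\<Sum>l<m. (Y (N + l) \<omega>)\<^sup>2))"
        by (intro adapted_comp[where f="\<lambda>s. \<delta>\<^sup>2 * real m * s"] adapted_sum adapted_comp[where f="\<lambda>y.
            y\<^sup>2"] adapted_Y) auto
      fix \<omega> assume "\<omega> \<in> space M"
      have "(\<Sum>l<m. \<bar>Y (N + l) \<omega>\<bar>)\<^sup>2 \<le> (\<Sum>l<m. \<bar>Y (N + l) \<omega>\<bar>\<^sup>2) * real (card {..<m})"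
        by (rule sum_squared_le_sum_of_squares)
      then have "\<delta>\<^sup>2 * (\<Sum>l<m. \<bar>Y (N + l) \<omega>\<bar>)\<^sup>2 \<le> \<delta>\<^sup>2 * ((\<Sum>l<m. \<bar>Y (N + l) \<omega>\<bar>\<^sup>2) * real (card {..<m}))"
        by (intro mult_left_mono) auto
      then show "D \<omega> \<le> \<delta>\<^sup>2 * real m * (\<Sum>l<m. (Y (N + l) \<omega>)\<^sup>2)"
        by (simp add: D_def power_mult_distrib mult_ac)
    qed
    also have "\<dots> = \<delta>\<^sup>2 * real m * (\<Sum>l<m. expectation (\<lambda>\<omega>. (Y (N + l) \<omega>)\<^sup>2))"
      using adapted_integrable[OF adapted_comp[OF adapted_Y[OF order_refl], where f="\<lambda>y. y\<^sup>2"]] by simp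
    also have "\<dots> \<le> \<delta>\<^sup>2 * real m * (\<Sum>l<m. (proj x)\<^sup>2 + 2 * \<delta> * real (N + m))"
    proof (intro mult_left_mono sum_mono)
      fix l assume "l \<in> {..<m}"
      then have "2 * \<delta> * real (N + l) \<le> 2 * \<delta> * real (N + m)" using \<delta>_pos by (intro mult_left_mono) auto
      then show "expectation (\<lambda>\<omega>. (Y (N + l) \<omega>)\<^sup>2) \<le> (proj x)\<^sup>2 + 2 * \<delta> * real (N + m)"
        using Y_second_moment[of "N + l"] by linarith
    qed auto
    also have "\<dots> = (\<delta> * real m)\<^sup>2 * ((proj x)\<^sup>2 + 2 * \<delta> * real (N + m))"
      by (simp add: power2_eq_square algebra_simps)
    finally show "expectation D \<le> (\<delta> * real m)\<^sup>2 * ((proj x)\<^sup>2 + 2 * \<delta> * real (N + m))" .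
  qed (use e in \<open>auto simp: D_def\<close>)
  finally show ?thesis .
qed

end

section \<open>Characteristic functions of the increments\<close>

context lazy_walk
begin

text \<open>Second-order expansion of the exponential of the increment: the mean vanishes and the
  conditional variance gives the factor 1 - \<mu>^2 \<delta>. The first error is its correction
  \<delta>^2 Y^2, the second the cubic remainder, with |z|^3 / 6 at most 4 \<kappa> z^2 / 6 and mean
  square at most 2 \<delta>.\<close>

lemma char_step:
  fixes G :: "'a \<Rightarrow> complex"
  assumes G: "adapted n G" "\<And>\<omega>. \<omega> \<in> space M \<Longrightarrow> cmod (G \<omega>) \<le> 1"
  shows "cmod ((CLINT \<omega>|M. G \<omega> * iexp (\<mu> * Y (Suc n) \<omega>))
      - of_real (1 - \<mu>\<^sup>2 * \<delta>) * (CLINT \<omega>|M. G \<omega> * iexp (\<mu> * (1 - \<delta>) * Y n \<omega>)))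
    \<le> \<mu>\<^sup>2 * \<delta>\<^sup>2 * ((proj x)\<^sup>2 + 2 * \<delta> * real n) / 2 + 4 * \<kappa> * \<bar>\<mu>\<bar> ^ 3 * \<delta> / 3"
proof -
  define K where "K \<omega> = (\<Sum>i\<le>d. move_prob i *\<^sub>R (G \<omega> * iexp (\<mu> * ((1 - \<delta>) * Y n \<omega> + incr i (X n \<omega>)))))"
      for \<omega>
  define I where "I \<omega> = G \<omega> * iexp (\<mu> * (1 - \<delta>) * Y n \<omega>)" for \<omega>
  have adK: "adapted n K"
    unfolding K_def by (rule kernel_adapted[OF G(1), where \<psi>="\<lambda>g y z. g * iexp (\<mu> * ((1 - \<delta>) * y
        + z))"])
  have adI: "adapted n I"
    unfolding I_def by (rule adapted_comp2[OF G(1) adapted_Y[OF order_refl], where f="\<lambda>g y. g * iexp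
        (\<mu> * (1 - \<delta>) * y)"])
  have "(CLINT \<omega>|M. G \<omega> * iexp (\<mu> * Y (Suc n) \<omega>)) = (CLINT \<omega>|M. G \<omega> * iexp (\<mu> * ((1 - \<delta>) * Y n \<omega>
      + \<xi> n \<omega>)))"
    by (simp add: \<xi>_def)
  also have "\<dots> = (CLINT \<omega>|M. K \<omega>)"
    unfolding K_def by (rule Y_step[OF G(1), where \<psi>="\<lambda>g y z. g * iexp (\<mu> * ((1 - \<delta>) * y + z))"])
  finally have EK: "(CLINT \<omega>|M. G \<omega> * iexp (\<mu> * Y (Suc n) \<omega>)) = (CLINT \<omega>|M. K \<omega>)" .
  have pw: "cmod (K \<omega> - of_real (1 - \<mu>\<^sup>2 * \<delta>) * I \<omega>) \<le> \<mu>\<^sup>2 * \<delta>\<^sup>2 / 2 * (Y n \<omega>)\<^sup>2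
      + 4 * \<kappa> * \<bar>\<mu>\<bar> ^ 3 * \<delta> / 3"
    if w: "\<omega> \<in> space M" for \<omega>
  proof -
    define z where "z i = incr i (X n \<omega>)" for i
    \<comment> \<open>The third-order Taylor remainder of the exponential.\<close>
    define R where "R i = iexp (\<mu> * z i) - (1 + \<i> * of_real (\<mu> * z i) - of_real ((\<mu> * z i)\<^sup>2) / 2)"
        for i
    have R: "cmod (R i) \<le> \<bar>\<mu>\<bar> ^ 3 * (4 * \<kappa>) * (z i)\<^sup>2 / 6" for i
    proof -
      have "R i = iexp (\<mu> * z i) - (\<Sum>k\<le>2. (\<i> * of_real (\<mu> * z i)) ^ k / fact k)"
      proof -
        have "\<i> * w * (\<i> * w) = - (w * w)" for w
          using i_squared by (metis (no_types) mult.assoc mult.left_commute mult_minus1)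
        then show ?thesis by (simp add: R_def numeral_2_eq_2 power2_eq_square)
      qed
      then have "cmod (R i) \<le> \<bar>\<mu> * z i\<bar> ^ 3 / 6"
        using iexp_approx1[of "\<mu> * z i" 2] by (simp add: numeral_3_eq_3[symmetric] fact_numeral)
      also have "\<bar>\<mu> * z i\<bar> ^ 3 = \<bar>\<mu>\<bar> ^ 3 * (\<bar>z i\<bar> * (z i)\<^sup>2)"
      proof -
        have "\<bar>z i\<bar> ^ 3 = \<bar>z i\<bar> * (z i)\<^sup>2" by (simp add: power3_eq_cube power2_eq_square mult.commute)
        then show ?thesis by (simp add: abs_mult power_mult_distrib)
      qed
      also have "\<dots> \<le> \<bar>\<mu>\<bar> ^ 3 * ((4 * \<kappa>) * (z i)\<^sup>2)"
        using incr_bound[OF X_hypercube[OF w], of i n]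
            by (intro mult_left_mono mult_right_mono) (auto simp: z_def)
      finally show ?thesis by (simp add: mult.assoc)
    qed
    have sq: "(\<Sum>i\<le>d. move_prob i * (z i)\<^sup>2) = 2 * \<delta> - \<delta>\<^sup>2 * (Y n \<omega>)\<^sup>2"
      unfolding z_def by (rule incr_square_X[OF w])
    have "(\<Sum>i\<le>d. move_prob i *\<^sub>R iexp (\<mu> * z i))
        = (\<Sum>i\<le>d. move_prob i *\<^sub>R R i) + (\<Sum>i\<le>d. of_real (move_prob i) + \<i> * of_real \<mu> * of_real
            (move_prob i * z i) - of_real (\<mu>\<^sup>2) / 2 * of_real (move_prob i * (z i)\<^sup>2))"
      unfolding sum.distrib[symmetric]
      by (intro sum.cong refl) (simp add: R_def scaleR_conv_of_real power_mult_distrib algebra_simps)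
    also have "(\<Sum>i\<le>d. of_real (move_prob i) + \<i> * of_real \<mu> * of_real (move_prob i * z i)
        - of_real (\<mu>\<^sup>2) / 2 * of_real (move_prob i * (z i)\<^sup>2))
        = of_real (\<Sum>i\<le>d. move_prob i) + \<i> * of_real \<mu> * of_real (\<Sum>i\<le>d. move_prob i * z i)
            - of_real (\<mu>\<^sup>2) / 2 * of_real (\<Sum>i\<le>d. move_prob i * (z i)\<^sup>2)"
      unfolding of_real_sum sum_distrib_left sum.distrib sum_subtractf ..
    also have "\<dots> = of_real (1 - \<mu>\<^sup>2 * \<delta>) + of_real (\<mu>\<^sup>2 * \<delta>\<^sup>2 * (Y n \<omega>)\<^sup>2 / 2)"
      unfolding sum_move_prob incr_mean[of "X n \<omega>", folded z_def] sq by (simp add: algebra_simps)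
    finally have expand: "(\<Sum>i\<le>d. move_prob i *\<^sub>R iexp (\<mu> * z i)) - of_real (1 - \<mu>\<^sup>2 * \<delta>)
        = (\<Sum>i\<le>d. move_prob i *\<^sub>R R i) + of_real (\<mu>\<^sup>2 * \<delta>\<^sup>2 * (Y n \<omega>)\<^sup>2 / 2)" by simp
    have "cmod (\<Sum>i\<le>d. move_prob i *\<^sub>R R i) \<le> (\<Sum>i\<le>d. move_prob i * (\<bar>\<mu>\<bar> ^ 3 * (4 * \<kappa>) * (z i)\<^sup>2 / 6))"
    proof (rule sum_norm_le)
      show "cmod (move_prob i *\<^sub>R R i) \<le> move_prob i * (\<bar>\<mu>\<bar> ^ 3 * (4 * \<kappa>) * (z i)\<^sup>2 / 6)" for i
        unfolding norm_scaleR abs_of_nonneg[OF move_prob_nonneg]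
            by (rule mult_left_mono[OF R move_prob_nonneg])
    qed
    also have "\<dots> = \<bar>\<mu>\<bar> ^ 3 * (4 * \<kappa>) / 6 * (\<Sum>i\<le>d. move_prob i * (z i)\<^sup>2)"
      by (simp add: sum_distrib_left mult_ac)
    also have "\<dots> \<le> \<bar>\<mu>\<bar> ^ 3 * (4 * \<kappa>) / 6 * (2 * \<delta>)"
      using incr_square_le[OF w, of n] kappa_nonneg unfolding z_def by (intro mult_left_mono) auto
    finally have rest: "cmod (\<Sum>i\<le>d. move_prob i *\<^sub>R R i) \<le> 4 * \<kappa> * \<bar>\<mu>\<bar> ^ 3 * \<delta> / 3"
        by (simp add: mult_ac)
    have "K \<omega> = I \<omega> * (\<Sum>i\<le>d. move_prob i *\<^sub>R iexp (\<mu> * z i))"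
      unfolding K_def I_def sum_distrib_left
      by (intro sum.cong refl) (simp add: z_def distrib_left exp_add mult_ac)
    then have "K \<omega> - of_real (1 - \<mu>\<^sup>2 * \<delta>) * I \<omega> = I \<omega> * ((\<Sum>i\<le>d. move_prob i *\<^sub>R R i)
        + of_real (\<mu>\<^sup>2 * \<delta>\<^sup>2 * (Y n \<omega>)\<^sup>2 / 2))"
      unfolding expand[symmetric] by (simp add: algebra_simps)
    then have "cmod (K \<omega> - of_real (1 - \<mu>\<^sup>2 * \<delta>) * I \<omega>) = cmod (I \<omega>) * cmod ((\<Sum>i\<le>d. move_prob i *\<^sub>R R i)
        + of_real (\<mu>\<^sup>2 * \<delta>\<^sup>2 * (Y n \<omega>)\<^sup>2 / 2))"
      by (simp only: norm_mult)
    also have "\<dots> \<le> 1 * (4 * \<kappa> * \<bar>\<mu>\<bar> ^ 3 * \<delta> / 3 + \<mu>\<^sup>2 * \<delta>\<^sup>2 * (Y n \<omega>)\<^sup>2 / 2)"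
    proof (intro mult_mono order_trans[OF norm_triangle_ineq] add_mono rest)
      show "cmod (I \<omega>) \<le> 1" using G(2)[OF w] by (simp add: I_def norm_mult)
      show "cmod (of_real (\<mu>\<^sup>2 * \<delta>\<^sup>2 * (Y n \<omega>)\<^sup>2 / 2)) \<le> \<mu>\<^sup>2 * \<delta>\<^sup>2 * (Y n \<omega>)\<^sup>2 / 2"
        by (simp only: norm_of_real) simp
    qed auto
    finally show ?thesis by (simp add: add.commute)
  qed
  have iY: "integrable M (\<lambda>\<omega>. (Y n \<omega>)\<^sup>2)"
    by (rule adapted_integrable[OF adapted_comp[OF adapted_Y[OF order_refl], where f="\<lambda>y. y\<^sup>2"]])
  have iK: "integrable M K" "integrable M I"
      by (rule adapted_integrable[OF adK], rule adapted_integrable[OF adI])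
  have "(CLINT \<omega>|M. K \<omega>) - of_real (1 - \<mu>\<^sup>2 * \<delta>) * (CLINT \<omega>|M. I \<omega>) = (CLINT \<omega>|M. K \<omega> - of_real (1
      - \<mu>\<^sup>2 * \<delta>) * I \<omega>)"
    using iK by simp
  also have "cmod \<dots> \<le> expectation (\<lambda>\<omega>. cmod (K \<omega> - of_real (1 - \<mu>\<^sup>2 * \<delta>) * I \<omega>))"
    by (rule integral_norm_bound)
  also have "\<dots> \<le> expectation (\<lambda>\<omega>. \<mu>\<^sup>2 * \<delta>\<^sup>2 / 2 * (Y n \<omega>)\<^sup>2 + 4 * \<kappa> * \<bar>\<mu>\<bar> ^ 3 * \<delta> / 3)"
    using iK iY by (intro integral_mono pw) auto
  also have "\<dots> = \<mu>\<^sup>2 * \<delta>\<^sup>2 / 2 * expectation (\<lambda>\<omega>. (Y n \<omega>)\<^sup>2) + 4 * \<kappa> * \<bar>\<mu>\<bar> ^ 3 * \<delta> / 3"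
    using iY by (simp add: prob_space)
  also have "\<dots> \<le> \<mu>\<^sup>2 * \<delta>\<^sup>2 / 2 * ((proj x)\<^sup>2 + 2 * \<delta> * real n) + 4 * \<kappa> * \<bar>\<mu>\<bar> ^ 3 * \<delta> / 3"
    by (intro add_right_mono mult_left_mono Y_second_moment) auto
  finally show ?thesis unfolding EK I_def by simp
qed

text \<open>Steps are peeled off from the last one backwards. Each gives one factor of the product
  and multiplies the frequency by 1 - \<delta>, until only the phase t ((1 - \<delta>)^m - c)
  \<open>Y N\<close> remains; this is small when \<open>c\<close> is close to (1 -
  \<delta>)^m.\<close>

lemma walk_increment_char:
  assumes A: "adapted N (\<lambda>\<omega>. \<omega> \<in> A)" and \<delta>1: "\<delta> \<le> 1" and t: "t\<^sup>2 * \<delta> \<le> 1"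
  shows "cmod ((CLINT \<omega>|M. indicator A \<omega> * iexp (t * (Y (N + m) \<omega> - c * Y N \<omega>)))
      - of_real (measure M (A \<inter> space M) * (\<Prod>k<m. 1 - t\<^sup>2 * (1 - \<delta>) ^ (2 * k) * \<delta>)))
    \<le> real m * (t\<^sup>2 * \<delta>\<^sup>2 * ((proj x)\<^sup>2 + 2 * \<delta> * real (N + m)) / 2 + 4 * \<kappa> * \<bar>t\<bar> ^ 3 * \<delta> / 3)
      + \<bar>t\<bar> * \<bar>(1 - \<delta>) ^ m - c\<bar> * (1 + (proj x)\<^sup>2 + 2 * \<delta> * real N)"
proof -
  define G where "G \<omega> = indicator A \<omega> * iexp (- (t * c * Y N \<omega>))" for \<omega>
  \<comment> \<open>The expectation with \<open>j\<close> steps removed: \<open>D 0\<close> is the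
    quantity sought, and \<open>D m\<close> involves time \<open>N\<close> only.\<close>
  define D where "D j = (CLINT \<omega>|M. G \<omega> * iexp (t * (1 - \<delta>) ^ j * Y (N + m - j) \<omega>))" for j
  define a where "a k = 1 - t\<^sup>2 * (1 - \<delta>) ^ (2 * k) * \<delta>" for k
  define err where "err = t\<^sup>2 * \<delta>\<^sup>2 * ((proj x)\<^sup>2 + 2 * \<delta> * real (N + m)) / 2 + 4 * \<kappa> * \<bar>t\<bar> ^ 3 * \<delta> / 3"
  have adG: "adapted N G"
    unfolding G_def indicator_def
    by (rule adapted_comp2[OF A adapted_Y[OF order_refl], where f="\<lambda>b y. of_bool b * iexp
        (- (t * c * y))"])
  have G1: "cmod (G \<omega>) \<le> 1" for \<omega> by (simp add: G_def norm_mult indicator_def)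
  have pow: "0 \<le> (1 - \<delta>) ^ j" "(1 - \<delta>) ^ j \<le> 1" for j
    using \<delta>1 \<delta>_pos by (auto intro: power_le_one)
  \<comment> \<open>The two smallness assumptions put all factors into [0, 1], so the errors of the
    single steps add up without being amplified.\<close>
  have a01: "0 \<le> a k" "a k \<le> 1" for k
  proof -
    have "(t\<^sup>2 * \<delta>) * (1 - \<delta>) ^ (2 * k) \<le> 1 * 1" using t pow \<delta>_pos by (intro mult_mono) auto
    moreover have "0 \<le> (t\<^sup>2 * \<delta>) * (1 - \<delta>) ^ (2 * k)" using pow \<delta>_pos by simp
    ultimately show "0 \<le> a k" "a k \<le> 1" by (simp_all add: a_def mult_ac)
  qed
  have step: "cmod (D j - of_real (a j) * D (Suc j)) \<le> err" if j: "j < m" for j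
  proof -
    define \<mu> where "\<mu> = t * (1 - \<delta>) ^ j"
    define n where "n = N + m - Suc j"
    have n: "N \<le> n" "N + m - j = Suc n" "n \<le> N + m" using j by (auto simp: n_def)
    have \<mu>: "\<bar>\<mu>\<bar> \<le> \<bar>t\<bar>" using pow[of j] by (simp add: \<mu>_def abs_mult mult_left_le)
    have \<mu>2: "\<mu>\<^sup>2 \<le> t\<^sup>2" using \<mu> abs_le_square_iff by blast
    have "cmod (D j - of_real (1 - \<mu>\<^sup>2 * \<delta>) * D (Suc j)) \<le> \<mu>\<^sup>2 * \<delta>\<^sup>2 * ((proj x)\<^sup>2 + 2 * \<delta> * real n) / 2
        + 4 * \<kappa> * \<bar>\<mu>\<bar> ^ 3 * \<delta> / 3"
    proof -
      have e1: "D j = (CLINT \<omega>|M. G \<omega> * iexp (\<mu> * Y (Suc n) \<omega>))" unfolding D_def n(2) \<mu>_def ..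
      have e2: "D (Suc j) = (CLINT \<omega>|M. G \<omega> * iexp (\<mu> * (1 - \<delta>) * Y n \<omega>))"
        unfolding D_def n_def[symmetric] \<mu>_def by (simp only: power_Suc mult_ac)
      show ?thesis unfolding e1 e2 by (rule char_step[OF adapted_mono[OF adG n(1)] G1])
    qed
    also have "\<mu>\<^sup>2 * \<delta>\<^sup>2 * ((proj x)\<^sup>2 + 2 * \<delta> * real n) \<le> t\<^sup>2 * \<delta>\<^sup>2 * ((proj x)\<^sup>2 + 2 * \<delta> * real (N
        + m))"
      using \<mu>2 n(3) \<delta>_pos by (intro mult_mono add_left_mono mult_right_mono mult_left_mono) auto
    also have "4 * \<kappa> * \<bar>\<mu>\<bar> ^ 3 * \<delta> \<le> 4 * \<kappa> * \<bar>t\<bar> ^ 3 * \<delta>"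
      using \<mu> kappa_nonneg \<delta>_pos by (intro mult_right_mono mult_left_mono power_mono) auto
    finally have "cmod (D j - of_real (1 - \<mu>\<^sup>2 * \<delta>) * D (Suc j)) \<le> err" by (simp add: err_def)
    moreover have "1 - \<mu>\<^sup>2 * \<delta> = a j" by (simp add: a_def \<mu>_def power_mult_distrib power_mult[symmetric]
        mult.commute)
    ultimately show ?thesis by simp
  qed
  have iter: "j \<le> m \<Longrightarrow> cmod (D 0 - of_real (\<Prod>k<j. a k) * D j) \<le> real j * err" for j
  proof (induction j)
    case 0
    then show ?case by simp
  next
    case (Suc j)
    have P: "0 \<le> (\<Prod>k<j. a k)" "(\<Prod>k<j. a k) \<le> 1" using a01 by (auto intro: prod_nonneg prod_le_1)
    have "D 0 - of_real (\<Prod>k<Suc j. a k) * D (Suc j) = (D 0 - of_real (\<Prod>k<j. a k) * D j)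
        + of_real (\<Prod>k<j. a k) * (D j - of_real (a j) * D (Suc j))"
      by (simp add: algebra_simps)
    also have "cmod \<dots> \<le> real j * err + 1 * err"
    proof (intro order_trans[OF norm_triangle_ineq] add_mono)
      show "cmod (D 0 - of_real (\<Prod>k<j. a k) * D j) \<le> real j * err" using Suc by simp
      show "cmod (of_real (\<Prod>k<j. a k) * (D j - of_real (a j) * D (Suc j))) \<le> 1 * err"
        unfolding norm_mult norm_of_real using P step[of j] Suc.prems by (intro mult_mono) auto
    qed
    finally show ?case by (simp add: algebra_simps)
  qed
  define Pr where "Pr = (\<Prod>k<m. a k)"
  have Pr: "0 \<le> Pr" "Pr \<le> 1" using a01 by (auto simp: Pr_def intro: prod_nonneg prod_le_1)
  have iA: "integrable M (\<lambda>\<omega>. indicator A \<omega> :: complex)"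
    unfolding indicator_def by (rule adapted_integrable[OF adapted_comp[OF A, where f=of_bool]])
  have intA: "(CLINT \<omega>|M. indicator A \<omega>) = of_real (measure M (A \<inter> space M))"
  proof -
    have "{\<omega> \<in> space M. \<omega> \<in> A} \<in> events" by (rule adapted_event[OF A])
    moreover have "{\<omega> \<in> space M. \<omega> \<in> A} = A \<inter> space M" by auto
    ultimately have ev: "A \<inter> space M \<in> events" by simp
    have "(CLINT \<omega>|M. indicator A \<omega>) = (CLINT \<omega>|M. of_real (indicat_real (A \<inter> space M) \<omega>))"
      by (intro Bochner_Integration.integral_cong) (auto simp: indicator_def)
    also have "\<dots> = of_real (expectation (indicat_real (A \<inter> space M)))"
        by (rule integral_complex_of_real)
    also have "expectation (indicat_real (A \<inter> space M)) = measure M (A \<inter> space M)" by simp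
    finally show ?thesis .
  qed
  have Dm: "cmod (D m - of_real (measure M (A \<inter> space M))) \<le> \<bar>t\<bar> * \<bar>(1 - \<delta>) ^ m - c\<bar> * (1 + (proj x)\<^sup>2
      + 2 * \<delta> * real N)"
  proof -
    define q where "q = t * ((1 - \<delta>) ^ m - c)"
    have Dm_eq: "D m = (CLINT \<omega>|M. indicator A \<omega> * iexp (q * Y N \<omega>))"
      unfolding D_def G_def
      by (intro Bochner_Integration.integral_cong refl)
         (simp add: q_def algebra_simps mult_exp_exp[symmetric] flip: exp_add)
    have adq: "adapted N (\<lambda>\<omega>. indicator A \<omega> * iexp (q * Y N \<omega>))"
      unfolding indicator_def
      by (rule adapted_comp2[OF A adapted_Y[OF order_refl], where f="\<lambda>b y. of_bool b * iexp (q * y)"])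
    have iY: "integrable M (\<lambda>\<omega>. (Y N \<omega>)\<^sup>2)"
      by (rule adapted_integrable[OF adapted_comp[OF adapted_Y[OF order_refl], where f="\<lambda>y. y\<^sup>2"]])
    have "D m - of_real (measure M (A \<inter> space M)) = (CLINT \<omega>|M. indicator A \<omega> * iexp (q * Y N \<omega>)
        - indicator A \<omega>)"
      unfolding Dm_eq intA[symmetric] using adapted_integrable[OF adq] iA by simp
    also have "cmod \<dots> \<le> expectation (\<lambda>\<omega>. cmod (indicator A \<omega> * iexp (q * Y N \<omega>) - indicator A \<omega>))"
      by (rule integral_norm_bound)
    also have "\<dots> \<le> expectation (\<lambda>\<omega>. \<bar>q\<bar> * (1 + (Y N \<omega>)\<^sup>2))"
    proof (rule integral_mono)
      show "integrable M (\<lambda>\<omega>. cmod (indicator A \<omega> * iexp (q * Y N \<omega>) - indicator A \<omega>))"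
        using adapted_integrable[OF adq] iA by auto
      show "integrable M (\<lambda>\<omega>. \<bar>q\<bar> * (1 + (Y N \<omega>)\<^sup>2))" using iY by auto
      fix \<omega>
      have "cmod (indicator A \<omega> * iexp (q * Y N \<omega>) - indicator A \<omega>) \<le> cmod (iexp (q * Y N \<omega>) - 1)"
        by (simp add: indicator_def)
      also have "\<dots> \<le> \<bar>q * Y N \<omega>\<bar>" using iexp_approx1[of "q * Y N \<omega>" 0] by simp
      \<comment> \<open>The first absolute moment is dominated by 1 + y^2, for which a bound is at
        hand.\<close>
      also have "\<dots> \<le> \<bar>q\<bar> * (1 + (Y N \<omega>)\<^sup>2)"
      proof -
        have "0 \<le> (1 - \<bar>Y N \<omega>\<bar>)\<^sup>2" by simp
        then have "\<bar>Y N \<omega>\<bar> \<le> 1 + (Y N \<omega>)\<^sup>2" by (simp add: power2_diff)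
        then show ?thesis by (simp add: abs_mult mult_left_mono)
      qed
      finally show "cmod (indicator A \<omega> * iexp (q * Y N \<omega>) - indicator A \<omega>) \<le> \<bar>q\<bar> * (1 + (Y N \<omega>)\<^sup>2)" .
    qed
    also have "\<dots> = \<bar>q\<bar> * (1 + expectation (\<lambda>\<omega>. (Y N \<omega>)\<^sup>2))" using iY by (simp add: prob_space)
    also have "\<dots> \<le> \<bar>q\<bar> * (1 + ((proj x)\<^sup>2 + 2 * \<delta> * real N))"
      by (intro mult_left_mono add_left_mono Y_second_moment) auto
    finally show ?thesis by (simp add: q_def abs_mult add.assoc)
  qed
  have D0: "D 0 = (CLINT \<omega>|M. indicator A \<omega> * iexp (t * (Y (N + m) \<omega> - c * Y N \<omega>)))"
    unfolding D_def G_def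
    by (intro Bochner_Integration.integral_cong refl) (simp add: algebra_simps flip: exp_add)
  have "D 0 - of_real (measure M (A \<inter> space M) * Pr) = (D 0 - of_real Pr * D m) + of_real Pr * (D m
      - of_real (measure M (A \<inter> space M)))"
    by (simp add: algebra_simps)
  also have "cmod \<dots> \<le> real m * err + 1 * (\<bar>t\<bar> * \<bar>(1 - \<delta>) ^ m - c\<bar> * (1 + (proj x)\<^sup>2 + 2 * \<delta> * real N))"
  proof (intro order_trans[OF norm_triangle_ineq] add_mono)
    show "cmod (D 0 - of_real Pr * D m) \<le> real m * err" using iter[of m] by (simp add: Pr_def)
    show "cmod (of_real Pr * (D m - of_real (measure M (A \<inter> space M)))) \<le> 1 * (\<bar>t\<bar> * \<bar>(1 - \<delta>) ^ m
        - c\<bar> * (1 + (proj x)\<^sup>2 + 2 * \<delta> * real N))"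
      unfolding norm_mult norm_of_real using Pr Dm by (intro mult_mono) auto
  qed
  finally show ?thesis unfolding D0 Pr_def a_def err_def by simp
qed

end

section \<open>The walk in continuous time\<close>

lemma step_path_cadlag:
  fixes y :: "nat \<Rightarrow> real"
  assumes "0 < \<delta>"
  shows "(\<lambda>t\<in>{0..}. y (nat \<lfloor>t / \<delta>\<rfloor>)) \<in> cadlag_paths"
  unfolding cadlag_paths_def
proof (intro CollectI conjI allI impI)
  let ?x = "\<lambda>t\<in>{0..}. y (nat \<lfloor>t / \<delta>\<rfloor>)"
  fix t :: real assume t: "0 \<le> t"
  have fl: "t < (of_int \<lfloor>t / \<delta>\<rfloor> + 1) * \<delta>" "of_int \<lfloor>t / \<delta>\<rfloor> * \<delta> \<le> t"
    using assms by (simp_all add: pos_divide_less_eq[symmetric] pos_le_divide_eq[symmetric])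
  have "\<forall>\<^sub>F s in at_right t. s \<in> {t<..<(of_int \<lfloor>t / \<delta>\<rfloor> + 1) * \<delta>}"
    by (rule eventually_at_right_real[OF fl(1)])
  then have "\<forall>\<^sub>F s in at_right t. ?x s = ?x t"
  proof eventually_elim
    case (elim s)
    then have "\<lfloor>s / \<delta>\<rfloor> = \<lfloor>t / \<delta>\<rfloor>"
      using fl(2) assms by (intro floor_unique) (auto simp: pos_divide_less_eq pos_le_divide_eq)
    then show ?case using elim t by simp
  qed
  then show "(?x \<longlongrightarrow> ?x t) (at_right t)" by (rule tendsto_eventually)
next
  let ?x = "\<lambda>t\<in>{0..}. y (nat \<lfloor>t / \<delta>\<rfloor>)"
  fix t :: real assume t: "0 < t"
  \<comment> \<open>The index just before \<open>t\<close>. It differs from the floor precisely when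
    \<open>t\<close> is a multiple of \<delta>, that is, at a possible jump.\<close>
  define m where "m = \<lceil>t / \<delta>\<rceil> - 1"
  have "0 < \<lceil>t / \<delta>\<rceil>" using t assms by simp
  then have m: "0 \<le> m" by (simp add: m_def)
  have ce: "of_int m < t / \<delta>" "t / \<delta> \<le> of_int m + 1" by (simp_all add: m_def) linarith+
  then have mt: "of_int m * \<delta> < t" using assms by (simp add: pos_less_divide_eq)
  have "\<forall>\<^sub>F s in at_left t. s \<in> {of_int m * \<delta><..<t}"
    by (rule eventually_at_left_real[OF mt])
  then have "\<forall>\<^sub>F s in at_left t. ?x s = y (nat m)"
  proof eventually_elim
    case (elim s)
    have "s / \<delta> < t / \<delta>" using elim assms by (simp add: divide_strict_right_mono)
    then have "\<lfloor>s / \<delta>\<rfloor> = m"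
      using elim ce(2) assms by (intro floor_unique) (auto simp: pos_le_divide_eq)
    moreover have "0 \<le> s"
    proof -
      have "0 \<le> of_int m * \<delta>" using m assms by simp
      then show ?thesis using elim by simp
    qed
    ultimately show ?case by simp
  qed
  then show "\<exists>l. (?x \<longlongrightarrow> l) (at_left t)" using tendsto_eventually by blast
qed auto

context lazy_walk
begin

definition clock :: "real \<Rightarrow> nat" where
  "clock t = nat \<lfloor>t / \<delta>\<rfloor>"

definition Yt :: "real \<Rightarrow> 'a \<Rightarrow> real" where
  "Yt t \<omega> = Y (clock t) \<omega>"

lemma Yt_eq: "Yt t \<omega> = (\<Sum>i<d. \<theta> i * lnnrw_at d p X t \<omega> i)"
  by (simp add: Yt_def Y_def proj_def lnnrw_at_def clock_def \<delta>_def)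

lemma clock_mono: "s \<le> t \<Longrightarrow> clock s \<le> clock t"
  unfolding clock_def using \<delta>_pos by (intro nat_mono floor_mono divide_right_mono) auto

lemma clock_bounds:
  assumes "0 \<le> t"
  shows "\<delta> * real (clock t) \<le> t" "t < \<delta> * real (clock t) + \<delta>"
proof -
  have "0 \<le> t / \<delta>" using assms \<delta>_pos by simp
  then have "real (clock t) \<le> t / \<delta>" "t / \<delta> < real (clock t) + 1" unfolding clock_def by linarith+
  then show "\<delta> * real (clock t) \<le> t" "t < \<delta> * real (clock t) + \<delta>"
    using \<delta>_pos by (simp_all add: field_simps)
qed

lemma Yt_measurable: "Yt t \<in> borel_measurable M"
  unfolding Yt_def[abs_def] by (rule adapted_measurable[OF adapted_Y[OF order_refl]])

text \<open>An envelope with horizon \<open>m\<close> sees the walk only up to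
  \<open>clock (real m)\<close>, so it is adapted and hence measurable.\<close>

lemma Yt_path_measurable: "(\<lambda>\<omega>. \<lambda>t\<in>{0..}. Yt t \<omega>) \<in> M \<rightarrow>\<^sub>M borel_of_topology skorokhod"
proof (rule path_measurableI)
  show "(\<lambda>t\<in>{0..}. Yt t \<omega>) \<in> cadlag_paths" for \<omega>
    unfolding Yt_def clock_def by (rule step_path_cadlag[OF \<delta>_pos, of "\<lambda>n. Y n \<omega>"])
  fix f :: "(real \<Rightarrow> real) \<Rightarrow> real" and m assume f: "\<forall>y\<in>cadlag_paths. 0 \<le> f y"
  have "adapted (clock (real m)) (\<lambda>\<omega>. envelope f m (\<lambda>t. Yt t \<omega>))"
  proof (rule adaptedI, rule envelope_cong[OF f])
    fix \<omega> \<omega>' t assume w: "\<omega> \<in> space M" "\<omega>' \<in> space M" "\<And>k. k \<le> clock (real m) \<Longrightarrow> X k \<omega> = X k \<omega>'"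
        and t: "t \<in> {0..real m}"
    show "Yt t \<omega> = Yt t \<omega>'"
      unfolding Yt_def Y_def using w(3)[OF clock_mono[of t "real m"]] t by simp
  qed
  then show "(\<lambda>\<omega>. envelope f m (\<lambda>t. Yt t \<omega>)) \<in> borel_measurable M" by (rule adapted_measurable)
qed

text \<open>A union bound over the intervals between grid points, including the one starting at
  \<open>T\<close> itself. Here \<open>q\<close> bounds the walk time spent in one interval, and
  \<open>e / 2\<close> compensates the factor 2 in \<open>oscillation_bound\<close>.\<close>

lemma modulus_event:
  assumes k: "0 < k" and e: "0 < e"
  defines "q \<equiv> 1 / real k + \<delta>"
  shows "\<exists>A\<in>events. prob A \<le> real (k * T + 1) * ((32 * q\<^sup>2 + 96 * \<kappa>\<^sup>2 * q) / (e / 2) ^ 4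
      + q\<^sup>2 * ((proj x)\<^sup>2 + 2 * (real T + 1)) / (e / 2)\<^sup>2)
    \<and> (\<forall>\<omega>\<in>space M - A. \<forall>t\<in>{0..real T}. \<bar>Yt t \<omega> - sampled k (\<lambda>t. Yt t \<omega>) t\<bar> \<le> e)"
proof -
  define N where "N j = clock (real j / real k)" for j
  define m where "m j = N (Suc j) - N j" for j
  define E where "E j = {\<omega> \<in> space M. \<exists>i\<le>m j. 2 * (e / 2) < \<bar>Y (N j + i) \<omega> - Y (N j) \<omega>\<bar>}" for j
  have N_mono: "N j \<le> N (Suc j)" for j
    unfolding N_def by (intro clock_mono divide_right_mono) auto
  then have Nm: "N j + m j = N (Suc j)" for j by (simp add: m_def)
  have q: "0 < q" using \<delta>_pos k by (simp add: q_def add_pos_pos)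
  have E: "E j \<in> events" for j
  proof -
    have "adapted (N j + m j) (\<lambda>\<omega>. \<not> (\<forall>i\<in>{..m j}. \<not> 2 * (e / 2) < \<bar>Y (N j + i) \<omega> - Y (N j) \<omega>\<bar>))"
      by (intro adapted_comp[where f=Not] adapted_All adapted_comp2[where f="\<lambda>a b. \<not> 2 * (e / 2)
          < \<bar>a - b\<bar>"] adapted_Y) auto
    note adapted_event[OF this]
    moreover have "{\<omega> \<in> space M. \<not> (\<forall>i\<in>{..m j}. \<not> 2 * (e / 2) < \<bar>Y (N j + i) \<omega> - Y (N j) \<omega>\<bar>)} = E j"
      unfolding E_def by blast
    ultimately show ?thesis by (simp only:)
  qed
  have PE: "prob (E j) \<le> (32 * q\<^sup>2 + 96 * \<kappa>\<^sup>2 * q) / (e / 2) ^ 4 + q\<^sup>2 * ((proj x)\<^sup>2 + 2 * (real T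
      + 1)) / (e / 2)\<^sup>2"
    if j: "j \<le> k * T" for j
  proof -
    have m0: "0 \<le> \<delta> * real (m j)" using \<delta>_pos by simp
    \<comment> \<open>Rounding down to a clock pulse loses less than \<delta>, which explains the
      extra \<delta> in \<open>q\<close>.\<close>
    have mq: "\<delta> * real (m j) \<le> q"
    proof -
      have "\<delta> * real (N (Suc j)) \<le> real (Suc j) / real k" "real j / real k < \<delta> * real (N j) + \<delta>"
        using clock_bounds[of "real (Suc j) / real k"] clock_bounds[of "real j / real k"]
            by (auto simp: N_def)
      moreover have "real (N (Suc j)) = real (N j) + real (m j)" using Nm[of j] by (metis of_nat_add)
      moreover have "real (Suc j) / real k = real j / real k + 1 / real k"
          by (simp add: add_divide_distrib)
      ultimately show ?thesis by (simp add: q_def algebra_simps)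
    qed
    \<comment> \<open>The last interval ends at \<open>real T + 1 / real k\<close>, which is at most
      \<open>real T + 1\<close>.\<close>
    have T: "\<delta> * real (N j + m j) \<le> real T + 1"
    proof -
      have "\<delta> * real (N (Suc j)) \<le> real (Suc j) / real k"
        using clock_bounds[of "real (Suc j) / real k"] by (simp add: N_def)
      also have "\<dots> \<le> real (k * T + k) / real k"
      proof (intro divide_right_mono)
        have "Suc j \<le> k * T + k" using j k by simp
        then show "real (Suc j) \<le> real (k * T + k)" by (simp only: of_nat_le_iff)
      qed simp
      also have "\<dots> = real T + 1" using k by (simp add: field_simps)
      finally show ?thesis by (simp add: Nm)
    qed
    have "prob (E j) \<le> (32 * (\<delta> * real (m j))\<^sup>2 + 96 * \<kappa>\<^sup>2 * (\<delta> * real (m j))) / (e / 2) ^ 4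
        + (\<delta> * real (m j))\<^sup>2 * ((proj x)\<^sup>2 + 2 * \<delta> * real (N j + m j)) / (e / 2)\<^sup>2"
      unfolding E_def by (rule oscillation_bound) (use e in simp)
    also have "\<dots> \<le> (32 * q\<^sup>2 + 96 * \<kappa>\<^sup>2 * q) / (e / 2) ^ 4 + q\<^sup>2 * ((proj x)\<^sup>2 + 2 * (real T
        + 1)) / (e / 2)\<^sup>2"
    proof (intro add_mono divide_right_mono)
      show "32 * (\<delta> * real (m j))\<^sup>2 \<le> 32 * q\<^sup>2" using mq m0 by (intro mult_left_mono power_mono) auto
      show "96 * \<kappa>\<^sup>2 * (\<delta> * real (m j)) \<le> 96 * \<kappa>\<^sup>2 * q" using mq by (intro mult_left_mono) auto
      show "(\<delta> * real (m j))\<^sup>2 * ((proj x)\<^sup>2 + 2 * \<delta> * real (N j + m j))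
          \<le> q\<^sup>2 * ((proj x)\<^sup>2 + 2 * (real T + 1))"
      proof (rule mult_mono)
        show "(proj x)\<^sup>2 + 2 * \<delta> * real (N j + m j) \<le> (proj x)\<^sup>2 + 2 * (real T + 1)"
          unfolding mult.assoc by (intro add_left_mono mult_left_mono T) simp
        show "(\<delta> * real (m j))\<^sup>2 \<le> q\<^sup>2" using mq m0 by (intro power_mono) auto
        show "0 \<le> (proj x)\<^sup>2 + 2 * \<delta> * real (N j + m j)" using \<delta>_pos by (intro add_nonneg_nonneg) auto
      qed simp
    qed (use e in auto)
    finally show ?thesis .
  qed
  show ?thesis
  proof (intro bexI[of _ "\<Union>j\<in>{..k * T}. E j"] conjI ballI)
    show "(\<Union>j\<in>{..k * T}. E j) \<in> events" using E by auto
    have "prob (\<Union>j\<in>{..k * T}. E j) \<le> (\<Sum>j\<in>{..k * T}. prob (E j))"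
      using E by (intro finite_measure_subadditive_finite) auto
    also have "\<dots> \<le> (\<Sum>j\<in>{..k * T}. (32 * q\<^sup>2 + 96 * \<kappa>\<^sup>2 * q) / (e / 2) ^ 4 + q\<^sup>2 * ((proj x)\<^sup>2
        + 2 * (real T + 1)) / (e / 2)\<^sup>2)"
      by (intro sum_mono PE) auto
    finally show "prob (\<Union>j\<in>{..k * T}. E j) \<le> real (k * T + 1) * ((32 * q\<^sup>2 + 96 * \<kappa>\<^sup>2 * q) / (e / 2) ^ 4
        + q\<^sup>2 * ((proj x)\<^sup>2 + 2 * (real T + 1)) / (e / 2)\<^sup>2)"
      by (simp only: sum_constant card_atMost Suc_eq_plus1)
    fix \<omega> t assume w: "\<omega> \<in> space M - (\<Union>j\<in>{..k * T}. E j)" and t: "t \<in> {0..real T}"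
    define j where "j = nat \<lfloor>real k * t\<rfloor>"
    have j: "j \<le> k * T" using sampled_index_le[of t T k] t by (simp add: j_def)
    have jt: "real j / real k \<le> t" "t \<le> real (Suc j) / real k"
      using sampled_time[OF k, of t] t by (auto simp: j_def add_divide_distrib)
    have "N j \<le> clock t" "clock t \<le> N (Suc j)"
      unfolding N_def using jt by (auto intro: clock_mono)
    then have "clock t = N j + (clock t - N j)" "clock t - N j \<le> m j" by (auto simp: m_def)
    moreover have "\<bar>Y (N j + i) \<omega> - Y (N j) \<omega>\<bar> \<le> e" if "i \<le> m j" for i
      using w j that by (force simp: E_def not_less)
    ultimately have "\<bar>Y (clock t) \<omega> - Y (N j) \<omega>\<bar> \<le> e" by metis
    then show "\<bar>Yt t \<omega> - sampled k (\<lambda>t. Yt t \<omega>) t\<bar> \<le> e"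
      by (simp add: Yt_def sampled_def N_def j_def)
  qed
qed

end

section \<open>The scaling limit\<close>

text \<open>After taking logarithms, ln(1 - \<delta>) lies between -\<delta> - 2 \<delta>^2 and
  -\<delta> once \<delta> is below 1/2.\<close>

lemma tendsto_one_minus_power:
  fixes \<delta> :: "nat \<Rightarrow> real" and m :: "nat \<Rightarrow> nat"
  assumes pos: "\<And>n. 0 < \<delta> n" and \<delta>: "\<delta> \<longlonglongrightarrow> 0" and m: "(\<lambda>n. \<delta> n * real (m n)) \<longlonglongrightarrow> h"
  shows "(\<lambda>n. (1 - \<delta> n) ^ m n) \<longlonglongrightarrow> exp (- h)"
proof -
  have ev: "\<forall>\<^sub>F n in sequentially. \<delta> n < 1 / 2" using \<delta> by (rule order_tendstoD) simp
  have "(\<lambda>n. real (m n) * ln (1 - \<delta> n)) \<longlonglongrightarrow> - h"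
  proof (rule real_tendsto_sandwich)
    show "\<forall>\<^sub>F n in sequentially. - (\<delta> n * real (m n)) - 2 * \<delta> n * (\<delta> n * real (m n))
        \<le> real (m n) * ln (1 - \<delta> n)"
      using ev
    proof eventually_elim
      case (elim n)
      have "real (m n) * (- \<delta> n - 2 * (\<delta> n)\<^sup>2) \<le> real (m n) * ln (1 - \<delta> n)"
        using elim pos[of n] by (intro mult_left_mono ln_one_minus_pos_lower_bound) auto
      then show ?case by (simp add: algebra_simps power2_eq_square)
    qed
    show "\<forall>\<^sub>F n in sequentially. real (m n) * ln (1 - \<delta> n) \<le> - (\<delta> n * real (m n))"
      using ev
    proof eventually_elim
      case (elim n)
      have "real (m n) * ln (1 - \<delta> n) \<le> real (m n) * (- \<delta> n)"
        using elim pos[of n] by (intro mult_left_mono ln_one_minus_pos_upper_bound) auto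
      then show ?case by (simp add: mult.commute)
    qed
    have "(\<lambda>n. - (\<delta> n * real (m n)) - 2 * \<delta> n * (\<delta> n * real (m n))) \<longlonglongrightarrow> - h - 2 * 0 * h"
      by (intro tendsto_intros m \<delta>)
    then show "(\<lambda>n. - (\<delta> n * real (m n)) - 2 * \<delta> n * (\<delta> n * real (m n))) \<longlonglongrightarrow> - h" by simp
    show "(\<lambda>n. - (\<delta> n * real (m n))) \<longlonglongrightarrow> - h" by (intro tendsto_intros m)
  qed
  then have "(\<lambda>n. exp (real (m n) * ln (1 - \<delta> n))) \<longlonglongrightarrow> exp (- h)" by (rule tendsto_exp)
  moreover have "\<forall>\<^sub>F n in sequentially. exp (real (m n) * ln (1 - \<delta> n)) = (1 - \<delta> n) ^ m n"
    using ev by eventually_elim (simp add: exp_of_nat_mult)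
  ultimately show ?thesis by (rule Lim_transform_eventually)
qed

text \<open>The subtracted terms form a geometric series whose sum converges to the exponent.
  Replacing each factor 1 - a by exp(-a) costs at most (t^2 \<delta>)^2, hence t^4 \<delta>
  (\<delta> m) in total, which tends to 0.\<close>

lemma tendsto_prod_variance:
  fixes \<delta> :: "nat \<Rightarrow> real" and m :: "nat \<Rightarrow> nat"
  assumes pos: "\<And>n. 0 < \<delta> n" and \<delta>: "\<delta> \<longlonglongrightarrow> 0" and m: "(\<lambda>n. \<delta> n * real (m n)) \<longlonglongrightarrow> h"
  shows "(\<lambda>n. \<Prod>k<m n. 1 - t\<^sup>2 * (1 - \<delta> n) ^ (2 * k) * \<delta> n) \<longlonglongrightarrow> exp (- (t\<^sup>2 * (1 - exp (- 2 * h)) / 2))"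
proof -
  define a where "a n k = t\<^sup>2 * (1 - \<delta> n) ^ (2 * k) * \<delta> n" for n k
  have ev1: "\<forall>\<^sub>F n in sequentially. \<delta> n < 1 / 2" using \<delta> by (rule order_tendstoD) simp
  have "(\<lambda>n. t\<^sup>2 * \<delta> n) \<longlonglongrightarrow> t\<^sup>2 * 0" by (intro tendsto_intros \<delta>)
  then have ev2: "\<forall>\<^sub>F n in sequentially. t\<^sup>2 * \<delta> n < 1" by (rule order_tendstoD) simp
  have sum: "(\<lambda>n. \<Sum>k<m n. a n k) \<longlonglongrightarrow> t\<^sup>2 * (1 - exp (- 2 * h)) / 2"
  proof -
    have "(\<lambda>n. t\<^sup>2 * (1 - ((1 - \<delta> n) ^ m n)\<^sup>2) / (2 - \<delta> n)) \<longlonglongrightarrow> t\<^sup>2 * (1 - (exp (- h))\<^sup>2) / (2 - 0)"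
      by (intro tendsto_intros tendsto_one_minus_power assms) simp
    moreover have "(exp (- h))\<^sup>2 = exp (- 2 * h)" by (simp add: exp_double[symmetric])
    ultimately have "(\<lambda>n. t\<^sup>2 * (1 - ((1 - \<delta> n) ^ m n)\<^sup>2) / (2 - \<delta> n)) \<longlonglongrightarrow> t\<^sup>2 * (1 - exp (- 2 * h)) / 2"
        by simp
    moreover have "\<forall>\<^sub>F n in sequentially. t\<^sup>2 * (1 - ((1 - \<delta> n) ^ m n)\<^sup>2) / (2 - \<delta> n) = (\<Sum>k<m n. a n k)"
      using ev1
    proof eventually_elim
      case (elim n)
      \<comment> \<open>The denominator of the geometric sum: its factor \<delta> cancels the one in
        front, leaving 2 - \<delta>, which tends to 2.\<close>
      have q: "(1 - \<delta> n)\<^sup>2 - 1 = - (\<delta> n * (2 - \<delta> n))" by (simp add: power2_eq_square algebra_simps)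
      have ne: "(1 - \<delta> n)\<^sup>2 \<noteq> 1"
      proof
        assume "(1 - \<delta> n)\<^sup>2 = 1"
        then have "\<delta> n * (2 - \<delta> n) = 0" using q by simp
        then show False using pos[of n] elim by simp
      qed
      have "(\<Sum>k<m n. a n k) = t\<^sup>2 * \<delta> n * (\<Sum>k<m n. ((1 - \<delta> n)\<^sup>2) ^ k)"
        unfolding a_def power_mult sum_distrib_left by (intro sum.cong refl) (simp only: mult_ac)
      also have "\<dots> = t\<^sup>2 * \<delta> n * ((((1 - \<delta> n)\<^sup>2) ^ m n - 1) / ((1 - \<delta> n)\<^sup>2 - 1))"
        by (simp only: geometric_sum[OF ne])
      also have "((1 - \<delta> n)\<^sup>2) ^ m n = ((1 - \<delta> n) ^ m n)\<^sup>2"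
        by (simp add: power_mult[symmetric] mult.commute)
      also have "t\<^sup>2 * \<delta> n * ((((1 - \<delta> n) ^ m n)\<^sup>2 - 1) / ((1 - \<delta> n)\<^sup>2 - 1))
          = t\<^sup>2 * (1 - ((1 - \<delta> n) ^ m n)\<^sup>2) / (2 - \<delta> n)"
        unfolding q using pos[of n] elim by (simp add: divide_simps) (simp add: algebra_simps)
      finally show ?case by simp
    qed
    ultimately show ?thesis by (rule Lim_transform_eventually)
  qed
  have "(\<lambda>n. (\<Prod>k<m n. 1 - a n k) - exp (- (\<Sum>k<m n. a n k))) \<longlonglongrightarrow> 0"
  proof (rule tendsto_0_le[where K=1])
    have "(\<lambda>n. t ^ 4 * \<delta> n * (\<delta> n * real (m n))) \<longlonglongrightarrow> t ^ 4 * 0 * h" by (intro tendsto_intros m \<delta>)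
    then show "(\<lambda>n. t ^ 4 * \<delta> n * (\<delta> n * real (m n))) \<longlonglongrightarrow> 0" by simp
    show "\<forall>\<^sub>F n in sequentially. norm ((\<Prod>k<m n. 1 - a n k) - exp (- (\<Sum>k<m n. a n k)))
        \<le> norm (t ^ 4 * \<delta> n * (\<delta> n * real (m n))) * 1"
      using ev1 ev2
    proof eventually_elim
      case (elim n)
      have a: "0 \<le> a n k" "a n k \<le> t\<^sup>2 * \<delta> n" for k
      proof -
        have "0 \<le> (1 - \<delta> n) ^ (2 * k)" "(1 - \<delta> n) ^ (2 * k) \<le> 1"
          using elim pos[of n] by (auto intro: power_le_one)
        moreover have "0 \<le> t\<^sup>2 * \<delta> n" using pos[of n] by simp
        ultimately have "(t\<^sup>2 * \<delta> n) * (1 - \<delta> n) ^ (2 * k) \<le> (t\<^sup>2 * \<delta> n) * 1" "0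
            \<le> (t\<^sup>2 * \<delta> n) * (1 - \<delta> n) ^ (2 * k)"
          using mult_left_mono mult_nonneg_nonneg by blast+
        then show "0 \<le> a n k" "a n k \<le> t\<^sup>2 * \<delta> n" by (simp_all add: a_def mult_ac)
      qed
      have a1: "a n k \<le> 1" for k using a(2)[of k] elim(2) by simp
      \<comment> \<open>The upper bound exp(-z) \<le> 1 - z + z^2 follows from (1 + z)(1 - z + z^2)
        = 1 + z^3 and exp(z) \<ge> 1 + z.\<close>
      have quad: "\<bar>1 - a n k - exp (- a n k)\<bar> \<le> (t\<^sup>2 * \<delta> n)\<^sup>2" for k
      proof -
        define z where "z = a n k"
        have z: "0 \<le> z" using a by (simp add: z_def)
        have "1 - z \<le> exp (- z)" using exp_ge_add_one_self[of "- z"] by simp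
        moreover have "exp (- z) \<le> 1 - z + z\<^sup>2"
        proof -
          have "1 \<le> (1 + z) * (1 - z + z\<^sup>2)"
            using z by (simp add: algebra_simps power2_eq_square)
          also have "\<dots> \<le> exp z * (1 - z + z\<^sup>2)"
          proof (rule mult_right_mono[OF exp_ge_add_one_self])
            have "0 \<le> (1 - z)\<^sup>2 + z" using z by simp
            then show "0 \<le> 1 - z + z\<^sup>2" by (simp add: power2_eq_square algebra_simps)
          qed
          finally show ?thesis by (simp add: exp_minus field_simps)
        qed
        moreover have "z\<^sup>2 \<le> (t\<^sup>2 * \<delta> n)\<^sup>2" using a by (intro power_mono) (auto simp: z_def)
        ultimately show ?thesis unfolding z_def[symmetric] by linarith
      qed
      have "norm ((\<Prod>k<m n. 1 - a n k) - exp (- (\<Sum>k<m n. a n k))) = norm ((\<Prod>k<m n. 1 - a n k)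
          - (\<Prod>k<m n. exp (- a n k)))"
        by (simp add: exp_sum[symmetric] sum_negf)
      also have "\<dots> \<le> (\<Sum>k<m n. norm (1 - a n k - exp (- a n k)))"
        by (rule norm_prod_diff) (use a a1 in \<open>auto simp: abs_le_iff add_increasing\<close>)
      also have "\<dots> \<le> (\<Sum>k<m n. (t\<^sup>2 * \<delta> n)\<^sup>2)" using quad by (intro sum_mono) auto
      also have "\<dots> = t ^ 4 * \<delta> n * (\<delta> n * real (m n))"
        by (simp add: power2_eq_square power4_eq_xxxx algebra_simps)
      finally show ?case by (simp add: order_trans[OF _ abs_ge_self])
    qed
  qed
  then have "(\<lambda>n. ((\<Prod>k<m n. 1 - a n k) - exp (- (\<Sum>k<m n. a n k))) + exp (- (\<Sum>k<m n. a n k)))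
      \<longlonglongrightarrow> 0 + exp (- (t\<^sup>2 * (1 - exp (- 2 * h)) / 2))"
    by (intro tendsto_intros sum)
  then show ?thesis by (simp add: a_def)
qed

lemma isCont_cdf_std_normal: "isCont (cdf std_normal_distribution) z"
proof -
  interpret real_distribution std_normal_distribution by (rule real_dist_normal_dist)
  have "AE y in lborel. y \<in> {z} \<longrightarrow> ennreal (std_normal_density y) = 0"
    using AE_lborel_singleton[of z] by eventually_elim simp
  then have "{z} \<in> null_sets std_normal_distribution"
    by (subst null_sets_density_iff) auto
  then show ?thesis by (simp add: isCont_cdf measure_eq_0_null_sets)
qed

section \<open>From noises to grid values\<close>

fun autoregression :: "real \<Rightarrow> real \<Rightarrow> (nat \<Rightarrow> real) \<Rightarrow> nat \<Rightarrow> real" where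
  "autoregression c y w 0 = y"
| "autoregression c y w (Suc j) = c * autoregression c y w j + w j"

lemma autoregression_increments: "autoregression c (z 0) (\<lambda>i. z (Suc i) - c * z i) j = z j"
  by (induction j) auto

text \<open>A coefficient between 0 and 1 never amplifies earlier errors, so the constant is 1 for
  every \<open>j\<close>.\<close>

lemma autoregression_lipschitz:
  assumes "0 \<le> c" "c \<le> 1"
  shows "\<bar>autoregression c y w j - autoregression c y' w' j\<bar> \<le> \<bar>y - y'\<bar> + (\<Sum>i<j. \<bar>w i - w' i\<bar>)"
proof (induction j)
  case (Suc j)
  have "autoregression c y w (Suc j) - autoregression c y' w' (Suc j)
      = c * (autoregression c y w j - autoregression c y' w' j) + (w j - w' j)"
    by (simp add: algebra_simps)
  also have "\<bar>\<dots>\<bar> \<le> c * \<bar>autoregression c y w j - autoregression c y' w' j\<bar> + \<bar>w j - w' j\<bar>"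
    using abs_triangle_ineq[of "c * (autoregression c y w j - autoregression c y' w' j)" "w j
        - w' j"] assms
    by (simp add: abs_mult)
  also have "\<dots> \<le> 1 * \<bar>autoregression c y w j - autoregression c y' w' j\<bar> + \<bar>w j - w' j\<bar>"
    using assms by (intro add_right_mono mult_right_mono) auto
  also have "\<dots> \<le> \<bar>y - y'\<bar> + (\<Sum>i<Suc j. \<bar>w i - w' i\<bar>)" using Suc by simp
  finally show ?case .
qed simp

text \<open>The dimension is a sequence \<open>D\<close>, later instantiated with
  \<open>Suc\<close>, because \<open>lazy_walk\<close> requires a positive dimension for every
  index.\<close>

locale walk_limit = ou_process N U u for N :: "'b measure" and U u +
  fixes M :: "nat \<Rightarrow> 'a measure" and D :: "nat \<Rightarrow> nat" and p :: "nat \<Rightarrow> real" and x :: "nat \<Rightarrow> nat \<Rightarrow> real"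
    and X :: "nat \<Rightarrow> nat \<Rightarrow> 'a \<Rightarrow> nat \<Rightarrow> real" and \<theta> :: "nat \<Rightarrow> nat \<Rightarrow> real" and \<kappa> :: "nat \<Rightarrow> real"
  assumes W: "\<And>n. lazy_walk (M n) (D n) (p n) (x n) (X n) (\<theta> n) (\<kappa> n)"
    and \<delta>_lim: "(\<lambda>n. lazy_walk.\<delta> (D n) (p n)) \<longlonglongrightarrow> 0"
    and \<kappa>_lim: "\<kappa> \<longlonglongrightarrow> 0"
    and start_lim: "(\<lambda>n. lazy_walk.proj (D n) (\<theta> n) (x n)) \<longlonglongrightarrow> u"
begin

abbreviation "\<delta> n \<equiv> lazy_walk.\<delta> (D n) (p n)"
abbreviation "clock n \<equiv> lazy_walk.clock (D n) (p n)"
abbreviation "Y n \<equiv> lazy_walk.Y (D n) (X n) (\<theta> n)"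
abbreviation "Yt n \<equiv> lazy_walk.Yt (D n) (p n) (X n) (\<theta> n)"
abbreviation "start n \<equiv> lazy_walk.proj (D n) (\<theta> n) (x n)"

lemma M_prob: "prob_space (M n)"
  using W[of n] by (simp add: lazy_walk_def)

lemma clock_tendsto:
  assumes s: "0 \<le> s"
  shows "(\<lambda>n. \<delta> n * real (clock n s)) \<longlonglongrightarrow> s"
proof (rule real_tendsto_sandwich)
  show "\<forall>\<^sub>F n in sequentially. s - \<delta> n \<le> \<delta> n * real (clock n s)"
    using lazy_walk.clock_bounds(2)[OF W s] by (intro always_eventually allI) (simp add: less_imp_le
        algebra_simps)
  show "\<forall>\<^sub>F n in sequentially. \<delta> n * real (clock n s) \<le> s"
    using lazy_walk.clock_bounds(1)[OF W s] by (intro always_eventually allI)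
  show "(\<lambda>n. s - \<delta> n) \<longlonglongrightarrow> s" using tendsto_diff[OF tendsto_const \<delta>_lim, of s] by simp
qed simp

text \<open>Coefficient and standard deviation are those of the limit process, so walk and limit
  share one recursion. The gap between exp(-h) and the walk's own (1 - \<delta>)^m is treated as an
  error.\<close>

definition walk_noise :: "nat \<Rightarrow> nat \<Rightarrow> nat \<Rightarrow> 'a \<Rightarrow> real" where
  "walk_noise k n i \<omega> = (Yt n (real (Suc i) / real k) \<omega> - exp (- (1 / real k)) * Yt n (real i / real k)
      \<omega>)
     / sqrt (1 - exp (- 2 * (1 / real k)))"

definition ou_noise :: "nat \<Rightarrow> nat \<Rightarrow> 'b \<Rightarrow> real" where
  "ou_noise k i \<omega> = (U (real (Suc i) / real k) \<omega> - exp (- (1 / real k)) * U (real i / real k) \<omega>)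
     / sqrt (1 - exp (- 2 * (1 / real k)))"

lemma scaled_variance:
  assumes "0 < k"
  shows "0 < 1 - exp (- 2 * (1 / real k))"
    and "(t / sqrt (1 - exp (- 2 * (1 / real k))))\<^sup>2 * (1 - exp (- 2 * (1 / real k))) / 2 = t\<^sup>2 / 2"
proof -
  show *: "0 < 1 - exp (- 2 * (1 / real k))" using assms by simp
  show "(t / sqrt (1 - exp (- 2 * (1 / real k))))\<^sup>2 * (1 - exp (- 2 * (1 / real k))) / 2 = t\<^sup>2 / 2"
    using * by (simp only: power_divide real_sqrt_pow2[OF less_imp_le[OF *]]) simp
qed

lemma walk_noise_measurable: "walk_noise k n i \<in> borel_measurable (M n)"
  unfolding walk_noise_def[abs_def] using lazy_walk.Yt_measurable[OF W] by measurable

lemma ou_noise_measurable: "ou_noise k i \<in> borel_measurable N"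
  unfolding ou_noise_def[abs_def] by measurable

text \<open>\<open>walk_increment_char\<close> at frequency t / \<sigma>, with \<open>c\<close> =
  exp(-h) and the box event of the earlier noises as the event of the past. The normalisation makes
  the limiting product exp(-t^2/2).\<close>

lemma walk_noise_char:
  assumes k: "0 < k"
  shows "(\<lambda>n. (CLINT \<omega>|M n. indicator (box_event (M n) (walk_noise k n) i a b) \<omega> * iexp (t * walk_noise
      k n i \<omega>))
    - measure (M n) (box_event (M n) (walk_noise k n) i a b) * char std_normal_distribution t) \<longlonglongrightarrow> 0"
proof -
  define h where "h = 1 / real k"
  define \<sigma> where "\<sigma> = sqrt (1 - exp (- 2 * h))"
  define r where "r = t / \<sigma>"
  define A where "A n = box_event (M n) (walk_noise k n) i a b" for n
  define Q where "Q n = clock n (real i / real k)" for n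
  define m where "m n = clock n (real (Suc i) / real k) - Q n" for n
  define Pr where "Pr n = (\<Prod>j<m n. 1 - r\<^sup>2 * (1 - \<delta> n) ^ (2 * j) * \<delta> n)" for n
  have Qm: "Q n + m n = clock n (real (Suc i) / real k)" for n
    unfolding m_def Q_def using lazy_walk.clock_mono[OF W, of "real i / real k" "real (Suc i) / real k"
        n]
    by (simp add: divide_right_mono)
  have \<delta>_pos: "0 < \<delta> n" for n by (rule lazy_walk.\<delta>_pos[OF W])
  have Q_lim: "(\<lambda>n. \<delta> n * real (Q n)) \<longlonglongrightarrow> real i / real k"
    unfolding Q_def by (rule clock_tendsto) simp
  have Qm_lim: "(\<lambda>n. \<delta> n * real (Q n + m n)) \<longlonglongrightarrow> real (Suc i) / real k"
    unfolding Qm by (rule clock_tendsto) simp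
  have m_lim: "(\<lambda>n. \<delta> n * real (m n)) \<longlonglongrightarrow> h"
  proof -
    have "(\<lambda>n. \<delta> n * real (Q n + m n) - \<delta> n * real (Q n)) \<longlonglongrightarrow> real (Suc i) / real k - real i / real k"
      by (intro tendsto_diff Q_lim Qm_lim)
    then show ?thesis by (simp add: h_def algebra_simps diff_divide_distrib[symmetric])
  qed
  have sigma: "r\<^sup>2 * (1 - exp (- 2 * h)) / 2 = t\<^sup>2 / 2"
    unfolding r_def \<sigma>_def h_def by (rule scaled_variance(2)[OF k])
  have Pr_lim: "Pr \<longlonglongrightarrow> exp (- (t\<^sup>2 / 2))"
    using tendsto_prod_variance[OF \<delta>_pos \<delta>_lim m_lim, of r] unfolding Pr_def sigma .
  have pow_lim: "(\<lambda>n. (1 - \<delta> n) ^ m n) \<longlonglongrightarrow> exp (- h)"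
    by (rule tendsto_one_minus_power[OF \<delta>_pos \<delta>_lim m_lim])
  \<comment> \<open>The bound of \<open>walk_increment_char\<close>, regrouped so that the step
    counts occur only as \<delta> times a count, which converges to a time.\<close>
  define err where "err n = \<delta> n * real (m n) * (r\<^sup>2 * \<delta> n * ((start n)\<^sup>2 + 2 * (\<delta> n * real (Q n + m n)))
      / 2 + 4 * \<kappa> n * \<bar>r\<bar> ^ 3 / 3)
      + \<bar>r\<bar> * \<bar>(1 - \<delta> n) ^ m n - exp (- h)\<bar> * (1 + (start n)\<^sup>2 + 2 * (\<delta> n * real (Q n)))" for n
  have "err \<longlonglongrightarrow> h * (r\<^sup>2 * 0 * (u\<^sup>2 + 2 * (real (Suc i) / real k)) / 2 + 4 * 0 * \<bar>r\<bar> ^ 3 / 3)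
      + \<bar>r\<bar> * \<bar>exp (- h) - exp (- h)\<bar> * (1 + u\<^sup>2 + 2 * (real i / real k))"
    unfolding err_def[abs_def] by (intro tendsto_intros m_lim Q_lim Qm_lim \<delta>_lim \<kappa>_lim start_lim
        pow_lim) auto
  then have "err \<longlonglongrightarrow> 0" by simp
  moreover have "(\<lambda>n. \<bar>Pr n - exp (- (t\<^sup>2 / 2))\<bar>) \<longlonglongrightarrow> 0"
    using Pr_lim by (simp add: LIM_zero tendsto_rabs_zero)
  ultimately have bound_lim: "(\<lambda>n. err n + \<bar>Pr n - exp (- (t\<^sup>2 / 2))\<bar>) \<longlonglongrightarrow> 0"
    using tendsto_add[of err 0] by simp
  \<comment> \<open>These two facts are the smallness assumptions of
    \<open>walk_increment_char\<close>, valid for large \<open>n\<close>.\<close>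
  have ev1: "\<forall>\<^sub>F n in sequentially. \<delta> n < 1" using \<delta>_lim by (rule order_tendstoD) simp
  have "(\<lambda>n. r\<^sup>2 * \<delta> n) \<longlonglongrightarrow> r\<^sup>2 * 0" by (intro tendsto_intros \<delta>_lim)
  then have ev2: "\<forall>\<^sub>F n in sequentially. r\<^sup>2 * \<delta> n < 1" by (rule order_tendstoD) simp
  show ?thesis
  proof (rule tendsto_0_le[OF bound_lim, where K=1])
    show "\<forall>\<^sub>F n in sequentially. cmod ((CLINT \<omega>|M n. indicator (box_event (M n) (walk_noise k n) i a b)
        \<omega> * iexp (t * walk_noise k n i \<omega>))
      - measure (M n) (box_event (M n) (walk_noise k n) i a b) * char std_normal_distribution t)
          \<le> norm (err n + \<bar>Pr n - exp (- (t\<^sup>2 / 2))\<bar>) * 1"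
      using ev1 ev2
    proof eventually_elim
      case (elim n)
      have sub: "A n \<inter> space (M n) = A n" unfolding A_def box_event_def by blast
      \<comment> \<open>The first \<open>i\<close> noises use grid times up to i/k only, hence the
        walk up to clock pulse \<open>Q n\<close>.\<close>
      have adA: "lazy_walk.adapted (M n) (X n) (Q n) (\<lambda>\<omega>. \<omega> \<in> A n)"
      proof (rule lazy_walk.adaptedI[OF W[of n]])
        fix \<omega> \<omega>' assume w: "\<omega> \<in> space (M n)" "\<omega>' \<in> space (M n)" "\<And>j. j \<le> Q n \<Longrightarrow> X n j \<omega> = X n j \<omega>'"
        have eq: "Yt n (real j / real k) \<omega> = Yt n (real j / real k) \<omega>'" if "j \<le> i" for j
        proof -
          have "clock n (real j / real k) \<le> Q n"
            unfolding Q_def using that by (intro lazy_walk.clock_mono[OF W[of n]] divide_right_mono)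
                auto
          then show ?thesis using w(3) by (simp add: lazy_walk.Yt_def[OF W[of n]] lazy_walk.Y_def[OF
              W[of n]])
        qed
        have "walk_noise k n j \<omega> = walk_noise k n j \<omega>'" if "j < i" for j
          unfolding walk_noise_def using eq[of j] eq[of "Suc j"] that by simp
        then show "(\<omega> \<in> A n) = (\<omega>' \<in> A n)" using w by (simp add: A_def box_event_def)
      qed
      have noise: "t * walk_noise k n i \<omega> = r * (Y n (Q n + m n) \<omega> - exp (- h) * Y n (Q n) \<omega>)" for \<omega>
        unfolding walk_noise_def lazy_walk.Yt_def[OF W[of n]] r_def \<sigma>_def h_def Qm by (simp add: Q_def)
      have ch: "char std_normal_distribution t = of_real (exp (- (t\<^sup>2 / 2)))"
        by (simp add: char_std_normal_distribution)
      define I where "I = (CLINT \<omega>|M n. indicator (A n) \<omega> * iexp (t * walk_noise k n i \<omega>))"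
      have 1: "cmod (I - of_real (measure (M n) (A n) * Pr n)) \<le> err n"
      proof -
        have "cmod (I - of_real (measure (M n) (A n) * Pr n)) \<le>
            real (m n) * (r\<^sup>2 * (\<delta> n)\<^sup>2 * ((start n)\<^sup>2 + 2 * \<delta> n * real (Q n + m n)) / 2
                + 4 * \<kappa> n * \<bar>r\<bar> ^ 3 * \<delta> n / 3)
          + \<bar>r\<bar> * \<bar>(1 - \<delta> n) ^ m n - exp (- h)\<bar> * (1 + (start n)\<^sup>2 + 2 * \<delta> n * real (Q n))"
          using lazy_walk.walk_increment_char[OF W[of n] adA, of r "m n" "exp (- h)"] elim
          unfolding I_def noise sub Pr_def by simp
        also have "\<dots> = err n" by (simp add: err_def power2_eq_square algebra_simps add_divide_distrib)
        finally show ?thesis .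
      qed
      have 2: "cmod (of_real (measure (M n) (A n) * Pr n) - of_real (measure (M n) (A n)) * of_real
          (exp (- (t\<^sup>2 / 2)))) \<le> \<bar>Pr n - exp (- (t\<^sup>2 / 2))\<bar>"
      proof -
        have "cmod (of_real (measure (M n) (A n) * Pr n) - of_real (measure (M n) (A n)) * of_real
            (exp (- (t\<^sup>2 / 2))))
            = \<bar>measure (M n) (A n) * (Pr n - exp (- (t\<^sup>2 / 2)))\<bar>"
          by (simp only: of_real_mult[symmetric] of_real_diff[symmetric] norm_of_real
              right_diff_distrib)
        also have "\<dots> \<le> 1 * \<bar>Pr n - exp (- (t\<^sup>2 / 2))\<bar>"
          unfolding abs_mult using prob_space.prob_le_1[OF M_prob, of n "A n"]
              by (intro mult_right_mono) auto
        finally show ?thesis by simp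
      qed
      have "cmod (I - measure (M n) (A n) * char std_normal_distribution t) \<le> err n + \<bar>Pr n
          - exp (- (t\<^sup>2 / 2))\<bar>"
        unfolding ch using norm_triangle_ineq[of "I - of_real (measure (M n) (A n) * Pr n)"
            "of_real (measure (M n) (A n) * Pr n) - of_real (measure (M n) (A n)) * of_real
                (exp (- (t\<^sup>2 / 2)))"] 1 2
        by simp
      also have "\<dots> \<le> norm (err n + \<bar>Pr n - exp (- (t\<^sup>2 / 2))\<bar>) * 1" by simp
      finally show ?case by (simp only: I_def A_def)
    qed
  qed
qed

text \<open>The exact counterpart for the limit: the earlier noises are measurable at time i/k, so
  \<open>increment_char\<close> applies with equality.\<close>

lemma ou_noise_char:
  assumes k: "0 < k"
  shows "(CLINT \<omega>|N. indicator (box_event N (ou_noise k) i a b) \<omega> * iexp (t * ou_noise k i \<omega>))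
    = prob (box_event N (ou_noise k) i a b) * char std_normal_distribution t"
proof -
  define h where "h = 1 / real k"
  define r where "r = t / sqrt (1 - exp (- 2 * h))"
  define s where "s = real i / real k"
  define T where "T = real (Suc i) / real k"
  have sT: "0 \<le> s" "s \<le> T" by (simp_all add: s_def T_def divide_right_mono)
  have Ts: "s - T = - h" by (simp add: s_def T_def h_def diff_divide_distrib[symmetric])
  let ?F = "natural_filtration N U s"
  have "{\<omega> \<in> space ?F. \<forall>j\<in>{..<i}. a j < ou_noise k j \<omega> \<and> ou_noise k j \<omega> \<le> b j} \<in> sets ?F"
  proof (rule sets.sets_Collect_finite_All)
    fix j assume "j \<in> {..<i}"
    then have "real (Suc j) / real k \<le> s" "real j / real k \<le> s"
      unfolding s_def by (auto intro!: divide_right_mono)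
    then have [measurable]: "U (real (Suc j) / real k) \<in> borel_measurable ?F" "U (real j / real k) \<in>
        borel_measurable ?F"
      by (auto intro!: natural_filtration_measurable)
    have [measurable]: "ou_noise k j \<in> borel_measurable ?F"
      unfolding ou_noise_def[abs_def] by measurable
    show "{\<omega> \<in> space ?F. a j < ou_noise k j \<omega> \<and> ou_noise k j \<omega> \<le> b j} \<in> sets ?F" by measurable
  qed simp
  moreover have "box_event N (ou_noise k) i a b = {\<omega> \<in> space ?F. \<forall>j\<in>{..<i}. a j < ou_noise k j \<omega>
      \<and> ou_noise k j \<omega> \<le> b j}"
    unfolding box_event_def space_natural_filtration by blast
  ultimately have A: "box_event N (ou_noise k) i a b \<in> sets ?F" by (simp only:)
  have noise: "t * ou_noise k i \<omega> = r * (U T \<omega> - exp (s - T) * U s \<omega>)" for \<omega>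
    unfolding Ts unfolding ou_noise_def r_def h_def s_def T_def by simp
  have "r\<^sup>2 * (1 - exp (2 * (s - T))) / 2 = t\<^sup>2 / 2"
    unfolding Ts r_def h_def using scaled_variance(2)[OF k, of t] by simp
  then show ?thesis
    unfolding noise increment_char[OF A sT] by (simp add: char_std_normal_distribution)
qed

text \<open>Both sides are compared with the same product of normal masses. For the limit process
  \<open>box_probability_tendsto\<close> is applied to a constant sequence, whose limit is its
  value.\<close>

lemma box_probabilities:
  assumes k: "0 < k" and ab: "\<And>j. a j \<le> b j"
  shows "(\<lambda>n. measure (M n) (box_event (M n) (walk_noise k n) i a b))
      \<longlonglongrightarrow> prob (box_event N (ou_noise k) i a b)"
proof -
  have 1: "(\<lambda>n. measure (M n) (box_event (M n) (walk_noise k n) i a b))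
      \<longlonglongrightarrow> (\<Prod>j<i. cdf std_normal_distribution (b j) - cdf std_normal_distribution (a j))"
    by (rule box_probability_tendsto[OF M_prob walk_noise_measurable real_dist_normal_dist
        isCont_cdf_std_normal walk_noise_char[OF k] ab])
  have "(\<lambda>n::nat. prob (box_event N (ou_noise k) i a b)) \<longlonglongrightarrow> (\<Prod>j<i. cdf std_normal_distribution (b j)
      - cdf std_normal_distribution (a j))"
    by (rule box_probability_tendsto[where M="\<lambda>_. N" and W="\<lambda>_. ou_noise k", OF prob_space_axioms
        ou_noise_measurable real_dist_normal_dist isCont_cdf_std_normal _ ab])
       (simp only: ou_noise_char[OF k] diff_self tendsto_const)
  from LIMSEQ_unique[OF this tendsto_const] 1 show ?thesis by simp
qed

text \<open>Grid values are rebuilt from the noises by \<open>autoregression\<close>. In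
  \<open>G\<close> the recursion starts from the limiting point \<open>u\<close>, so only the noises
  vary; the true start of the walk is restored at a Lipschitz cost.\<close>

lemma grid_expectation_tendsto:
  fixes F :: "(nat \<Rightarrow> real) \<Rightarrow> real"
  assumes k: "0 < k" and F: "\<And>x y. \<bar>F x - F y\<bar> \<le> L * (\<Sum>j\<le>n. \<bar>x j - y j\<bar>)" and F_bound: "\<And>x. \<bar>F x\<bar> \<le> B"
  shows "(\<lambda>d. \<integral>\<omega>. F (\<lambda>j. Yt d (real j / real k) \<omega>) \<partial>M d) \<longlonglongrightarrow> (\<integral>\<omega>. F (\<lambda>j. U (real j / real k) \<omega>) \<partial>N)"
proof -
  define c where "c = exp (- (1 / real k))"
  define \<sigma> where "\<sigma> = sqrt (1 - exp (- 2 * (1 / real k)))"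
  have c: "0 \<le> c" "c \<le> 1" by (simp_all add: c_def)
  have \<sigma>: "0 < \<sigma>" "\<sigma> \<le> 1" using scaled_variance(1)[OF k] by (simp_all add: \<sigma>_def)
  define G where "G w = F (autoregression c u (\<lambda>i. \<sigma> * w i))" for w
  define L' where "L' = \<bar>L\<bar> * real (Suc n)"
  have F': "\<bar>F x - F y\<bar> \<le> L' * q" if "\<And>j. j \<le> n \<Longrightarrow> \<bar>x j - y j\<bar> \<le> q" for x y q
  proof -
    have "(\<Sum>j\<le>n. \<bar>x j - y j\<bar>) \<le> (\<Sum>j\<le>n. q)" using that by (intro sum_mono) auto
    then have "\<bar>L\<bar> * (\<Sum>j\<le>n. \<bar>x j - y j\<bar>) \<le> \<bar>L\<bar> * (real (Suc n) * q)" by (intro mult_left_mono) auto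
    moreover have "L * (\<Sum>j\<le>n. \<bar>x j - y j\<bar>) \<le> \<bar>L\<bar> * (\<Sum>j\<le>n. \<bar>x j - y j\<bar>)"
        by (intro mult_right_mono sum_nonneg) auto
    ultimately show ?thesis using F[of x y] by (simp add: L'_def mult.assoc)
  qed
  have G: "\<bar>G w - G w'\<bar> \<le> L' * (\<Sum>i<n. \<bar>w i - w' i\<bar>)" for w w'
    unfolding G_def
  proof (rule F')
    fix j assume "j \<le> n"
    have "\<bar>autoregression c u (\<lambda>i. \<sigma> * w i) j - autoregression c u (\<lambda>i. \<sigma> * w' i) j\<bar>
        \<le> \<bar>u - u\<bar> + (\<Sum>i<j. \<bar>\<sigma> * w i - \<sigma> * w' i\<bar>)"
      by (rule autoregression_lipschitz[OF c])
    also have "\<dots> \<le> (\<Sum>i<j. \<bar>w i - w' i\<bar>)"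
    proof -
      have "\<bar>\<sigma> * w i - \<sigma> * w' i\<bar> \<le> \<bar>w i - w' i\<bar>" for i
        using \<sigma> mult_right_mono[of \<sigma> 1 "\<bar>w i - w' i\<bar>"]
            by (simp add: right_diff_distrib[symmetric] abs_mult)
      then show ?thesis by (simp add: sum_mono)
    qed
    also have "\<dots> \<le> (\<Sum>i<n. \<bar>w i - w' i\<bar>)" using \<open>j \<le> n\<close> by (intro sum_mono2) auto
    finally show "\<bar>autoregression c u (\<lambda>i. \<sigma> * w i) j - autoregression c u (\<lambda>i. \<sigma> * w' i) j\<bar>
        \<le> (\<Sum>i<n. \<bar>w i - w' i\<bar>)" .
  qed
  have walk_inc: "\<sigma> * walk_noise k d i \<omega> = Yt d (real (Suc i) / real k) \<omega> - c * Yt d (real i / real k)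
      \<omega>" for d i \<omega>
    unfolding walk_noise_def c_def[symmetric] \<sigma>_def[symmetric] using \<sigma> by simp
  have ou_inc: "\<sigma> * ou_noise k i \<omega> = U (real (Suc i) / real k) \<omega> - c * U (real i / real k) \<omega>" for i \<omega>
    unfolding ou_noise_def c_def[symmetric] \<sigma>_def[symmetric] using \<sigma> by simp
  have Y_eq: "(\<lambda>j. Yt d (real j / real k) \<omega>) = autoregression c (Yt d 0 \<omega>) (\<lambda>i. \<sigma> * walk_noise k d i \<omega>)"
      for d \<omega>
    unfolding walk_inc
    using autoregression_increments[of c "\<lambda>j. Yt d (real j / real k) \<omega>"] by (intro ext) simp
  have U_eq: "(\<lambda>j. U (real j / real k) \<omega>) = autoregression c (U 0 \<omega>) (\<lambda>i. \<sigma> * ou_noise k i \<omega>)" for \<omega>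
    unfolding ou_inc
    using autoregression_increments[of c "\<lambda>j. U (real j / real k) \<omega>"] by (intro ext) simp
  have mG: "(\<lambda>\<omega>. G (\<lambda>j. walk_noise k d j \<omega>)) \<in> borel_measurable (M d)" for d
    by (rule lipschitz_sum_measurable[OF G _ walk_noise_measurable]) simp
  have mGU: "(\<lambda>\<omega>. G (\<lambda>j. ou_noise k j \<omega>)) \<in> borel_measurable N"
    by (rule lipschitz_sum_measurable[OF G _ ou_noise_measurable]) simp
  have mF: "(\<lambda>\<omega>. F (\<lambda>j. Yt d (real j / real k) \<omega>)) \<in> borel_measurable (M d)" for d
    by (rule lipschitz_sum_measurable[OF F _ lazy_walk.Yt_measurable[OF W]]) simp
  have lim: "(\<lambda>d. \<integral>\<omega>. G (\<lambda>j. walk_noise k d j \<omega>) \<partial>M d) \<longlonglongrightarrow> (\<integral>\<omega>. G (\<lambda>j. ou_noise k j \<omega>) \<partial>N)"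
    by (rule lipschitz_expectation_tendsto[OF M_prob walk_noise_measurable prob_space_axioms
        ou_noise_measurable
          box_probabilities[OF k] G _ mG mGU, where B=B]) (simp_all add: G_def F_bound)
  have U_lim: "(\<integral>\<omega>. G (\<lambda>j. ou_noise k j \<omega>) \<partial>N) = (\<integral>\<omega>. F (\<lambda>j. U (real j / real k) \<omega>) \<partial>N)"
  proof (rule integral_cong_AE[OF mGU])
    show "(\<lambda>\<omega>. F (\<lambda>j. U (real j / real k) \<omega>)) \<in> borel_measurable N"
      by (rule lipschitz_sum_measurable[OF F _ measurable_U]) simp_all
    show "AE \<omega> in N. G (\<lambda>j. ou_noise k j \<omega>) = F (\<lambda>j. U (real j / real k) \<omega>)"
      using start_U by eventually_elim (simp add: G_def U_eq)
  qed
  \<comment> \<open>Same noises, different starting points: the recursion keeps the initial gap from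
    growing.\<close>
  have diff: "\<bar>(\<integral>\<omega>. F (\<lambda>j. Yt d (real j / real k) \<omega>) \<partial>M d) - (\<integral>\<omega>. G (\<lambda>j. walk_noise k d j \<omega>) \<partial>M d)\<bar>
      \<le> L' * \<bar>start d - u\<bar>" for d
  proof -
    interpret Md: prob_space "M d" by (rule M_prob)
    have iF: "integrable (M d) (\<lambda>\<omega>. F (\<lambda>j. Yt d (real j / real k) \<omega>))"
      using F_bound by (intro Md.integrable_const_bound[where B=B] AE_I2 mF) simp
    have iG: "integrable (M d) (\<lambda>\<omega>. G (\<lambda>j. walk_noise k d j \<omega>))"
      using F_bound by (intro Md.integrable_const_bound[where B=B] AE_I2 mG) (simp add: G_def)
    have "AE \<omega> in M d. X d 0 \<omega> = x d"
      using lazy_walk.walk[OF W, of d] by (simp add: lnnrw_def)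
    then have pw: "AE \<omega> in M d. \<bar>F (\<lambda>j. Yt d (real j / real k) \<omega>) - G (\<lambda>j. walk_noise k d j \<omega>)\<bar>
        \<le> L' * \<bar>start d - u\<bar>"
    proof eventually_elim
      case (elim \<omega>)
      have Y0: "Yt d 0 \<omega> = start d"
        using elim by (simp add: lazy_walk.Yt_def[OF W] lazy_walk.Y_def[OF W] lazy_walk.clock_def[OF W])
      show ?case
        unfolding Y_eq G_def Y0
      proof (rule F')
        show "\<bar>autoregression c (start d) (\<lambda>i. \<sigma> * walk_noise k d i \<omega>) j
            - autoregression c u (\<lambda>i. \<sigma> * walk_noise k d i \<omega>) j\<bar> \<le> \<bar>start d - u\<bar>" for j
          using autoregression_lipschitz[OF c, of "start d" "\<lambda>i. \<sigma> * walk_noise k d i \<omega>" j u "\<lambda>i. \<sigma> *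
              walk_noise k d i \<omega>"] by simp
      qed
    qed
    have "\<bar>(\<integral>\<omega>. F (\<lambda>j. Yt d (real j / real k) \<omega>) - G (\<lambda>j. walk_noise k d j \<omega>) \<partial>M d)\<bar>
        \<le> (\<integral>\<omega>. \<bar>F (\<lambda>j. Yt d (real j / real k) \<omega>) - G (\<lambda>j. walk_noise k d j \<omega>)\<bar> \<partial>M d)"
      by (rule integral_abs_bound)
    also have "\<dots> \<le> (\<integral>\<omega>. L' * \<bar>start d - u\<bar> \<partial>M d)"
      using iF iG pw by (intro integral_mono_AE) auto
    finally show ?thesis using iF iG by (simp add: Md.prob_space)
  qed
  have "(\<lambda>d. (\<integral>\<omega>. F (\<lambda>j. Yt d (real j / real k) \<omega>) \<partial>M d) - (\<integral>\<omega>. G (\<lambda>j. walk_noise k d j \<omega>) \<partial>M d)) \<longlonglongrightarrow> 0"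
  proof (rule tendsto_0_le[where K=1])
    have "(\<lambda>d. L' * \<bar>start d - u\<bar>) \<longlonglongrightarrow> L' * \<bar>u - u\<bar>" by (intro tendsto_intros start_lim)
    then show "(\<lambda>d. L' * \<bar>start d - u\<bar>) \<longlonglongrightarrow> 0" by simp
  qed (intro always_eventually allI, use diff in \<open>simp add: order_trans[OF _ abs_ge_self]\<close>)
  from tendsto_add[OF this lim] show ?thesis by (simp add: U_lim)
qed

text \<open>For fixed \<open>k\<close> and growing \<open>n\<close>, \<open>q\<close> tends to 1/k
  and \<kappa> to 0, so the bound of \<open>modulus_event\<close> tends to (T + 1/k) C / k. This is
  small for large \<open>k\<close>, thanks to the quadratic dependence on \<open>q\<close> of the
  terms without \<kappa>.\<close>

lemma modulus_tendsto:
  fixes T :: nat and e :: real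
  assumes e: "0 < e"
  shows "\<forall>\<^sub>F k in sequentially. \<forall>\<^sub>F n in sequentially. \<exists>A\<in>sets (M n). measure (M n) A \<le> e \<and>
    (\<forall>\<omega>\<in>space (M n) - A. \<forall>t\<in>{0..real T}. \<bar>Yt n t \<omega> - sampled k (\<lambda>t. Yt n t \<omega>) t\<bar> \<le> e)"
proof -
  define bound where "bound k q \<kappa> P = real (k * T + 1) * ((32 * q\<^sup>2 + 96 * \<kappa>\<^sup>2 * q) / (e / 2) ^ 4
      + q\<^sup>2 * (P\<^sup>2 + 2 * (real T + 1)) / (e / 2)\<^sup>2)"
    for k and q \<kappa> P :: real
  \<comment> \<open>The coefficient of q^2 in the limiting bound for a single interval.\<close>
  define C where "C = 32 / (e / 2) ^ 4 + (u\<^sup>2 + 2 * (real T + 1)) / (e / 2)\<^sup>2"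
  have "(\<lambda>k. (real T + inverse (real (Suc k))) * C * inverse (real (Suc k))) \<longlonglongrightarrow> (real T + 0) * C * 0"
    by (intro tendsto_intros LIMSEQ_inverse_real_of_nat)
  then have "\<forall>\<^sub>F k in sequentially. (real T + inverse (real (Suc k))) * C * inverse (real (Suc k)) < e"
    using e by (intro order_tendstoD(2)) auto
  then have ev: "\<forall>\<^sub>F k in sequentially. \<forall>\<^sub>F n in sequentially. \<exists>A\<in>sets (M n). measure (M n) A \<le> e \<and>
    (\<forall>\<omega>\<in>space (M n) - A. \<forall>t\<in>{0..real T}. \<bar>Yt n t \<omega> - sampled (Suc k) (\<lambda>t. Yt n t \<omega>) t\<bar> \<le> e)"
  proof eventually_elim
    case (elim k)
    have "(\<lambda>n. bound (Suc k) (1 / real (Suc k) + \<delta> n) (\<kappa> n) (start n)) \<longlonglongrightarrow> bound (Suc k) (1 / real (Suc k)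
        + 0) 0 u"
      unfolding bound_def by (intro tendsto_intros \<delta>_lim \<kappa>_lim start_lim) (use e in auto)
    also have "bound (Suc k) (1 / real (Suc k) + 0) 0 u = (real T + inverse (real (Suc k))) * C *
        inverse (real (Suc k))"
    proof -
      have "(s * real T + 1) * ((32 * (1 / s + 0)\<^sup>2 + 96 * 0\<^sup>2 * (1 / s + 0)) / a + (1 / s
          + 0)\<^sup>2 * c / b) = (real T + inverse s) * (32 / a + c / b) * inverse s"
        if "s \<noteq> 0" "a \<noteq> 0" "b \<noteq> 0" for s a b c :: real
        using that by (simp add: field_simps power2_eq_square)
      moreover have "real (Suc k * T + 1) = real (Suc k) * real T + 1" by (simp add: algebra_simps)
      ultimately show ?thesis using e by (simp only: bound_def C_def) simp
    qed
    finally have "\<forall>\<^sub>F n in sequentially. bound (Suc k) (1 / real (Suc k) + \<delta> n) (\<kappa> n) (start n) < e"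
      using elim by (rule order_tendstoD(2))
    then show ?case
    proof eventually_elim
      case (elim n)
      have "0 < Suc k" by simp
      from lazy_walk.modulus_event[OF W this e, of n T] elim show ?case
        unfolding bound_def by (meson order_trans less_imp_le)
    qed
  qed
  \<comment> \<open>The estimate was made for mesh \<open>1 / real (Suc k)\<close> to avoid division
    by 0; the index is shifted back.\<close>
  from ev show ?thesis by (rule eventually_sequentially_Suc[THEN iffD1])
qed

lemma walk_converges_weakly: "weakly_converges skorokhod (\<lambda>n. path_law (M n) (Yt n)) (path_law N U)"
proof (rule weakly_converges_skorokhodI)
  show "(\<lambda>\<omega>. \<lambda>t\<in>{0..}. Yt n t \<omega>) \<in> M n \<rightarrow>\<^sub>M borel_of_topology skorokhod" for n
    by (rule lazy_walk.Yt_path_measurable[OF W])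
  show "Yt n t \<in> borel_measurable (M n)" for n t by (rule lazy_walk.Yt_measurable[OF W])
  show "continuous_on {0..} (\<lambda>t. U t \<omega>)" if "\<omega> \<in> space N" for \<omega> by (rule continuous_U[OF that])
qed (fact M_prob prob_space_axioms measurable_U grid_expectation_tendsto modulus_tendsto)+

end

text \<open>Lets the theorem be proved for positive dimensions, where its hypotheses on the walks
  apply.\<close>

lemma weakly_converges_Suc:
  assumes "weakly_converges S (\<lambda>n. \<mu> (Suc n)) \<nu>"
  shows "weakly_converges S \<mu> \<nu>"
  using assms unfolding weakly_converges_def
  by (simp add: eventually_sequentially_Suc[of "\<lambda>n. prob_space (\<mu> n) \<and> sets (\<mu> n)
      = sets (borel_of_topology S)"] filterlim_sequentially_Suc[of "\<lambda>n. \<integral>x. _ x \<partial>\<mu> n"])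

theorem theorem2p2:
  fixes p :: "nat \<Rightarrow> real"
    and \<theta> x :: "nat \<Rightarrow> nat \<Rightarrow> real"
    and M :: "nat \<Rightarrow> 'a measure"
    and X :: "nat \<Rightarrow> nat \<Rightarrow> 'a \<Rightarrow> nat \<Rightarrow> real"
    and N :: "'b measure"
    and U :: "real \<Rightarrow> 'b \<Rightarrow> real"
    and u :: real
  assumes "\<And>d. d \<ge> 1 \<Longrightarrow> 0 < p d \<and> p d \<le> 1"
    and "\<And>d. d \<ge> 1 \<Longrightarrow> L2_set (\<theta> d) {..<d} = 1"
    and "\<And>d. d \<ge> 1 \<Longrightarrow> x d \<in> hypercube d"
    and "\<And>d. d \<ge> 1 \<Longrightarrow> lnnrw d (p d) (x d) (M d) (X d)"
    and "ornstein_uhlenbeck_from u N U"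
    and "(\<lambda>d. \<Sum>i<d. \<theta> d i * x d i) \<longlonglongrightarrow> u"
    and "(\<lambda>d. MAX i\<in>{..<d}. \<bar>\<theta> d i\<bar>) \<longlonglongrightarrow> 0"
  shows "weakly_converges skorokhod
           (\<lambda>d. path_law (M d) (\<lambda>t \<omega>. \<Sum>i<d. \<theta> d i * lnnrw_at d (p d) (X d) t \<omega> i))
           (path_law N U)"
proof (rule weakly_converges_Suc)
  define \<kappa> where "\<kappa> d = (MAX i\<in>{..<d}. \<bar>\<theta> d i\<bar>)" for d
  have walks: "lazy_walk (M d) d (p d) (x d) (X d) (\<theta> d) (\<kappa> d)" if d: "1 \<le> d" for d
  proof -
    have "prob_space (M d)" using assms(4)[OF d] by (simp add: lnnrw_def)
    moreover have "(\<Sum>i<d. (\<theta> d i)\<^sup>2) = 1" using assms(2)[OF d] by (simp add: L2_set_def)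
    moreover have "\<bar>\<theta> d i\<bar> \<le> \<kappa> d" if "i < d" for i
      unfolding \<kappa>_def using that by (intro Max_ge) auto
    ultimately show ?thesis
      using assms(1)[OF d] assms(4)[OF d] d by (simp add: lazy_walk_def lazy_walk_axioms_def)
  qed
  have "prob_space N" using assms(5) by (simp add: ornstein_uhlenbeck_from_def diffusion_from_def)
  \<comment> \<open>As p \<le> 1, the pulse spacing 2 p / d is at most 2 / d.\<close>
  moreover have "(\<lambda>n. lazy_walk.\<delta> (Suc n) (p (Suc n))) \<longlonglongrightarrow> 0"
  proof (rule tendsto_0_le[OF LIMSEQ_inverse_real_of_nat, where K=2], intro always_eventually allI)
    fix n
    have "0 \<le> p (Suc n)" "p (Suc n) \<le> 1" using assms(1)[of "Suc n"] by auto
    then show "norm (lazy_walk.\<delta> (Suc n) (p (Suc n))) \<le> norm (inverse (real (Suc n))) * 2"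
      using lazy_walk.\<delta>_def[OF walks[of "Suc n"]] by (simp add: field_simps)
  qed
  moreover have "(\<lambda>n. \<kappa> (Suc n)) \<longlonglongrightarrow> 0"
    using assms(7) unfolding \<kappa>_def by (rule LIMSEQ_Suc)
  moreover have "(\<lambda>n. lazy_walk.proj (Suc n) (\<theta> (Suc n)) (x (Suc n))) \<longlonglongrightarrow> u"
    using LIMSEQ_Suc[OF assms(6)] lazy_walk.proj_def[OF walks[of "Suc _"]] by simp
  ultimately interpret walk_limit N U u "\<lambda>n. M (Suc n)" Suc "\<lambda>n. p (Suc n)" "\<lambda>n. x (Suc n)" "\<lambda>n. X
      (Suc n)"
    "\<lambda>n. \<theta> (Suc n)" "\<lambda>n. \<kappa> (Suc n)"
    using walks assms(5)
    by (intro walk_limit.intro walk_limit_axioms.intro ou_process.intro ou_process_axioms.intro) auto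
  have "(\<lambda>t \<omega>. \<Sum>i<Suc n. \<theta> (Suc n) i * lnnrw_at (Suc n) (p (Suc n)) (X (Suc n)) t \<omega> i) = Yt n" for n
    using lazy_walk.Yt_eq[OF walks[of "Suc n"]] by (intro ext) simp
  then show "weakly_converges skorokhod
      (\<lambda>n. path_law (M (Suc n)) (\<lambda>t \<omega>. \<Sum>i<Suc n. \<theta> (Suc n) i * lnnrw_at (Suc n) (p (Suc n)) (X (Suc n))
          t \<omega> i)) (path_law N U)"
    using walk_converges_weakly by (simp only:)
qed

end
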